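(* Let $\beta_1,\beta_2,\gamma_1,\gamma_2\in\mathbb{Z}[i]$ with $\gamma_1,\gamma_2\neq 0$ and $\gcd(\beta_1,\gamma_1)=\gcd(\beta_2,\gamma_2)=1$. Then the set $$\Big\{\frac{\pi_1}{\pi_2} : \pi_1,\pi_2 \text{ are Gaussian primes with } \pi_1\equiv\beta_1 \pmod{\gamma_1} \text{ and } \pi_2\equiv\beta_2 \pmod{\gamma_2}\Big\}$$ is dense in $\mathbb{C}$.
   Context: The Gaussian integers are $\mathbb{Z}[i]=\{a+bi : a,b\in\mathbb{Z}\}$, a unique factorization domain with units $\pm1,\pm i$. A Gaussian prime is a prime element of $\mathbb{Z}[i]$, i.e. a nonzero nonunit $\pi$ such that $\pi\mid\alpha\beta$ implies $\pi\mid\alpha$ or $\pi\mid\beta$. For $\alpha,\beta,\gamma\in\mathbb{Z}[i]$, $\alpha\equiv\beta \pmod{\gamma}$ means $\gamma\mid(\beta-\alpha)$ in $\mathbb{Z}[i]$; $\gcd(\beta,\gamma)=1$ means $\beta$ and $\gamma$ have no common nonunit divisor in $\mathbb{Z}[i]$. *)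

theory Defs
  imports "HOL-Complex_Analysis.Complex_Analysis" "HOL-Computational_Algebra.Computational_Algebra"
begin

datatype gauss_int = Gauss_Int (ReZ: int) (ImZ: int)

lemma gauss_int_eq_iff: "x = y \<longleftrightarrow> ReZ x = ReZ y \<and> ImZ x = ImZ y"
  by (cases x; cases y) auto

instantiation gauss_int :: comm_ring_1
begin

definition "0 = Gauss_Int 0 0"
definition "1 = Gauss_Int 1 0"
definition "x + y = Gauss_Int (ReZ x + ReZ y) (ImZ x + ImZ y)"
definition "x - y = Gauss_Int (ReZ x - ReZ y) (ImZ x - ImZ y)"
definition "- x = Gauss_Int (- ReZ x) (- ImZ x)"
definition "x * y =
  Gauss_Int (ReZ x * ReZ y - ImZ x * ImZ y) (ReZ x * ImZ y + ImZ x * ReZ y)"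

instance
  by standard
     (auto simp: zero_gauss_int_def one_gauss_int_def plus_gauss_int_def minus_gauss_int_def
        uminus_gauss_int_def times_gauss_int_def algebra_simps gauss_int_eq_iff)

end

definition complex_of_gauss_int :: "gauss_int \<Rightarrow> complex" where
  "complex_of_gauss_int z = Complex (of_int (ReZ z)) (of_int (ImZ z))"

lemma complex_of_gauss_int_mult:
  "complex_of_gauss_int (x * y) = complex_of_gauss_int x * complex_of_gauss_int y"
  by (simp add: complex_of_gauss_int_def times_gauss_int_def complex_eq_iff)

lemma complex_of_gauss_int_eq_0_iff: "complex_of_gauss_int x = 0 \<longleftrightarrow> x = 0"
  by (simp add: complex_of_gauss_int_def zero_gauss_int_def complex_eq_iff gauss_int_eq_iff)

instance gauss_int :: idom
proof
  fix x y :: gauss_int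
  assume "x \<noteq> 0" "y \<noteq> 0"
  then show "x * y \<noteq> 0"
    by (metis complex_of_gauss_int_eq_0_iff complex_of_gauss_int_mult mult_eq_0_iff)
qed

(* The library constant coprime lives in the class algebraic_semidom, which requires a division
   operator that is exact whenever the divisor divides the dividend.  The one below rounds both
   coordinates of the complex quotient to a nearest integer (with x div 0 = 0); the definitions of
   dvd, prime_elem and coprime do not mention it. *)
definition round_div :: "int \<Rightarrow> int \<Rightarrow> int" where
  "round_div a n = (2 * a + n) div (2 * n)"

lemma round_div_exact:
  assumes n: "n > 0"
  shows "round_div (a * n) n = a"
proof -
  have "2 * (a * n) + n = n + a * (2 * n)" by (simp add: algebra_simps)
  moreover have "(n + a * (2 * n)) div (2 * n) = a + n div (2 * n)"
    using n by (intro div_mult_self1) auto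
  moreover have "n div (2 * n) = 0"
    using n by (intro div_pos_pos_trivial) auto
  ultimately show ?thesis by (simp only: round_div_def)
qed

instantiation gauss_int :: idom_divide
begin

definition "x div y =
  (let n = (ReZ y)\<^sup>2 + (ImZ y)\<^sup>2
   in Gauss_Int (round_div (ReZ x * ReZ y + ImZ x * ImZ y) n)
                (round_div (ImZ x * ReZ y - ReZ x * ImZ y) n))"

instance
proof
  fix a b :: gauss_int
  assume b: "b \<noteq> 0"
  define n where "n = (ReZ b)\<^sup>2 + (ImZ b)\<^sup>2"
  have n: "n > 0"
    using b by (auto simp: n_def gauss_int_eq_iff zero_gauss_int_def sum_power2_gt_zero_iff)
  have "ReZ (a * b) * ReZ b + ImZ (a * b) * ImZ b = ReZ a * n"
    and "ImZ (a * b) * ReZ b - ReZ (a * b) * ImZ b = ImZ a * n"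
    by (auto simp: n_def times_gauss_int_def algebra_simps power2_eq_square)
  then show "a * b div b = a"
    using n by (simp add: divide_gauss_int_def n_def [symmetric] round_div_exact Let_def)
next
  fix a :: gauss_int
  show "a div 0 = 0"
    by (simp add: divide_gauss_int_def round_div_def zero_gauss_int_def)
qed

end

instance gauss_int :: algebraic_semidom ..

end

theory Submission
  imports Defs "HOL-Probability.Sinc_Integral" "HOL-Real_Asymp.Real_Asymp"
begin

text \<open>For a character \<open>\<phi>\<close> modulo \<open>\<gamma>\<close> and \<open>k \<in> \<int>\<close> put \<open>\<psi>(a) = \<phi>(a) (a/|a|)^k\<close>. The Hecke series
  \<open>L(s) = \<Sum> \<psi>(a) N(a)^(-s)\<close> continues to \<open>Re s > 0\<close>, with a simple pole at 1 exactly for the principal character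
  and \<open>k = 0\<close>: adding up \<open>2 f(l a) - f(l a + \<gamma> d) - f(l a - \<gamma> d)\<close>, where \<open>f\<close> is the summand and \<open>d\<close> runs over
  the residues modulo \<open>l\<close>, yields \<open>L\<close> times an explicit factor, and these second differences decay fast enough to
  converge for \<open>Re s > 0\<close>. On the line \<open>Re s = 1\<close>, \<open>L\<close> does not vanish, by the 3-4-1 inequality and, for real characters
  at 1, by a Landau-type argument. Orthogonality of characters then describes the boundary behaviour of
  \<open>\<Sum> ln N(\<pi>) (\<pi>/|\<pi>|)^k N(\<pi>)^(-s)\<close>, taken over the primes \<open>\<pi>\<close> congruent to \<open>\<beta>\<close> modulo \<open>\<gamma>\<close>.
  As in the Wiener-Ikehara method, these sums are tested against a kernel in \<open>ln N(\<pi>)\<close> and \<open>\<pi>/|\<pi>|\<close> that is band-limited in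
  both variables, has positive mean, and is positive only near a prescribed point. So primes in the residue class exist with
  \<open>\<pi>/|\<pi>|\<close> near any direction and \<open>ln N(\<pi>)\<close> near every large real number. Choosing \<open>\<pi>2\<close> near the
  positive real axis and \<open>\<pi>1\<close> with \<open>|\<pi>1|\<close> near \<open>|z| |\<pi>2|\<close> and direction near that of \<open>z\<close> brings the quotient near \<open>z\<close>.\<close>

section \<open>Arithmetic of the Gaussian integers\<close>

text \<open>Second differences, rather than first ones, are dictated by the Landau-type argument. A
  first difference of the summand has order \<open>N(a)^(-s-1/2)\<close>, summable over a
  two-dimensional lattice only for \<open>Re s > 1/2\<close>; a second difference gains a full power
  of \<open>N(a)\<close>. The argument for real characters lets \<open>s\<close> decrease to 1/2 and
  uses finite values there, so the half plane \<open>Re s > 1/2\<close> would be just too small. The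
  explicit factor is \<open>N(l) psi(l) N(l)^(-s) - 1\<close>; for the principal character it
  vanishes at 1 and cancels the pole. The kernel is a trigonometric polynomial in the direction, so
  only finitely many exponents \<open>k\<close> enter at a time. In \<open>ln N(\<pi>)\<close> its
  Fourier transform has compact support, so only a bounded segment of \<open>Re s = 1\<close>
  enters, and continuity there is all that is asked of the series. The price is that such a kernel
  cannot vanish outside a small window. It is allowed to be negative there: a positive mean together
  with nonpositive values outside the window forces a prime inside it.\<close>

abbreviation (input) cg :: "gauss_int \<Rightarrow> complex" where
  "cg \<equiv> complex_of_gauss_int"

definition gnorm :: "gauss_int \<Rightarrow> nat" where
  "gnorm x = nat ((ReZ x)\<^sup>2 + (ImZ x)\<^sup>2)"

lemma cg_simps [simp]:
  "cg (x * y) = cg x * cg y"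
  "cg 0 = 0" "cg 1 = 1" "cg (x + y) = cg x + cg y" "cg (x - y) = cg x - cg y" "cg (- x) = - cg x"
  by (rule complex_of_gauss_int_mult)
     (auto simp: complex_of_gauss_int_def zero_gauss_int_def
      one_gauss_int_def plus_gauss_int_def minus_gauss_int_def uminus_gauss_int_def complex_eq_iff)

lemma cg_power [simp]: "cg (x ^ n) = cg x ^ n"
  by (induction n) auto

lemma cg_eq_0_iff [simp]: "cg x = 0 \<longleftrightarrow> x = 0"
  by (rule complex_of_gauss_int_eq_0_iff)

lemma cg_eq_iff [simp]: "cg x = cg y \<longleftrightarrow> x = y"
  using cg_eq_0_iff[of "x - y"] by simp

lemma gnorm_cmod: "real (gnorm x) = (cmod (cg x))\<^sup>2"
  by (simp add: gnorm_def cmod_power2 complex_of_gauss_int_def)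

lemma gnorm_mult [simp]: "gnorm (x * y) = gnorm x * gnorm y"
proof -
  have "real (gnorm (x * y)) = real (gnorm x * gnorm y)"
    by (simp only: gnorm_cmod of_nat_mult cg_simps norm_mult power_mult_distrib)
  thus ?thesis by (simp only: of_nat_eq_iff)
qed

lemma gnorm_0 [simp]: "gnorm 0 = 0" and gnorm_1 [simp]: "gnorm 1 = 1"
  by (simp_all add: gnorm_def zero_gauss_int_def one_gauss_int_def)

lemma gnorm_power [simp]: "gnorm (x ^ n) = gnorm x ^ n"
  by (induction n) auto

lemma gnorm_eq_0_iff [simp]: "gnorm x = 0 \<longleftrightarrow> x = 0"
  using gnorm_cmod[of x] by auto

lemma gnorm_pos_iff [simp]: "0 < gnorm x \<longleftrightarrow> x \<noteq> 0"
  using gnorm_eq_0_iff[of x] by linarith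

lemma finite_gnorm_le: "finite {x. gnorm x \<le> n}"
proof -
  have "{x. gnorm x \<le> n} \<subseteq> (\<lambda>(a, b). Gauss_Int a b) ` ({- int n..int n} \<times> {- int n..int n})"
  proof
    fix x assume x: "x \<in> {x. gnorm x \<le> n}"
    have *: "(ReZ x)\<^sup>2 + (ImZ x)\<^sup>2 \<le> int n" using x by (simp add: gnorm_def nat_le_iff)
    have **: "\<bar>a\<bar> \<le> a\<^sup>2" for a :: int
      using self_le_power[of "\<bar>a\<bar>" 2] by (cases "a = 0") auto
    have "\<bar>ReZ x\<bar> \<le> int n" "\<bar>ImZ x\<bar> \<le> int n"
      using * **[of "ReZ x"] **[of "ImZ x"] zero_le_power2[of "ReZ x"] zero_le_power2[of "ImZ x"] by linarith+
    thus "x \<in> (\<lambda>(a, b). Gauss_Int a b) ` ({- int n..int n} \<times> {- int n..int n})"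
      by (intro image_eqI[of _ _ "(ReZ x, ImZ x)"]) auto
  qed
  thus ?thesis by (rule finite_subset) auto
qed

definition gcnj :: "gauss_int \<Rightarrow> gauss_int" where "gcnj x = Gauss_Int (ReZ x) (- ImZ x)"

lemma cg_gcnj [simp]: "cg (gcnj x) = cnj (cg x)"
  by (simp add: gcnj_def complex_of_gauss_int_def complex_eq_iff)

lemma cg_of_int [simp]: "cg (of_int n) = of_int n"
proof -
  have "cg (of_nat k) = of_nat k" for k by (induction k) auto
  thus ?thesis by (cases n) (auto simp: of_nat_diff)
qed

lemma cg_of_nat [simp]: "cg (of_nat n) = of_nat n"
  using cg_of_int[of "int n"] by simp

lemma mult_gcnj: "x * gcnj x = of_nat (gnorm x)"
proof -
  have "complex_of_real (real (gnorm x)) = cg x * cnj (cg x)"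
    by (simp only: gnorm_cmod complex_norm_square)
  hence "cg (x * gcnj x) = cg (of_nat (gnorm x))" by simp
  thus ?thesis by (simp only: cg_eq_iff)
qed

lemma gnorm_of_nat [simp]: "gnorm (of_nat n) = n ^ 2"
proof -
  have "real (gnorm (of_nat n)) = real (n\<^sup>2)" by (simp add: gnorm_cmod)
  thus ?thesis by linarith
qed

lemma is_unit_iff_gnorm: "is_unit x \<longleftrightarrow> gnorm x = 1"
proof
  assume "is_unit x"
  then obtain y where "1 = x * y" by auto
  hence "gnorm x * gnorm y = 1" by (metis gnorm_1 gnorm_mult)
  thus "gnorm x = 1" by simp
next
  assume "gnorm x = 1"
  hence "x * gcnj x = 1" using mult_gcnj[of x] by simp
  thus "is_unit x" by (metis dvdI)
qed

lemma gnorm_dvd_le: "x dvd y \<Longrightarrow> y \<noteq> 0 \<Longrightarrow> gnorm x \<le> gnorm y"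
  by (auto simp: dvd_def Suc_le_eq)

lemma finite_divisors: "(y :: gauss_int) \<noteq> 0 \<Longrightarrow> finite {x. x dvd y}"
  by (rule finite_subset[OF _ finite_gnorm_le[of "gnorm y"]]) (auto dest: gnorm_dvd_le)

lemma gauss_units: "{u::gauss_int. is_unit u} = {1, - 1, Gauss_Int 0 1, Gauss_Int 0 (- 1)}"
proof -
  have "is_unit u \<Longrightarrow> u \<in> {1, - 1, Gauss_Int 0 1, Gauss_Int 0 (- 1)}" for u
  proof -
    assume "is_unit u"
    hence *: "(ReZ u)\<^sup>2 + (ImZ u)\<^sup>2 = 1" by (simp add: is_unit_iff_gnorm gnorm_def)
    have "(ReZ u)\<^sup>2 = 0 \<or> (ReZ u)\<^sup>2 = 1" using * zero_le_power2[of "ReZ u"] zero_le_power2[of "ImZ u"] by linarith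
    hence "ReZ u = 0 \<and> \<bar>ImZ u\<bar> = 1 \<or> \<bar>ReZ u\<bar> = 1 \<and> ImZ u = 0"
      using * by (auto simp: power2_eq_1_iff abs_if)
    thus ?thesis
      by (auto simp: gauss_int_eq_iff one_gauss_int_def uminus_gauss_int_def abs_if split: if_splits)
  qed
  moreover have "is_unit u" if "u \<in> {1, - 1, Gauss_Int 0 1, Gauss_Int 0 (- 1)}" for u
    using that by (subst is_unit_iff_gnorm) (auto simp: gnorm_def one_gauss_int_def uminus_gauss_int_def)
  ultimately show ?thesis by auto
qed

lemma card_gauss_units: "card {u::gauss_int. is_unit u} = 4"
  by (subst gauss_units) (simp add: one_gauss_int_def uminus_gauss_int_def)

lemma finite_gauss_units: "finite {u::gauss_int. is_unit u}"
  by (subst gauss_units) simp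

section \<open>Euclidean division and prime factors\<close>

lemma gauss_euclid:
  assumes "b \<noteq> 0"
  obtains q where "gnorm (a - q * b) < gnorm b"
proof -
  define z where "z = cg a / cg b"
  define q where "q = Gauss_Int (round (Re z)) (round (Im z))"
  have 1: "\<bar>Re (z - cg q)\<bar> \<le> 1/2" "\<bar>Im (z - cg q)\<bar> \<le> 1/2"
    using of_int_round_abs_le[of "Re z"] of_int_round_abs_le[of "Im z"]
    by (auto simp: q_def complex_of_gauss_int_def abs_minus_commute)
  have "(cmod (z - cg q))\<^sup>2 \<le> (1/2)^2 + (1/2)^2"
    unfolding cmod_power2 by (intro add_mono; subst power2_abs[symmetric]; intro power_mono 1) auto
  moreover have "cg (a - q * b) = (z - cg q) * cg b"
    using assms by (simp add: z_def field_simps)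
  ultimately have "real (gnorm (a - q * b)) \<le> (1/2) * real (gnorm b)"
    using mult_right_mono[of "(cmod (z - cg q))\<^sup>2" "1/2" "(cmod (cg b))\<^sup>2"]
    unfolding gnorm_cmod by (simp add: norm_mult power_mult_distrib power2_eq_square mult_ac)
  moreover have "real (gnorm b) > 0" using assms by simp
  ultimately have "gnorm (a - q * b) < gnorm b" by linarith
  thus ?thesis using that by blast
qed

text \<open>A nonzero element of least norm in the ideal generated by \<open>a\<close> and
  \<open>b\<close> divides every element of it, since a Euclidean remainder would have smaller
  norm.\<close>

lemma gauss_ideal_generator:
  fixes a b :: gauss_int
  assumes "b \<noteq> 0"
  obtains x y where "a * x + b * y dvd a" "a * x + b * y dvd b"
proof -
  define I where "I = {z. z \<noteq> 0 \<and> (\<exists>x y. z = a * x + b * y)}"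
  have "b = a * 0 + b * 1" by simp
  hence "b \<in> I" using assms unfolding I_def by blast
  define d where "d = arg_min gnorm (\<lambda>z. z \<in> I)"
  have d: "d \<in> I" "\<And>z. z \<in> I \<Longrightarrow> gnorm d \<le> gnorm z"
    using arg_min_nat_lemma[of "\<lambda>z. z \<in> I" b gnorm] \<open>b \<in> I\<close> by (auto simp: d_def)
  then obtain x y where xy: "d = a * x + b * y" "d \<noteq> 0" by (auto simp: I_def)
  have *: "d dvd c" if c: "c = a * u + b * v" for c u v
  proof -
    obtain q where q: "gnorm (c - q * d) < gnorm d" using gauss_euclid xy by metis
    have "c - q * d = a * (u - q * x) + b * (v - q * y)"
      by (simp add: c xy algebra_simps)
    hence "c - q * d = 0" using d(2)[of "c - q * d"] q by (force simp: I_def)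
    thus ?thesis by (metis dvd_triv_right eq_iff_diff_eq_0)
  qed
  have "d dvd a" "d dvd b" using *[of a 1 0] *[of b 0 1] by auto
  thus ?thesis using that xy by blast
qed

lemma gauss_bezout:
  fixes a b :: gauss_int
  assumes "coprime a b" "b \<noteq> 0"
  obtains x y where "a * x + b * y = 1"
proof -
  obtain x y where xy: "a * x + b * y dvd a" "a * x + b * y dvd b"
    using gauss_ideal_generator[OF assms(2)] by metis
  hence "is_unit (a * x + b * y)" using assms(1) by (auto simp: coprime_def)
  then obtain w where "(a * x + b * y) * w = 1" by (metis dvdE)
  hence "a * (x * w) + b * (y * w) = 1" by (simp add: algebra_simps)
  thus ?thesis using that by blast
qed

text \<open>Among the nonunit divisors of \<open>a\<close>, one of least norm has only trivial
  divisors. A generator of the ideal of \<open>p\<close> and \<open>y\<close> then turns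
  irreducibility into primality.\<close>

lemma exists_prime_factor:
  assumes "a \<noteq> 0" "\<not> is_unit a"
  obtains p :: gauss_int where "prime_elem p" "p dvd a"
proof -
  define D where "D = {p. p dvd a \<and> \<not> is_unit p}"
  define p where "p = arg_min gnorm (\<lambda>z. z \<in> D)"
  have p: "p \<in> D" "\<And>z. z \<in> D \<Longrightarrow> gnorm p \<le> gnorm z"
    using arg_min_nat_lemma[of "\<lambda>z. z \<in> D" a gnorm] assms by (auto simp: p_def D_def)
  have p0: "p \<noteq> 0" "\<not> is_unit p" using p(1) assms by (auto simp: D_def)
  have irr: "is_unit d \<or> p dvd d" if "d dvd p" for d
  proof (rule ccontr)
    assume *: "\<not> (is_unit d \<or> p dvd d)"
    obtain e where e: "p = d * e" using \<open>d dvd p\<close> by (rule dvdE)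
    have "d \<in> D" using * that p(1) by (auto simp: D_def)
    hence "gnorm p \<le> gnorm d" by (rule p(2))
    hence "gnorm e = 1" using e p0
      by (metis gnorm_mult gnorm_pos_iff mult_le_cancel1 mult_eq_0_iff nat_mult_1_right
          le_antisym less_one linorder_not_less One_nat_def)
    hence "is_unit e" by (simp add: is_unit_iff_gnorm)
    hence "p dvd d" using e by (simp add: mult_unit_dvd_iff)
    thus False using * by blast
  qed
  have "prime_elem p"
  proof (rule prime_elemI)
    fix x y assume xy: "p dvd x * y"
    show "p dvd x \<or> p dvd y"
    proof (rule disjCI)
      assume ny: "\<not> p dvd y"
      obtain u v where uv: "y * u + p * v dvd y" "y * u + p * v dvd p"
        using gauss_ideal_generator[OF p0(1)] by metis
      have "is_unit (y * u + p * v)" using irr[OF uv(2)] uv(1) ny dvd_trans by blast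
      moreover have "p dvd x * (y * u + p * v)"
        using xy by (simp add: distrib_left dvd_add mult.assoc[symmetric])
      ultimately show "p dvd x" by (simp add: dvd_mult_unit_iff)
    qed
  qed (use p0 in auto)
  thus ?thesis using that p(1) by (auto simp: D_def)
qed

lemma gnorm_prime_ge: "prime_elem p \<Longrightarrow> gnorm p \<ge> 2"
  using is_unit_iff_gnorm[of p] gnorm_pos_iff[of p] by (auto simp: prime_elem_def simp del: gnorm_pos_iff)

text \<open>Divisibility between primes is association, and the four units give four distinct
  associates. This is the source of the factor 4 in the later identities.\<close>

lemma card_associates_prime:
  assumes q: "prime_elem (q::gauss_int)"
  shows "card {p. prime_elem p \<and> p dvd q} = 4"
proof -
  have q0: "q \<noteq> 0" using q by auto
  have "{p. prime_elem p \<and> p dvd q} = (\<lambda>u. u * q) ` {u. is_unit u}"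
  proof (safe)
    fix p assume p: "prime_elem p" "p dvd q"
    then obtain e where e: "q = p * e" by auto
    have "\<not> is_unit p" using p by (simp add: prime_elem_def)
    hence ue: "is_unit e"
      using q e by (metis irreducibleD prime_elem_imp_irreducible)
    then obtain w where w: "e * w = 1" by (metis dvdE)
    hence "p = w * q" by (simp add: e ac_simps)
    moreover have "is_unit w" using w by (metis dvdI mult.commute)
    ultimately show "p \<in> (\<lambda>u. u * q) ` {u. is_unit u}" by auto
  next
    fix u assume u: "is_unit (u :: gauss_int)"
    have "u \<noteq> 0" using u by auto
    thus "prime_elem (u * q)"
      using u q by (auto simp: prime_elem_def mult_unit_dvd_iff' is_unit_mult_iff)
    show "u * q dvd q" using u by (simp add: mult_unit_dvd_iff')
  qed
  moreover have "inj_on (\<lambda>u. u * q) {u. is_unit u}" using q0 by (auto simp: inj_on_def)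
  ultimately show ?thesis by (simp add: card_image card_gauss_units)
qed

text \<open>Prime powers are indexed by pairs of a prime element (not a class of associates) and an exponent.\<close>

definition prime_powers :: "(gauss_int \<times> nat) set" where
  "prime_powers = {(p, m). prime_elem p \<and> m \<ge> 1}"

lemma finite_prime_powers_dvd:
  assumes "a \<noteq> 0"
  shows "finite {(p, m). (p, m) \<in> prime_powers \<and> p ^ m dvd a}"
proof -
  have "{(p, m). (p, m) \<in> prime_powers \<and> p ^ m dvd a} \<subseteq> {p. p dvd a} \<times> {..gnorm a}"
  proof
    fix x assume "x \<in> {(p, m). (p, m) \<in> prime_powers \<and> p ^ m dvd a}"
    then obtain p m where x: "x = (p, m)" and p: "prime_elem p" and m: "m \<ge> 1" and pm: "p ^ m dvd a"
      by (auto simp: prime_powers_def)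
    have "p dvd p ^ m" using m by (intro dvd_power) auto
    hence 1: "p dvd a" using pm by (rule dvd_trans)
    \<comment> \<open>Primes have norm at least 2, so the exponent stays below
      \<open>gnorm a\<close>; this crude bound is enough for finiteness.\<close>
    have "m < 2 ^ m" by (rule less_exp)
    also have "(2::nat) ^ m \<le> gnorm p ^ m" by (intro power_mono gnorm_prime_ge p) auto
    also have "\<dots> \<le> gnorm a" using gnorm_dvd_le[OF pm assms] by simp
    finally show "x \<in> {p. p dvd a} \<times> {..gnorm a}" using 1 x by simp
  qed
  moreover have "finite ({p. p dvd a} \<times> {..gnorm a})" using finite_divisors[OF assms] by simp
  ultimately show ?thesis by (rule finite_subset)
qed

text \<open>The Gaussian counterpart of the divisor sum of the von Mangoldt function. Removing one
  prime \<open>q\<close> from \<open>a\<close> lowers by one the exponents available to the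
  associates of \<open>q\<close> and to no other prime. As every prime is listed with its four
  associates, the sum drops by \<open>4 * ln (gnorm q)\<close>.\<close>

lemma sum_ln_prime_powers_dvd:
  assumes "a \<noteq> 0"
  shows "(\<Sum>(p, m)\<in>{(p, m). (p, m) \<in> prime_powers \<and> p ^ m dvd a}. ln (real (gnorm p))) = 4 * ln (real (gnorm a))"
  using assms
  proof (induction "gnorm a" arbitrary: a rule: less_induct)
    case less
    show ?case
    proof (cases "is_unit a")
      case True
      have E: "{(p, m). (p, m) \<in> prime_powers \<and> p ^ m dvd a} = {}"
      proof -
        have False if "prime_elem p" "m \<ge> 1" "p ^ m dvd a" for p m
        proof -
          have "p dvd p ^ m" using that(2) by (intro dvd_power) auto
          hence "is_unit p" using that(3) True by (meson dvd_trans)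
          thus False using that(1) by (simp add: prime_elem_def)
        qed
        thus ?thesis by (auto simp: prime_powers_def)
      qed
      show ?thesis unfolding E using True by (simp add: is_unit_iff_gnorm)
    next
      case False
      then obtain q where q: "prime_elem q" "q dvd a" using exists_prime_factor less.prems by blast
      then obtain b where b: "a = q * b" by auto
      have b0: "b \<noteq> 0" using b less.prems by auto
      have q0: "q \<noteq> 0" using q by auto
      have "gnorm b < gnorm a" using b b0 gnorm_prime_ge[OF q(1)] by simp
      hence IH: "(\<Sum>(p, m)\<in>{(p, m). (p, m) \<in> prime_powers \<and> p ^ m dvd b}. ln (real (gnorm p))) = 4 * ln (real (gnorm b))"
        using less.hyps b0 by blast
      define A where "A = {p. prime_elem p \<and> p dvd q}"
      define S where "S = {(p, m). (p, m) \<in> prime_powers \<and> p ^ m dvd b}"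
      \<comment> \<open>\<open>h\<close> raises the exponent at the associates of \<open>q\<close>
        and fixes all other pairs. Among the prime powers dividing \<open>a\<close> its image misses
        exactly the pairs \<open>(p, 1)\<close> with \<open>p\<close> associated to
        \<open>q\<close>.\<close>
      define h where "h = (\<lambda>(p, m). if p dvd q then (p, Suc m) else (p, m :: nat))"
      have assoc: "\<exists>u. is_unit u \<and> q = p * u" if "p \<in> A" for p
      proof -
        obtain u where u: "q = p * u" using \<open>p \<in> A\<close> unfolding A_def by (auto elim: dvdE)
        have "\<not> is_unit p" using \<open>p \<in> A\<close> by (simp add: A_def prime_elem_def)
        hence "is_unit u" using irreducibleD[OF prime_elem_imp_irreducible[OF q(1)] u] by blast
        thus ?thesis using u by blast
      qed
      have key1: "p ^ Suc m dvd a \<longleftrightarrow> p ^ m dvd b" if "p \<in> A" for p m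
      proof -
        obtain u where "is_unit u" "q = p * u" using assoc[OF \<open>p \<in> A\<close>] by auto
        moreover have "p \<noteq> 0" using that by (auto simp: A_def)
        ultimately show ?thesis unfolding b by (simp add: mult.assoc dvd_mult_unit_iff')
      qed
      have key2: "p ^ m dvd a \<longleftrightarrow> p ^ m dvd b" if p: "prime_elem p" "\<not> p dvd q" for p m
      proof -
        have "p ^ m dvd q * c \<Longrightarrow> p ^ m dvd c" for c
        proof (induction m arbitrary: c)
          case (Suc m)
          have "p dvd q * c" using Suc.prems dvd_mult_left[of p "p ^ m" "q * c"] by simp
          hence "p dvd c" using p by (simp add: prime_elem_dvd_mult_iff)
          then obtain e where e: "c = p * e" by auto
          have "p ^ m dvd q * e" using Suc.prems p by (auto simp: e mult.left_commute[of q])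
          thus ?case using Suc.IH[of e] by (simp add: e mult_dvd_mono)
        qed auto
        from this[of b] show ?thesis by (auto simp only: b dvd_mult)
      qed
      have A4: "card A = 4" unfolding A_def by (rule card_associates_prime[OF q(1)])
      have finA: "finite A" using A4 by (metis card.infinite zero_neq_numeral)
      have finS: "finite S" unfolding S_def by (rule finite_prime_powers_dvd[OF b0])
      have split: "{(p, m). (p, m) \<in> prime_powers \<and> p ^ m dvd a} = h ` S \<union> (\<lambda>p. (p, Suc 0)) ` A"
      proof (intro equalityI subsetI)
        fix x assume "x \<in> {(p, m). (p, m) \<in> prime_powers \<and> p ^ m dvd a}"
        then obtain p m where x: "x = (p, m)" "prime_elem p" "m \<ge> 1" "p ^ m dvd a" by (auto simp: prime_powers_def)
        show "x \<in> h ` S \<union> (\<lambda>p. (p, Suc 0)) ` A"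
        proof (cases "p \<in> A")
          case False
          hence "\<not> p dvd q" using x by (auto simp: A_def)
          hence "(p, m) \<in> S" "h (p, m) = x" using x key2 by (auto simp: S_def prime_powers_def h_def)
          thus ?thesis by (metis UnI1 image_eqI)
        next
          case True
          obtain k where k: "m = Suc k" using x(3) by (cases m) auto
          show ?thesis
          proof (cases "k = 0")
            case False
            have "(p, k) \<in> S" "h (p, k) = x"
              using x True key1[OF True, of k] False by (auto simp: S_def prime_powers_def h_def k A_def)
            thus ?thesis by (metis UnI1 image_eqI)
          qed (use x True k in auto)
        qed
      next
        fix x assume "x \<in> h ` S \<union> (\<lambda>p. (p, Suc 0)) ` A"
        thus "x \<in> {(p, m). (p, m) \<in> prime_powers \<and> p ^ m dvd a}"
        proof
          assume "x \<in> h ` S"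
          then obtain p m where pm: "(p, m) \<in> S" "x = h (p, m)" by auto
          show ?thesis using pm key1[of p m] key2[of p m]
            by (cases "p dvd q") (auto simp: S_def prime_powers_def h_def A_def)
        next
          assume "x \<in> (\<lambda>p. (p, Suc 0)) ` A"
          then obtain p where p: "p \<in> A" "x = (p, Suc 0)" by auto
          thus ?thesis using key1[OF p(1), of 0] by (auto simp: A_def prime_powers_def)
        qed
      qed
      have disj: "h ` S \<inter> (\<lambda>p. (p, Suc 0)) ` A = {}"
        by (auto simp: h_def S_def prime_powers_def A_def split: if_splits)
      have injh: "inj_on h S" by (auto simp: inj_on_def h_def split: if_splits)
      have gA: "gnorm p = gnorm q" if "p \<in> A" for p
        using assoc[OF that] by (auto simp: is_unit_iff_gnorm)
      have "(\<Sum>(p, m)\<in>{(p, m). (p, m) \<in> prime_powers \<and> p ^ m dvd a}. ln (real (gnorm p)))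
          = (\<Sum>(p, m)\<in>h ` S. ln (real (gnorm p))) + (\<Sum>(p, m)\<in>(\<lambda>p. (p, Suc 0)) ` A. ln (real (gnorm p)))"
        unfolding split using finA finS disj by (intro sum.union_disjoint) auto
      also have "(\<Sum>(p, m)\<in>h ` S. ln (real (gnorm p))) = (\<Sum>(p, m)\<in>S. ln (real (gnorm p)))"
        by (subst sum.reindex[OF injh]) (auto simp: h_def intro!: sum.cong)
      also have "\<dots> = 4 * ln (real (gnorm b))" using IH by (simp add: S_def)
      also have "(\<Sum>(p, m)\<in>(\<lambda>p. (p, Suc 0)) ` A. ln (real (gnorm p))) = (\<Sum>p\<in>A. ln (real (gnorm p)))"
        by (subst sum.reindex) (auto simp: inj_on_def)
      also have "\<dots> = 4 * ln (real (gnorm q))" using gA A4 by simp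
      also have "4 * ln (real (gnorm b)) + 4 * ln (real (gnorm q)) = 4 * ln (real (gnorm a))"
        using q0 b0 by (simp add: b ln_mult)
      finally show ?thesis .
    qed
  qed

section \<open>Characters modulo a Gaussian integer\<close>

locale gauss_mod =
  fixes g :: gauss_int
  assumes g0: "g \<noteq> 0"
begin

abbreviation gcong (infix "\<simeq>" 50) where "a \<simeq> b \<equiv> g dvd a - b"

lemma gcong_refl: "a \<simeq> a" by simp

lemma gcong_sym: "a \<simeq> b \<Longrightarrow> b \<simeq> a"
  using dvd_minus_iff[of g "a - b"] by simp

lemma gcong_trans: "a \<simeq> b \<Longrightarrow> b \<simeq> c \<Longrightarrow> a \<simeq> c"
  using dvd_add[of g "a - b" "b - c"] by simp

lemma gcong_mult: "a \<simeq> b \<Longrightarrow> c \<simeq> d \<Longrightarrow> a * c \<simeq> b * d"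
proof -
  assume "a \<simeq> b" "c \<simeq> d"
  hence "g dvd (a - b) * c + b * (c - d)" by (intro dvd_add dvd_mult2 dvd_mult)
  thus ?thesis by (simp add: algebra_simps)
qed

lemma gcong_power: "a \<simeq> b \<Longrightarrow> a ^ n \<simeq> b ^ n"
  by (induction n) (simp_all add: gcong_mult)

lemma gcong_power1: "a \<simeq> 1 \<Longrightarrow> a ^ n \<simeq> 1"
  using gcong_power[of a 1 n] by simp

lemma coprime_iff_inverse: "coprime a g \<longleftrightarrow> (\<exists>x. a * x \<simeq> 1)"
proof
  assume "coprime a g"
  then obtain x y where "a * x + g * y = 1" using gauss_bezout g0 by blast
  hence "a * x - 1 = g * (- y)" by (simp add: algebra_simps)
  hence "a * x \<simeq> 1" by simp
  thus "\<exists>x. a * x \<simeq> 1" by blast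
next
  assume "\<exists>x. a * x \<simeq> 1"
  then obtain x where x: "a * x \<simeq> 1" by blast
  show "coprime a g"
  proof (rule coprimeI)
    fix d assume d: "d dvd a" "d dvd g"
    hence "d dvd a * x - (a * x - 1)" using x by (meson dvd_diff dvd_mult2 dvd_trans)
    thus "is_unit d" by simp
  qed
qed

lemma coprime_gcong: "a \<simeq> b \<Longrightarrow> coprime a g \<longleftrightarrow> coprime b g"
  unfolding coprime_iff_inverse by (meson gcong_mult gcong_refl gcong_sym gcong_trans)

lemma coprime_mult_iff: "coprime (a * b) g \<longleftrightarrow> coprime a g \<and> coprime b g"
proof
  assume "coprime (a * b) g"
  thus "coprime a g \<and> coprime b g"
    unfolding coprime_iff_inverse by (metis mult.assoc mult.commute)
next
  assume "coprime a g \<and> coprime b g"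
  then obtain x y where "a * x \<simeq> 1" "b * y \<simeq> 1" unfolding coprime_iff_inverse by blast
  hence "(a * x) * (b * y) \<simeq> 1" using gcong_mult[of "a * x" 1 "b * y" 1] by simp
  thus "coprime (a * b) g" unfolding coprime_iff_inverse by (intro exI[of _ "x * y"]) (simp add: mult_ac)
qed

lemma coprime_power_left: "coprime a g \<Longrightarrow> coprime (a ^ n) g"
  by (induction n) (auto simp: coprime_mult_iff)

lemma gcong_cancel: "coprime a g \<Longrightarrow> a * b \<simeq> a * c \<Longrightarrow> b \<simeq> c"
proof -
  assume "coprime a g" and *: "a * b \<simeq> a * c"
  then obtain x where x: "a * x \<simeq> 1" using coprime_iff_inverse by blast
  have **: "a * x * d \<simeq> d" for d using gcong_mult[OF x gcong_refl[of d]] by simp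
  have "a * x * b \<simeq> a * x * c" using gcong_mult[OF * gcong_refl[of x]] by (simp add: mult_ac)
  thus ?thesis using **[of b] **[of c] gcong_sym gcong_trans by blast
qed

text \<open>Not a transversal: a finite set that meets every residue class, which suffices for
  pigeonhole and counting arguments.\<close>

definition reps :: "gauss_int set" where "reps = {x. gnorm x \<le> gnorm g}"

lemma finite_reps: "finite reps"
  unfolding reps_def by (rule finite_gnorm_le)

lemma exists_rep: "\<exists>b\<in>reps. b \<simeq> a"
proof -
  obtain q where q: "gnorm (a - q * g) < gnorm g" using gauss_euclid[OF g0] by blast
  have "a - q * g \<simeq> a" by (simp add: dvd_minus_iff)
  thus ?thesis using q by (intro bexI[of _ "a - q * g"]) (auto simp: reps_def)
qed

text \<open>Pigeonhole on the powers of \<open>a\<close> among the finitely many representatives,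
  followed by cancellation.\<close>

lemma exists_power_cong_1:
  assumes "coprime a g"
  shows "\<exists>n\<ge>1. a ^ n \<simeq> 1"
proof -
  define r where "r n = (SOME b. b \<in> reps \<and> b \<simeq> a ^ n)" for n
  have r: "r n \<in> reps \<and> r n \<simeq> a ^ n" for n
    unfolding r_def by (rule someI_ex) (use exists_rep in blast)
  have "\<not> inj r"
    using finite_reps r finite_subset[of "range r" reps] finite_imageD[of r UNIV] by auto
  then obtain i j where ij: "i < j" "r i = r j" unfolding inj_def by (metis linorder_neqE_nat)
  have "a ^ j \<simeq> a ^ i" using r[of i] r[of j] ij gcong_sym gcong_trans by metis
  hence "a ^ i * a ^ (j - i) \<simeq> a ^ i * 1" using ij by (simp add: power_add[symmetric])
  hence "a ^ (j - i) \<simeq> 1" by (rule gcong_cancel[OF coprime_power_left[OF assms]])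
  thus ?thesis using ij by (intro exI[of _ "j - i"]) auto
qed

lemma exists_exponent: "\<exists>e\<ge>1. \<forall>a. coprime a g \<longrightarrow> a ^ e \<simeq> 1"
proof -
  define n where "n a = (SOME n. n \<ge> 1 \<and> a ^ n \<simeq> 1)" for a
  have n: "n a \<ge> 1 \<and> a ^ n a \<simeq> 1" if "coprime a g" for a
    unfolding n_def by (rule someI_ex) (use exists_power_cong_1[OF that] in blast)
  define C where "C = {b \<in> reps. coprime b g}"
  have C: "finite C" using finite_reps by (simp add: C_def)
  define e where "e = (\<Prod>b\<in>C. n b)"
  have "e \<ge> 1" unfolding e_def using n by (intro prod_ge_1) (auto simp: C_def)
  moreover have "a ^ e \<simeq> 1" if a: "coprime a g" for a
  proof -
    obtain b where b: "b \<in> reps" "b \<simeq> a" using exists_rep by blast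
    hence bC: "b \<in> C" using a coprime_gcong by (auto simp: C_def)
    then obtain k where "e = n b * k" unfolding e_def using C by (metis dvdE dvd_prod_eqI)
    moreover have "b ^ n b \<simeq> 1" using n bC by (simp add: C_def)
    ultimately have "b ^ e \<simeq> 1" using gcong_power1 by (simp add: power_mult)
    thus ?thesis using gcong_power[OF b(2), of e] gcong_sym gcong_trans by blast
  qed
  ultimately show ?thesis by blast
qed

text \<open>A common exponent of the unit group modulo \<open>g\<close>, not necessarily the least
  one. It lets \<open>a ^ (unit_exp - 1)\<close> serve as an inverse of \<open>a\<close>, so that
  only nonnegative powers occur.\<close>

definition unit_exp :: nat where "unit_exp = (SOME e. e \<ge> 1 \<and> (\<forall>a. coprime a g \<longrightarrow> a ^ e \<simeq> 1))"

lemma unit_exp_ge_1: "unit_exp \<ge> 1" and power_unit_exp: "coprime a g \<Longrightarrow> a ^ unit_exp \<simeq> 1"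
proof -
  have "unit_exp \<ge> 1 \<and> (\<forall>a. coprime a g \<longrightarrow> a ^ unit_exp \<simeq> 1)"
    unfolding unit_exp_def by (rule someI_ex) (use exists_exponent in blast)
  thus "unit_exp \<ge> 1" "coprime a g \<Longrightarrow> a ^ unit_exp \<simeq> 1" by auto
qed

text \<open>A character on a subset \<open>H\<close> of the units modulo \<open>g\<close>, both given as objects on \<open>\<int>[i]\<close> that respect congruence.\<close>

definition pchar :: "gauss_int set \<Rightarrow> (gauss_int \<Rightarrow> complex) \<Rightarrow> bool" where
  "pchar H f \<longleftrightarrow> 1 \<in> H \<and> (\<forall>a\<in>H. coprime a g) \<and> (\<forall>a\<in>H. \<forall>b. b \<simeq> a \<longrightarrow> b \<in> H \<and> f b = f a) \<and>
     (\<forall>a\<in>H. \<forall>b\<in>H. a * b \<in> H \<and> f (a * b) = f a * f b) \<and> (\<forall>a\<in>H. f a \<noteq> 0)"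

lemma pchar_1: "pchar H f \<Longrightarrow> f 1 = 1"
  unfolding pchar_def by (metis mult_1 mult_cancel_right1)

lemma pcharI:
  assumes "1 \<in> H" "\<And>a. a \<in> H \<Longrightarrow> coprime a g" "\<And>a b. a \<in> H \<Longrightarrow> b \<simeq> a \<Longrightarrow> b \<in> H"
    "\<And>a b. a \<in> H \<Longrightarrow> b \<simeq> a \<Longrightarrow> f b = f a" "\<And>a b. a \<in> H \<Longrightarrow> b \<in> H \<Longrightarrow> a * b \<in> H"
    "\<And>a b. a \<in> H \<Longrightarrow> b \<in> H \<Longrightarrow> f (a * b) = f a * f b" "\<And>a. a \<in> H \<Longrightarrow> f a \<noteq> 0"
  shows "pchar H f"
  unfolding pchar_def by (intro conjI ballI allI impI) (rule assms; assumption)+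

lemma pcharD:
  assumes "pchar H f"
  shows "1 \<in> H" "a \<in> H \<Longrightarrow> coprime a g" "a \<in> H \<Longrightarrow> b \<simeq> a \<Longrightarrow> b \<in> H"
    "a \<in> H \<Longrightarrow> b \<simeq> a \<Longrightarrow> f b = f a" "a \<in> H \<Longrightarrow> b \<in> H \<Longrightarrow> a * b \<in> H"
    "a \<in> H \<Longrightarrow> b \<in> H \<Longrightarrow> f (a * b) = f a * f b" "a \<in> H \<Longrightarrow> f a \<noteq> 0"
  using assms unfolding pchar_def by blast+

lemma pchar_power:
  assumes "pchar H f" "a \<in> H"
  shows "a ^ n \<in> H \<and> f (a ^ n) = f a ^ n"
proof (induction n)
  case 0 show ?case using pchar_1[OF assms(1)] pcharD(1)[OF assms(1)] by simp
next
  case (Suc n) thus ?case using pcharD(5,6)[OF assms(1,2), of "a ^ n"] by simp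
qed

text \<open>\<open>n\<close> is the order of \<open>a\<close> modulo \<open>H\<close>, so the only
  constraint on the value at \<open>a\<close> is that its \<open>n\<close>-th power be
  \<open>f (a ^ n)\<close>. The extension sends \<open>h * a ^ j\<close> to
  \<open>f h * z ^ j\<close> on the group generated by \<open>H\<close> and \<open>a\<close>; the
  work lies in the independence of the representation.\<close>

lemma pchar_extend:
  assumes H: "pchar H f" and a: "coprime a g"
    and n: "n \<ge> 1" "a ^ n \<in> H" "\<And>m. m \<ge> 1 \<Longrightarrow> m < n \<Longrightarrow> a ^ m \<notin> H"
    and z: "z ^ n = f (a ^ n)"
  obtains H' f' where "pchar H' f'" "H \<subseteq> H'" "a \<in> H'" "\<And>h. h \<in> H \<Longrightarrow> f' h = f h" "f' a = z"
proof -
  have closed: "b \<in> H" "f b = f c" if "c \<in> H" "b \<simeq> c" for b c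
    using pcharD(3,4)[OF H] that by blast+
  have Hm: "b * c \<in> H" "f (b * c) = f b * f c" if "b \<in> H" "c \<in> H" for b c
    using pcharD(5,6)[OF H] that by blast+
  have Hp: "b ^ k \<in> H" "f (b ^ k) = f b ^ k" if "b \<in> H" for b k
    using pchar_power[OF H that] by auto
  have H1: "1 \<in> H" "f 1 = 1" using pcharD(1)[OF H] pchar_1[OF H] by auto
  have Hc: "coprime b g" "f b \<noteq> 0" if "b \<in> H" for b using pcharD(2,7)[OF H] that by blast+
  have fe: "f b ^ unit_exp = 1" if "b \<in> H" for b
    using Hp[OF that, of unit_exp] closed(2)[OF H1(1) power_unit_exp[OF Hc(1)[OF that]]] H1 by simp
  have z0: "z \<noteq> 0" using z Hc(2)[OF n(2)] n(1) by (auto simp: power_0_left)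
  \<comment> \<open>The exponents \<open>m\<close> with \<open>a ^ m\<close> in \<open>H\<close> are
    multiples of \<open>n\<close>: the remainder of \<open>m\<close> modulo \<open>n\<close> is
    again such an exponent, and it lies below the least positive one.\<close>
  have claim: "f (a ^ m) = z ^ m" if m: "a ^ m \<in> H" for m
  proof -
    define q r where "q = m div n" and "r = m mod n"
    have mqr: "m = n * q + r" by (simp add: q_def r_def)
    have "a ^ m * (a ^ n) ^ (q * (unit_exp - 1)) = a ^ r * (a ^ unit_exp) ^ (n * q)"
    proof -
      have "m + n * (q * (unit_exp - 1)) = r + unit_exp * (n * q)"
        using unit_exp_ge_1 by (cases unit_exp) (auto simp: mqr algebra_simps)
      thus ?thesis by (simp only: power_mult[symmetric] power_add[symmetric])
    qed
    moreover have "a ^ r * (a ^ unit_exp) ^ (n * q) \<simeq> a ^ r * 1"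
      by (intro gcong_mult gcong_refl gcong_power1 power_unit_exp a)
    ultimately have "a ^ r \<simeq> a ^ m * (a ^ n) ^ (q * (unit_exp - 1))" using gcong_sym by simp
    hence "a ^ r \<in> H" using closed(1) Hm(1) Hp(1) m n(2) by blast
    hence "r = 0" using n(3)[of r] n(1) by (cases "r = 0") (auto simp: r_def)
    hence "f (a ^ m) = f ((a ^ n) ^ q)" by (simp add: mqr power_mult)
    also have "\<dots> = z ^ m" using Hp(2)[OF n(2)] \<open>r = 0\<close> by (simp add: mqr power_mult z)
    finally show ?thesis .
  qed
  have ze: "z ^ unit_exp = 1"
    using claim[of unit_exp] closed[OF H1(1) power_unit_exp[OF a]] H1 by simp
  have WD: "f h * z ^ j = f h' * z ^ j'" if h: "h \<in> H" "h' \<in> H" "h * a ^ j \<simeq> h' * a ^ j'" for h h' j j'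
  proof -
    \<comment> \<open>Here \<open>a ^ m\<close> plays the role of \<open>a ^ (j' - j)\<close>, and
      \<open>h' ^ (unit_exp - 1) * h\<close> that of the quotient of \<open>h\<close> by
      \<open>h'\<close>.\<close>
    define m where "m = j' + (unit_exp - 1) * j"
    have ee: "x ^ (unit_exp - 1) * x = x ^ unit_exp" for x :: gauss_int using unit_exp_ge_1 by (cases unit_exp) auto
    have ee': "x ^ (unit_exp - 1) * x = x ^ unit_exp" for x :: complex using unit_exp_ge_1 by (cases unit_exp) auto
    have aj: "(a ^ (unit_exp - 1)) ^ j * a ^ j = (a ^ unit_exp) ^ j" by (simp only: power_mult_distrib[symmetric] ee)
    have m': "a ^ m = a ^ j' * (a ^ (unit_exp - 1)) ^ j" by (simp add: m_def power_add power_mult)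
    have "h' ^ (unit_exp - 1) * h * ((a ^ unit_exp) ^ j) = h' ^ (unit_exp - 1) * (a ^ (unit_exp - 1)) ^ j * (h * a ^ j)"
      by (simp only: aj[symmetric] mult_ac)
    moreover have "h' ^ (unit_exp - 1) * (a ^ (unit_exp - 1)) ^ j * (h * a ^ j) \<simeq> h' ^ (unit_exp - 1) * (a ^ (unit_exp - 1)) ^ j * (h' * a ^ j')"
      by (intro gcong_mult gcong_refl h)
    moreover have "h' ^ (unit_exp - 1) * (a ^ (unit_exp - 1)) ^ j * (h' * a ^ j') = h' ^ unit_exp * a ^ m"
      by (simp only: m' ee[symmetric] mult_ac)
    moreover have "h' ^ unit_exp * a ^ m \<simeq> 1 * a ^ m" by (intro gcong_mult gcong_refl power_unit_exp Hc h)
    ultimately have 1: "h' ^ (unit_exp - 1) * h * ((a ^ unit_exp) ^ j) \<simeq> a ^ m" by (metis gcong_trans mult_1)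
    have "h' ^ (unit_exp - 1) * h * ((a ^ unit_exp) ^ j) \<simeq> h' ^ (unit_exp - 1) * h * 1"
      by (intro gcong_mult gcong_refl gcong_power1 power_unit_exp a)
    hence 2: "a ^ m \<simeq> h' ^ (unit_exp - 1) * h" using 1 gcong_sym gcong_trans by (metis mult.right_neutral)
    have inH: "h' ^ (unit_exp - 1) * h \<in> H" using Hm(1) Hp(1) h by blast
    have "a ^ m \<in> H" using closed(1)[OF inH 2] .
    from claim[OF this] closed(2)[OF inH 2] have "f (h' ^ (unit_exp - 1) * h) = z ^ m" by simp
    hence "f h' ^ (unit_exp - 1) * f h = z ^ m" using Hm(2) Hp h by simp
    hence "f h' * f h' ^ (unit_exp - 1) * f h * z ^ j = f h' * z ^ m * z ^ j" by (simp add: mult_ac)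
    moreover have "f h' * f h' ^ (unit_exp - 1) = 1" using ee'[of "f h'"] fe[OF h(2)] by (simp add: mult.commute)
    moreover have "z ^ m * z ^ j = z ^ j'"
    proof -
      have "m + j = j' + unit_exp * j" using unit_exp_ge_1 by (cases unit_exp) (auto simp: m_def)
      hence "z ^ m * z ^ j = z ^ j' * (z ^ unit_exp) ^ j" by (simp only: power_add[symmetric] power_mult[symmetric])
      thus ?thesis by (simp add: ze)
    qed
    ultimately show ?thesis by (metis mult.assoc mult_1)
  qed
  define H' where "H' = {b. \<exists>h\<in>H. \<exists>j. b \<simeq> h * a ^ j}"
  define f' where "f' b = (SOME w. \<exists>h\<in>H. \<exists>j. b \<simeq> h * a ^ j \<and> w = f h * z ^ j)" for b
  have f': "f' b = f h * z ^ j" if b: "h \<in> H" "b \<simeq> h * a ^ j" for b h j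
  proof -
    have "\<exists>h\<in>H. \<exists>j. b \<simeq> h * a ^ j \<and> f' b = f h * z ^ j"
      unfolding f'_def by (rule someI_ex) (use b in blast)
    then obtain h' j' where "h' \<in> H" "b \<simeq> h' * a ^ j'" "f' b = f h' * z ^ j'" by blast
    thus ?thesis using WD[of h' h j' j] b gcong_sym gcong_trans by metis
  qed
  have HH': "h \<in> H'" "f' h = f h" if "h \<in> H" for h
    using that f'[OF that, of h 0] by (auto simp: H'_def intro!: bexI[of _ h] exI[of _ 0])
  have aH': "a \<in> H'" "f' a = z"
    using f'[OF H1(1), of a 1] H1 by (auto simp: H'_def intro!: bexI[of _ 1] exI[of _ 1])
  have "pchar H' f'"
    unfolding pchar_def
  proof (intro conjI ballI allI impI)
    show "1 \<in> H'" using HH' H1 by blast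
  next
    fix b assume "b \<in> H'"
    then obtain h j where hj: "h \<in> H" "b \<simeq> h * a ^ j" by (auto simp: H'_def)
    show "coprime b g"
      using coprime_gcong[OF hj(2)] Hc(1)[OF hj(1)] coprime_power_left[OF a, of j] by (simp add: coprime_mult_iff)
    show "f' b \<noteq> 0" using f'[OF hj] Hc(2)[OF hj(1)] z0 by simp
    { fix c assume "c \<simeq> b"
      hence c: "c \<simeq> h * a ^ j" using hj gcong_trans by blast
      show "c \<in> H'" using c hj by (auto simp: H'_def)
      show "f' c = f' b" using f'[OF hj] f'[OF hj(1) c] by simp }
    { fix c assume "c \<in> H'"
      then obtain h' j' where hj': "h' \<in> H" "c \<simeq> h' * a ^ j'" by (auto simp: H'_def)
      have bc: "b * c \<simeq> (h * h') * a ^ (j + j')"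
        using gcong_mult[OF hj(2) hj'(2)] by (simp add: power_add mult_ac)
      have hh: "h * h' \<in> H" using Hm hj hj' by blast
      show "b * c \<in> H'" using bc hh by (auto simp: H'_def)
      show "f' (b * c) = f' b * f' c"
        using f'[OF hj] f'[OF hj'] f'[OF hh bc] Hm(2)[OF hj(1) hj'(1)] by (simp add: power_add mult_ac) }
  qed
  thus ?thesis using that HH' aH' by blast
qed

section \<open>Dirichlet characters and their orthogonality\<close>

definition gchar :: "(gauss_int \<Rightarrow> complex) \<Rightarrow> bool" where
  "gchar \<phi> \<longleftrightarrow> (\<forall>a b. \<phi> (a * b) = \<phi> a * \<phi> b) \<and> (\<forall>a b. a \<simeq> b \<longrightarrow> \<phi> a = \<phi> b) \<and> (\<forall>a. \<phi> a \<noteq> 0 \<longleftrightarrow> coprime a g)"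

text \<open>On the group generated by \<open>a\<close>, a character may take a primitive
  \<open>n\<close>-th root of unity at \<open>a\<close>, where \<open>n \<ge> 2\<close> is the order
  of \<open>a\<close>. Among the partial characters that separate \<open>a\<close> from 1, one whose
  domain meets \<open>reps\<close> in the most elements is defined on all units, since otherwise
  \<open>pchar_extend\<close> would enlarge it.\<close>

lemma exists_gchar_separating:
  assumes a: "coprime a g" "\<not> a \<simeq> 1"
  obtains \<phi> where "gchar \<phi>" "\<phi> a \<noteq> 1"
proof -
  have least: "\<exists>n\<ge>1. b ^ n \<in> H \<and> (\<forall>m\<ge>1. m < n \<longrightarrow> b ^ m \<notin> H)" if "pchar H f" "coprime b g" for H f b
  proof -
    have "b ^ unit_exp \<in> H" using pcharD(3)[OF that(1) pcharD(1)[OF that(1)] power_unit_exp[OF that(2)]] .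
    hence "\<exists>n. n \<ge> 1 \<and> b ^ n \<in> H" using unit_exp_ge_1 by blast
    from exists_least_iff[THEN iffD1, OF this] show ?thesis by blast
  qed
  define P where "P = {(H, f). pchar H f \<and> a \<in> H \<and> f a \<noteq> 1}"
  have "\<exists>x. x \<in> P"
  proof -
    have t: "pchar {b. b \<simeq> 1} (\<lambda>_. 1)"
    proof (rule pcharI)
      show "coprime a g" if "a \<in> {b. b \<simeq> 1}" for a
        using coprime_gcong[of a 1] that by simp
      show "b \<in> {b. b \<simeq> 1}" if "a \<in> {b. b \<simeq> 1}" "b \<simeq> a" for a b
        using gcong_trans[of b a 1] that by blast
      show "a * b \<in> {b. b \<simeq> 1}" if "a \<in> {b. b \<simeq> 1}" "b \<in> {b. b \<simeq> 1}" for a b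
        using gcong_mult[of a 1 b 1] that by simp
    qed simp_all
    obtain n where n: "n \<ge> 1" "a ^ n \<in> {b. b \<simeq> 1}" "\<And>m. m \<ge> 1 \<Longrightarrow> m < n \<Longrightarrow> a ^ m \<notin> {b. b \<simeq> 1}"
      using least[OF t a(1)] by blast
    have "n \<noteq> 1" using n(2) a(2) by auto
    hence n2: "n \<ge> 2" using n(1) by simp
    define z where "z = cis (2 * pi / n)"
    have zn: "z ^ n = 1" 
    proof -
      have "z ^ n = cis (real n * (2 * pi / real n))" unfolding z_def by (rule Complex.DeMoivre)
      also have "real n * (2 * pi / real n) = 2 * pi" using n2 by simp
      finally show ?thesis by (simp add: cis.ctr complex_eq_iff)
    qed
    have z1: "z \<noteq> 1"
    proof
      assume "z = 1"
      hence "cos (2 * pi / n) = 1" by (simp add: z_def cis.ctr complex_eq_iff)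
      moreover have "cos (2 * pi / n) \<noteq> 1"
      proof (cases "n = 2")
        case False
        hence "n > 2" using n2 by simp
        hence "cos (2 * pi / n) < cos 0"
          by (intro cos_monotone_0_pi) (auto simp: field_simps)
        thus ?thesis by simp
      qed simp
      ultimately show False by simp
    qed
    obtain H' f' where "pchar H' f'" "{b. b \<simeq> 1} \<subseteq> H'" "a \<in> H'" "f' a = z"
      using pchar_extend[OF t a(1) n zn] by metis
    thus ?thesis using z1 by (intro exI[of _ "(H', f')"]) (auto simp: P_def)
  qed
  then obtain x0 where x0: "x0 \<in> P" by blast
  define M where "M x = card (fst x \<inter> reps)" for x :: "gauss_int set \<times> (gauss_int \<Rightarrow> complex)"
  have "M x \<le> card reps" for x unfolding M_def by (intro card_mono finite_reps) auto
  then obtain x where x: "x \<in> P" "\<And>y. y \<in> P \<Longrightarrow> M y \<le> M x"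
    using ex_has_greatest_nat[of "\<lambda>x. x \<in> P" x0 M "Suc (card reps)"] x0 by (metis le_imp_less_Suc)
  obtain H f where Hf: "x = (H, f)" by (cases x)
  have pc: "pchar H f" "a \<in> H" "f a \<noteq> 1" using x(1) by (auto simp: P_def Hf)
  have full: "b \<in> H" if b: "coprime b g" for b
  proof (rule ccontr)
    assume nb: "b \<notin> H"
    obtain n where n: "n \<ge> 1" "b ^ n \<in> H" "\<And>m. m \<ge> 1 \<Longrightarrow> m < n \<Longrightarrow> b ^ m \<notin> H"
      using least[OF pc(1) b] by blast
    obtain z where "z ^ n = f (b ^ n)"
    proof -
      define w where "w = f (b ^ n)"
      have "(if w = 0 then 0 else exp (Ln w / n)) ^ n = w"
        using n(1) by (auto simp: exp_of_nat_mult[symmetric] power_0_left)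
      thus ?thesis using that w_def by blast
    qed
    then obtain H' f' where H': "pchar H' f'" "H \<subseteq> H'" "b \<in> H'" "\<And>h. h \<in> H \<Longrightarrow> f' h = f h"
      using pchar_extend[OF pc(1) b n] by metis
    have "(H', f') \<in> P" using H' pc by (auto simp: P_def)
    hence "M (H', f') \<le> M x" by (rule x(2))
    moreover have "H \<inter> reps \<subset> H' \<inter> reps"
    proof -
      obtain b' where b': "b' \<in> reps" "b' \<simeq> b" using exists_rep by blast
      have "b' \<in> H'" using pcharD(3)[OF H'(1,3) b'(2)] .
      moreover have "b' \<notin> H" using nb pcharD(3)[OF pc(1) _ gcong_sym[OF b'(2)]] by blast
      ultimately show ?thesis using H'(2) b'(1) by blast
    qed
    hence "M x < M (H', f')" unfolding M_def Hf using finite_reps by (intro psubset_card_mono) auto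
    ultimately show False by simp
  qed
  have mem: "b \<in> H \<longleftrightarrow> coprime b g" for b using full pcharD(2)[OF pc(1)] by blast
  define \<phi> where "\<phi> b = (if coprime b g then f b else 0)" for b
  have "\<phi> (b * c) = \<phi> b * \<phi> c" for b c
    using pcharD(6)[OF pc(1), of b c] by (simp add: \<phi>_def mem coprime_mult_iff)
  moreover have "\<phi> b = \<phi> c" if "b \<simeq> c" for b c
    using pcharD(4)[OF pc(1), of c b] that coprime_gcong[OF that] by (simp add: \<phi>_def mem)
  moreover have "\<phi> b \<noteq> 0 \<longleftrightarrow> coprime b g" for b
    using pcharD(7)[OF pc(1), of b] by (simp add: \<phi>_def mem)
  ultimately have "gchar \<phi>" unfolding gchar_def by blast
  moreover have "\<phi> a \<noteq> 1" using a pc by (simp add: \<phi>_def)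
  ultimately show ?thesis using that by blast
qed

lemma gchar_1: "gchar \<phi> \<Longrightarrow> \<phi> 1 = 1"
  unfolding gchar_def by (metis coprime_1_left mult_1 mult_cancel_right1)

lemma gchar_mult: "gchar \<phi> \<Longrightarrow> \<phi> (a * b) = \<phi> a * \<phi> b"
  and gchar_gcong: "gchar \<phi> \<Longrightarrow> a \<simeq> b \<Longrightarrow> \<phi> a = \<phi> b"
  and gchar_nz: "gchar \<phi> \<Longrightarrow> \<phi> a \<noteq> 0 \<longleftrightarrow> coprime a g"
  by (auto simp: gchar_def)

lemma gchar_power: "gchar \<phi> \<Longrightarrow> \<phi> (a ^ n) = \<phi> a ^ n"
  by (induction n) (auto simp: gchar_1 gchar_mult)

lemma gchar_root: "gchar \<phi> \<Longrightarrow> coprime a g \<Longrightarrow> \<phi> a ^ unit_exp = 1"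
  by (metis gchar_1 gchar_gcong gchar_power power_unit_exp)

lemma norm_gchar: "gchar \<phi> \<Longrightarrow> norm (\<phi> a) = (if coprime a g then 1 else 0)"
  using gchar_root[of \<phi> a] gchar_nz[of \<phi> a] unit_exp_ge_1
  by (auto dest!: power_eq_1_iff)

lemma finite_gchars: "finite {\<phi>. gchar \<phi>}"
proof -
  define Z where "Z = insert 0 {z::complex. z ^ unit_exp = 1}"
  have "finite Z" unfolding Z_def using finite_nth_roots[of unit_exp 1] unit_exp_ge_1 by simp
  hence "finite (PiE reps (\<lambda>_. Z))" by (intro finite_PiE finite_reps)
  moreover have "(\<lambda>\<phi>. restrict \<phi> reps) ` {\<phi>. gchar \<phi>} \<subseteq> PiE reps (\<lambda>_. Z)"
    using gchar_root gchar_nz by (force simp: Z_def)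
  moreover have "inj_on (\<lambda>\<phi>. restrict \<phi> reps) {\<phi>. gchar \<phi>}"
  proof (rule inj_onI)
    fix \<phi> \<phi>' assume *: "\<phi> \<in> {\<phi>. gchar \<phi>}" "\<phi>' \<in> {\<phi>. gchar \<phi>}" "restrict \<phi> reps = restrict \<phi>' reps"
    show "\<phi> = \<phi>'"
    proof
      fix a
      obtain b where "b \<in> reps" "b \<simeq> a" using exists_rep by blast
      thus "\<phi> a = \<phi>' a" using * gchar_gcong by (metis mem_Collect_eq restrict_apply')
    qed
  qed
  ultimately show ?thesis by (meson finite_imageD finite_subset)
qed

definition principal :: "gauss_int \<Rightarrow> complex" where "principal a = (if coprime a g then 1 else 0)"

lemma gchar_principal: "gchar principal"
  unfolding gchar_def principal_def using coprime_gcong by (auto simp: coprime_mult_iff)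

lemma gchar_times: "gchar \<phi> \<Longrightarrow> gchar \<phi>' \<Longrightarrow> gchar (\<lambda>a. \<phi> a * \<phi>' a)"
  unfolding gchar_def by (auto simp: mult_ac)

lemma gchar_cnj: "gchar \<phi> \<Longrightarrow> gchar (\<lambda>a. cnj (\<phi> a))"
  unfolding gchar_def by auto

text \<open>Multiplication by a character with value other than 1 at \<open>c\<close> permutes the
  characters, so the sum equals that value times itself.\<close>

lemma sum_gchar:
  assumes "coprime c g" "\<not> c \<simeq> 1"
  shows "(\<Sum>\<phi> | gchar \<phi>. \<phi> c) = 0"
proof -
  obtain \<phi>1 where \<phi>1: "gchar \<phi>1" "\<phi>1 c \<noteq> 1" using exists_gchar_separating[OF assms] .
  define S where "S = (\<Sum>\<phi> | gchar \<phi>. \<phi> c)"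
  have inv: "cnj (\<phi>1 a) * \<phi>1 a = principal a" for a
    using norm_gchar[OF \<phi>1(1), of a] gchar_nz[OF \<phi>1(1), of a]
    by (auto simp: principal_def mult.commute complex_norm_square[symmetric])
  have id0: "principal a * \<phi> a = \<phi> a" if "gchar \<phi>" for \<phi> a
    using gchar_nz[OF that, of a] by (auto simp: principal_def)
  have "S = (\<Sum>\<phi> | gchar \<phi>. \<phi>1 c * \<phi> c)"
    unfolding S_def
  proof (rule sum.reindex_bij_witness[of _ "\<lambda>\<phi> a. \<phi>1 a * \<phi> a" "\<lambda>\<phi> a. cnj (\<phi>1 a) * \<phi> a"])
    fix \<phi> assume "\<phi> \<in> {\<phi>. gchar \<phi>}"
    hence \<phi>: "gchar \<phi>" by simp
    show "(\<lambda>a. \<phi>1 a * (cnj (\<phi>1 a) * \<phi> a)) = \<phi>" "(\<lambda>a. cnj (\<phi>1 a) * (\<phi>1 a * \<phi> a)) = \<phi>"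
      using inv id0[OF \<phi>] by (auto simp: fun_eq_iff mult_ac)
    show "(\<lambda>a. cnj (\<phi>1 a) * \<phi> a) \<in> {\<phi>. gchar \<phi>}" "(\<lambda>a. \<phi>1 a * \<phi> a) \<in> {\<phi>. gchar \<phi>}"
      using gchar_times gchar_cnj \<phi> \<phi>1 by simp_all
    show "\<phi>1 c * (cnj (\<phi>1 c) * \<phi> c) = \<phi> c"
      using inv[of c] id0[OF \<phi>, of c] by (metis mult.assoc mult.commute)
  qed
  also have "\<dots> = \<phi>1 c * S" by (simp add: S_def sum_distrib_left)
  finally have "(\<phi>1 c - 1) * S = 0" by (simp add: algebra_simps)
  thus ?thesis using \<phi>1(2) by (simp add: S_def)
qed

text \<open>On units \<open>cnj (\<phi> b)\<close> is the value of \<open>\<phi>\<close> at an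
  inverse \<open>x\<close> of \<open>b\<close>, so the sum becomes the one over
  \<open>\<phi> (x * a)\<close>.\<close>

lemma gchar_orthogonality:
  assumes b: "coprime b g"
  shows "(\<Sum>\<phi> | gchar \<phi>. cnj (\<phi> b) * \<phi> a) = (if a \<simeq> b then of_nat (card {\<phi>. gchar \<phi>}) else 0)"
proof (cases "coprime a g")
  case False
  hence "\<not> a \<simeq> b" using b coprime_gcong by blast
  moreover have "\<phi> a = 0" if "gchar \<phi>" for \<phi> using gchar_nz[OF that] False by blast
  ultimately show ?thesis by (auto intro!: sum.neutral)
next
  case True
  obtain x where x: "b * x \<simeq> 1" using b coprime_iff_inverse by blast
  have cx: "coprime x g" using coprime_gcong[OF x] by (simp add: coprime_mult_iff)
  have eq: "cnj (\<phi> b) * \<phi> a = \<phi> (x * a)" if \<phi>: "gchar \<phi>" for \<phi>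
  proof -
    have "\<phi> b * \<phi> x = 1" using gchar_gcong[OF \<phi> x] gchar_mult[OF \<phi>] gchar_1[OF \<phi>] by simp
    moreover have "\<phi> b * cnj (\<phi> b) = 1" using norm_gchar[OF \<phi>, of b] b by (simp add: complex_norm_square[symmetric])
    ultimately have "\<phi> b * (cnj (\<phi> b) - \<phi> x) = 0" by (simp add: algebra_simps)
    hence "cnj (\<phi> b) = \<phi> x" using gchar_nz[OF \<phi>] b by auto
    thus ?thesis using gchar_mult[OF \<phi>] by simp
  qed
  have "(\<Sum>\<phi> | gchar \<phi>. cnj (\<phi> b) * \<phi> a) = (\<Sum>\<phi> | gchar \<phi>. \<phi> (x * a))" by (intro sum.cong) (auto simp: eq)
  moreover have iff: "x * a \<simeq> 1 \<longleftrightarrow> a \<simeq> b"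
  proof
    assume "x * a \<simeq> 1"
    hence "x * a \<simeq> x * b" using x gcong_sym gcong_trans by (metis mult.commute)
    thus "a \<simeq> b" using gcong_cancel[OF cx] by blast
  next
    assume "a \<simeq> b"
    hence "x * a \<simeq> x * b" using gcong_mult gcong_refl by blast
    thus "x * a \<simeq> 1" using x gcong_trans by (metis mult.commute)
  qed
  moreover have "(\<Sum>\<phi> | gchar \<phi>. \<phi> (x * a)) = of_nat (card {\<phi>. gchar \<phi>})" if "x * a \<simeq> 1"
  proof -
    have "\<phi> (x * a) = 1" if "gchar \<phi>" for \<phi>
      using gchar_gcong[OF that \<open>x * a \<simeq> 1\<close>] gchar_1[OF that] by simp
    hence "(\<Sum>\<phi> | gchar \<phi>. \<phi> (x * a)) = (\<Sum>\<phi> | gchar \<phi>. 1)" by (intro sum.cong) auto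
    thus ?thesis by simp
  qed
  moreover have "coprime (x * a) g" using cx True by (simp add: coprime_mult_iff)
  ultimately show ?thesis using sum_gchar[of "x * a"] by auto
qed

end

section \<open>Dirichlet series over the Gaussian integers\<close>

text \<open>By the local majorants the finite partial sums converge uniformly on small closed balls
  along the filter of finite subsets. Holomorphy and termwise differentiation follow; derivatives of
  every order are wanted for the completely monotone function of the real case.\<close>

lemma locally_uniform_infsum:
  fixes f :: "'i \<Rightarrow> complex \<Rightarrow> complex"
  assumes S: "open S" and hol: "\<And>i. i \<in> I \<Longrightarrow> f i holomorphic_on S"
    and dom: "\<And>z. z \<in> S \<Longrightarrow> \<exists>d>0. \<exists>M. cball z d \<subseteq> S \<and> M summable_on I \<and> (\<forall>i\<in>I. \<forall>s\<in>cball z d. norm (f i s) \<le> M i)"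
  shows holomorphic_infsum: "(\<lambda>s. infsum (\<lambda>i. f i s) I) holomorphic_on S"
    and has_sum_higher_deriv: "z \<in> S \<Longrightarrow> ((\<lambda>i. (deriv ^^ m) (f i) z) has_sum (deriv ^^ m) (\<lambda>s. infsum (\<lambda>i. f i s) I) z) I"
proof -
  have ul: "\<exists>d>0. cball z d \<subseteq> S \<and> uniform_limit (cball z d) (\<lambda>X s. \<Sum>i\<in>X. f i s) (\<lambda>s. infsum (\<lambda>i. f i s) I) (finite_subsets_at_top I)"
    if "z \<in> S" for z
    using dom[OF that] Weierstrass_m_test_general[of I "cball z _" f] by metis
  have holX: "(\<lambda>s. \<Sum>i\<in>X. f i s) holomorphic_on S" if "X \<subseteq> I" for X
    by (intro holomorphic_intros hol) (use that in auto)
  have ev: "\<forall>\<^sub>F X in finite_subsets_at_top I. X \<subseteq> I \<and> finite X"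
    using eventually_finite_subsets_at_top_weakI by (metis (mono_tags, lifting))
  have "(\<lambda>s. infsum (\<lambda>i. f i s) I) field_differentiable at z" if z: "z \<in> S" for z
  proof -
    obtain d where d: "d > 0" "cball z d \<subseteq> S"
      and u: "uniform_limit (cball z d) (\<lambda>X s. \<Sum>i\<in>X. f i s) (\<lambda>s. infsum (\<lambda>i. f i s) I) (finite_subsets_at_top I)"
      using ul[OF z] by blast
    have "\<forall>\<^sub>F X in finite_subsets_at_top I. continuous_on (cball z d) (\<lambda>s. \<Sum>i\<in>X. f i s) \<and> (\<lambda>s. \<Sum>i\<in>X. f i s) holomorphic_on ball z d"
      using ev
    proof eventually_elim
      case (elim X)
      have "(\<lambda>s. \<Sum>i\<in>X. f i s) holomorphic_on cball z d"
        using holX[of X] elim d(2) holomorphic_on_subset by blast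
      thus ?case using holomorphic_on_imp_continuous_on holomorphic_on_subset ball_subset_cball by blast
    qed
    from holomorphic_uniform_limit[OF this u] have "(\<lambda>s. infsum (\<lambda>i. f i s) I) holomorphic_on ball z d" by auto
    thus ?thesis using d(1) by (simp add: holomorphic_on_imp_differentiable_at)
  qed
  thus "(\<lambda>s. infsum (\<lambda>i. f i s) I) holomorphic_on S"
    by (simp add: holomorphic_on_def field_differentiable_at_within)
  assume z: "z \<in> S"
  obtain d where d: "d > 0" "cball z d \<subseteq> S"
    and u: "uniform_limit (cball z d) (\<lambda>X s. \<Sum>i\<in>X. f i s) (\<lambda>s. infsum (\<lambda>i. f i s) I) (finite_subsets_at_top I)"
    using ul[OF z] by blast
  have bS: "ball z d \<subseteq> S" using d(2) ball_subset_cball by blast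
  have "((\<lambda>X. (deriv ^^ m) (\<lambda>s. \<Sum>i\<in>X. f i s) z) \<longlongrightarrow> (deriv ^^ m) (\<lambda>s. infsum (\<lambda>i. f i s) I) z) (finite_subsets_at_top I)"
  proof (rule higher_deriv_complex_uniform_limit[where A = "ball z d"])
    show "uniform_limit (ball z d) (\<lambda>X s. \<Sum>i\<in>X. f i s) (\<lambda>s. infsum (\<lambda>i. f i s) I) (finite_subsets_at_top I)"
      using u ball_subset_cball uniform_limit_on_subset by blast
    show "\<forall>\<^sub>F X in finite_subsets_at_top I. (\<lambda>s. \<Sum>i\<in>X. f i s) holomorphic_on ball z d"
      using ev by eventually_elim (use holX bS holomorphic_on_subset in blast)
  qed (use d in auto)
  moreover have "\<forall>\<^sub>F X in finite_subsets_at_top I. (deriv ^^ m) (\<lambda>s. \<Sum>i\<in>X. f i s) z = (\<Sum>i\<in>X. (deriv ^^ m) (f i) z)"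
    using ev
  proof eventually_elim
    case (elim X)
    hence "finite X" "X \<subseteq> I" by auto
    thus ?case
    proof (induction X rule: finite_induct)
      case empty
      have "(deriv ^^ m) (\<lambda>s. 0) z = (0::complex)" by (induction m) (auto simp: higher_deriv_const)
      thus ?case by simp
    next
      case (insert i X)
      have "(deriv ^^ m) (\<lambda>s. f i s + (\<Sum>i\<in>X. f i s)) z = (deriv ^^ m) (f i) z + (deriv ^^ m) (\<lambda>s. \<Sum>i\<in>X. f i s) z"
        by (rule higher_deriv_add[of _ S]) (use insert hol holX S z in auto)
      thus ?case using insert by simp
    qed
  qed
  ultimately show "((\<lambda>i. (deriv ^^ m) (f i) z) has_sum (deriv ^^ m) (\<lambda>s. infsum (\<lambda>i. f i s) I) z) I"
    unfolding has_sum_def by (rule Lim_transform_eventually)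
qed

text \<open>\<open>m\<close> is the order of vanishing of \<open>f\<close> at \<open>z0\<close>,
  finite because \<open>f\<close> does not vanish identically on the connected set \<open>S\<close>.
  The limit form, unlike a residue, can later be taken along a horizontal ray from the
  right.\<close>

lemma log_derivative_limit:
  assumes f: "f holomorphic_on S" and S: "open S" "connected S" "z0 \<in> S" and nz: "w \<in> S" "f w \<noteq> 0"
  obtains m :: nat where "((\<lambda>z. (z - z0) * (deriv f z / f z)) \<longlongrightarrow> of_nat m) (at z0)" "m > 0 \<longleftrightarrow> f z0 = 0"
proof (cases "f z0 = 0")
  case False
  have "deriv f holomorphic_on S" using f S(1) by (rule holomorphic_deriv)
  hence "(deriv f \<longlongrightarrow> deriv f z0) (at z0)" "(f \<longlongrightarrow> f z0) (at z0)"
    using f S by (auto simp: continuous_on_eq_continuous_at isCont_def dest!: holomorphic_on_imp_continuous_on)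
  hence "((\<lambda>z. (z - z0) * (deriv f z / f z)) \<longlongrightarrow> (z0 - z0) * (deriv f z0 / f z0)) (at z0)"
    using False by (intro tendsto_intros) auto
  thus ?thesis using that[of 0] False by simp
next
  case True
  have "\<not> f constant_on S" using nz True S(3) unfolding constant_on_def by metis
  then obtain g r n where gr: "0 < n" "0 < r" "ball z0 r \<subseteq> S" "g holomorphic_on ball z0 r"
      "\<And>w. w \<in> ball z0 r \<Longrightarrow> f w = (w - z0) ^ n * g w" "\<And>w. w \<in> ball z0 r \<Longrightarrow> g w \<noteq> 0"
    using holomorphic_factor_zero_nonconstant[OF f S True] by metis
  have z0: "z0 \<in> ball z0 r" using gr by simp
  have eq: "(z - z0) * (deriv f z / f z) = of_nat n + (z - z0) * (deriv g z / g z)" if z: "z \<in> ball z0 r - {z0}" for z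
  proof -
    have g': "(g has_field_derivative deriv g z) (at z)"
      using gr(4) z by (intro holomorphic_derivI[of _ "ball z0 r"]) auto
    have "((\<lambda>w. (w - z0) ^ n * g w) has_field_derivative
       (of_nat n * (z - z0) ^ (n - 1)) * g z + (z - z0) ^ n * deriv g z) (at z)"
      by (rule derivative_eq_intros g' refl | simp)+
    hence "(f has_field_derivative (of_nat n * (z - z0) ^ (n - 1)) * g z + (z - z0) ^ n * deriv g z) (at z)"
      by (rule has_field_derivative_transform_within_open[where S = "ball z0 r"]) (use z gr in auto)
    hence "deriv f z = (of_nat n * (z - z0) ^ (n - 1)) * g z + (z - z0) ^ n * deriv g z" by (rule DERIV_imp_deriv)
    moreover have q: "(z - z0) ^ n = (z - z0) * (z - z0) ^ (n - 1)" using gr(1) by (cases n) auto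
    moreover have fz: "f z = (z - z0) * (z - z0) ^ (n - 1) * g z" using gr z q by simp
    moreover have "u * ((N * v * G + u * v * G') / (u * v * G)) = N + u * (G' / G)"
      if "u \<noteq> 0" "v \<noteq> 0" "G \<noteq> 0" for u v N G G' :: complex
      using that by (simp add: field_simps)
    moreover have "z - z0 \<noteq> 0" "(z - z0) ^ (n - 1) \<noteq> 0" "g z \<noteq> 0" using gr z by auto
    ultimately show ?thesis by metis
  qed
  have "deriv g holomorphic_on ball z0 r" using gr(4) by (rule holomorphic_deriv) auto
  hence "(deriv g \<longlongrightarrow> deriv g z0) (at z0)" "(g \<longlongrightarrow> g z0) (at z0)"
    using gr(4) z0 by (auto simp: continuous_on_eq_continuous_at isCont_def dest!: holomorphic_on_imp_continuous_on)
  hence "((\<lambda>z. of_nat n + (z - z0) * (deriv g z / g z)) \<longlongrightarrow> of_nat n + (z0 - z0) * (deriv g z0 / g z0)) (at z0)"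
    using gr(6)[OF z0] by (intro tendsto_intros) auto
  moreover have "\<forall>\<^sub>F z in at z0. of_nat n + (z - z0) * (deriv g z / g z) = (z - z0) * (deriv f z / f z)"
    using eventually_at_ball'[OF gr(2)] by eventually_elim (intro eq[symmetric], auto)
  ultimately have "((\<lambda>z. (z - z0) * (deriv f z / f z)) \<longlongrightarrow> of_nat n) (at z0)"
    by (simp add: Lim_transform_eventually)
  thus ?thesis using that[of n] True gr(1) by simp
qed

text \<open>Sums below run over all Gaussian integers: the summand at 0 vanishes because \<open>0 powr s = 0\<close>, and every
  ideal is counted four times.\<close>

definition npow :: "gauss_int \<Rightarrow> complex \<Rightarrow> complex" where
  "npow a s = of_nat (gnorm a) powr (- s)"

lemma npow_mult: "npow (a * b) s = npow a s * npow b s"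
  unfolding npow_def by (simp add: powr_times_real)

lemma npow_1 [simp]: "npow 1 s = 1" and npow_0 [simp]: "npow 0 s = 0"
  by (simp_all add: npow_def)

lemma norm_npow: "norm (npow a s) = real (gnorm a) powr (- Re s)"
  unfolding npow_def by (subst norm_powr_real_powr) auto

lemma npow_holomorphic [holomorphic_intros]: "f holomorphic_on S \<Longrightarrow> (\<lambda>s. npow a (f s)) holomorphic_on S"
  unfolding npow_def by (intro holomorphic_intros)

lemma npow_add: "npow a (s + t) = npow a s * npow a t"
  unfolding npow_def by (simp add: powr_add[symmetric])

lemma gnorm_ge_1: "a \<noteq> 0 \<Longrightarrow> real (gnorm a) \<ge> 1"
  using gnorm_pos_iff[of a] by linarith

lemma norm_npow_mono: "x \<le> Re s \<Longrightarrow> norm (npow a s) \<le> real (gnorm a) powr (- x)"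
  unfolding norm_npow by (cases "a = 0") (auto intro!: powr_mono gnorm_ge_1)

lemma deriv_npow: "(npow a has_field_derivative - of_real (ln (real (gnorm a))) * npow a s) (at s)"
proof (cases "a = 0")
  case True
  thus ?thesis by (simp add: npow_def[abs_def])
next
  case False
  have "((\<lambda>z. of_nat (gnorm a) powr z) has_field_derivative Ln (of_nat (gnorm a)) * of_nat (gnorm a) powr (- s)) (at (- s))"
    using False by (intro has_field_derivative_powr_right) auto
  moreover have "(uminus has_field_derivative (- 1 :: complex)) (at s)" by (auto intro!: derivative_eq_intros)
  ultimately have "((\<lambda>z. of_nat (gnorm a) powr (- z)) has_field_derivative Ln (of_nat (gnorm a)) * of_nat (gnorm a) powr (- s) * (- 1)) (at s)"
    using DERIV_chain2 by blast
  moreover have "Ln (of_nat (gnorm a)) = of_real (ln (real (gnorm a)))"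
    using False Ln_of_real[of "real (gnorm a)"] by simp
  ultimately show ?thesis by (simp add: npow_def[abs_def] mult_ac)
qed

lemma summable_int_powr:
  assumes "x > 1"
  shows "(\<lambda>n::int. (1 + real_of_int \<bar>n\<bar>) powr (- x)) summable_on UNIV"
proof -
  have "summable (\<lambda>n. real (Suc n) powr (- x))"
    using assms by (subst summable_Suc_iff[of "\<lambda>n. real n powr (- x)"]) (simp add: summable_real_powr_iff)
  hence nat: "(\<lambda>n::nat. (1 + real n) powr (- x)) summable_on UNIV"
    by (subst summable_on_UNIV_nonneg_real_iff) (auto simp: add.commute)
  have 1: "(\<lambda>n::int. (1 + real_of_int \<bar>n\<bar>) powr (- x)) summable_on range int"
    by (subst summable_on_reindex) (use nat in \<open>auto simp: o_def\<close>)
  have 2: "(\<lambda>n::int. (1 + real_of_int \<bar>n\<bar>) powr (- x)) summable_on range (\<lambda>n. - int n)"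
    by (subst summable_on_reindex) (use nat in \<open>auto simp: o_def inj_def\<close>)
  have "range int \<union> range (\<lambda>n. - int n) = UNIV"
    by (auto simp: image_iff) (metis int_cases2)
  thus ?thesis using summable_on_union[OF 1 2] by simp
qed

text \<open>A product of two one-dimensional sums dominates the lattice sum: if \<open>m\<close> is
  the larger absolute coordinate of a nonzero \<open>a\<close>, then
  \<open>(1 + |ReZ a|) (1 + |ImZ a|) \<le> 4 m^2 \<le> 4 N(a)\<close>.\<close>

lemma summable_gnorm_powr:
  assumes "x > 1"
  shows "(\<lambda>a. real (gnorm a) powr (- x)) summable_on UNIV"
proof -
  define h where "h n = (1 + real_of_int \<bar>n\<bar>) powr (- x)" for n :: int
  have h: "h summable_on UNIV" unfolding h_def by (rule summable_int_powr[OF assms])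
  have "(\<lambda>(m, n). h m * h n) summable_on (Sigma UNIV (\<lambda>_. UNIV))"
  proof (rule summable_on_SigmaI)
    show "((\<lambda>n. case (m, n) of (m, n) \<Rightarrow> h m * h n) has_sum h m * infsum h UNIV) UNIV" for m
      using has_sum_cmult_right[OF has_sum_infsum[OF h], of "h m"] by simp
    show "(\<lambda>m. h m * infsum h UNIV) summable_on UNIV" by (rule summable_on_cmult_left[OF h])
  qed (auto simp: h_def)
  hence 1: "(\<lambda>(m, n). 4 powr x * (h m * h n)) summable_on UNIV"
    using summable_on_cmult_right[of "\<lambda>(m, n). h m * h n" UNIV "4 powr x"] by (simp add: case_prod_unfold)
  have bij: "bij_betw (\<lambda>a. (ReZ a, ImZ a)) UNIV UNIV"
    by (rule bij_betwI[of _ _ _ "\<lambda>(m, n). Gauss_Int m n"]) auto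
  have 2: "(\<lambda>a. 4 powr x * (h (ReZ a) * h (ImZ a))) summable_on UNIV"
    using summable_on_reindex_bij_betw[OF bij, of "\<lambda>(m, n). 4 powr x * (h m * h n)"] 1 by simp
  have "real (gnorm a) powr (- x) \<le> 4 powr x * (h (ReZ a) * h (ImZ a))" for a
  proof (cases "a = 0")
    case False
    define m where "m = max \<bar>ReZ a\<bar> \<bar>ImZ a\<bar>"
    have "m \<ge> 1" using False by (auto simp: m_def gauss_int_eq_iff zero_gauss_int_def)
    have m2: "m\<^sup>2 \<le> (ReZ a)\<^sup>2 + (ImZ a)\<^sup>2" by (auto simp: m_def max_def)
    have "(1 + \<bar>ReZ a\<bar>) * (1 + \<bar>ImZ a\<bar>) \<le> (2 * m) * (2 * m)"
      using \<open>m \<ge> 1\<close> by (intro mult_mono) (auto simp: m_def)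
    also have "\<dots> \<le> 4 * int (gnorm a)" using m2 by (simp add: gnorm_def power2_eq_square)
    finally have "real_of_int ((1 + \<bar>ReZ a\<bar>) * (1 + \<bar>ImZ a\<bar>)) \<le> real_of_int (4 * int (gnorm a))"
      by (simp only: of_int_le_iff)
    hence "(1 + real_of_int \<bar>ReZ a\<bar>) * (1 + real_of_int \<bar>ImZ a\<bar>) \<le> 4 * real (gnorm a)" by simp
    hence "(4 * real (gnorm a)) powr (- x) \<le> ((1 + real_of_int \<bar>ReZ a\<bar>) * (1 + real_of_int \<bar>ImZ a\<bar>)) powr (- x)"
      using assms by (intro powr_mono2') auto
    also have "\<dots> = h (ReZ a) * h (ImZ a)" by (simp add: h_def powr_mult)
    finally have "4 powr x * (4 powr (- x) * real (gnorm a) powr (- x)) \<le> 4 powr x * (h (ReZ a) * h (ImZ a))"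
      by (intro mult_left_mono) (simp_all add: powr_mult)
    moreover have "4 powr x * 4 powr (- x) = (1::real)" by (simp add: powr_minus)
    ultimately show ?thesis by (simp only: mult.assoc[symmetric] mult_1)
  qed (simp add: h_def)
  thus ?thesis by (intro summable_on_comparison_test[OF 2]) auto
qed

text \<open>The \<open>k + 1\<close> points with real part \<open>k + 1\<close> and imaginary part
  from 0 to \<open>k\<close> have norm at most \<open>2 (k + 1)^2\<close>, so each such column
  contributes at least half a term of the harmonic series.\<close>

lemma not_summable_gnorm:
  assumes "C \<ge> 0"
  shows "\<exists>F. finite F \<and> 0 \<notin> F \<and> (\<Sum>a\<in>F. 1 / real (gnorm a)) > C"
proof -
  have "\<not> summable (\<lambda>n. 1 / real (Suc n))"
    using not_summable_harmonic[where 'a = real] summable_Suc_iff[of "\<lambda>n. 1 / real n"] by (simp add: inverse_eq_divide)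
  hence "\<not> (\<forall>n. (\<Sum>k<n. 1 / real (Suc k)) \<le> 2 * C)"
    using summableI_nonneg_bounded[of "\<lambda>n. 1 / real (Suc n)" "2 * C"] by auto
  then obtain n where n: "(\<Sum>k<n. 1 / real (Suc k)) > 2 * C" by (auto simp: not_le)
  define T where "T = Sigma {..<n} (\<lambda>k. {..k})"
  define e where "e = (\<lambda>(k, j). Gauss_Int (int (Suc k)) (int j))"
  have inj: "inj_on e T" by (auto simp: inj_on_def e_def)
  have finT: "finite T" by (simp add: T_def)
  have "1 / (2 * (real (Suc k))\<^sup>2) \<le> 1 / real (gnorm (e (k, j)))" if "j \<le> k" for k j
  proof -
    have "(real j)\<^sup>2 \<le> (real (Suc k))\<^sup>2" using that by (intro power_mono) auto
    moreover have g: "real (gnorm (e (k, j))) = (real (Suc k))\<^sup>2 + (real j)\<^sup>2"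
      by (simp add: gnorm_cmod e_def complex_of_gauss_int_def cmod_power2)
    ultimately have "real (gnorm (e (k, j))) \<le> 2 * (real (Suc k))\<^sup>2" by simp
    moreover have "0 < real (gnorm (e (k, j)))" unfolding g by (simp add: add_pos_nonneg)
    ultimately show ?thesis by (intro divide_left_mono) auto
  qed
  hence "(\<Sum>(k, j)\<in>T. 1 / (2 * (real (Suc k))\<^sup>2)) \<le> (\<Sum>x\<in>T. 1 / real (gnorm (e x)))"
    by (intro sum_mono) (auto simp: T_def)
  moreover have "(\<Sum>(k, j)\<in>T. 1 / (2 * (real (Suc k))\<^sup>2)) = (\<Sum>k<n. \<Sum>j\<le>k. 1 / (2 * (real (Suc k))\<^sup>2))"
    unfolding T_def by (subst sum.Sigma) auto
  moreover have "(\<Sum>j\<le>k. 1 / (2 * (real (Suc k))\<^sup>2)) = (1 / real (Suc k)) / 2" for k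
  proof -
    have 1: "(\<Sum>j\<le>k. 1 / (2 * (real (Suc k))\<^sup>2)) = real (Suc k) * (1 / (2 * (real (Suc k))\<^sup>2))" by simp
    have "s * (1 / (2 * s\<^sup>2)) = (1 / s) / 2" if "s > 0" for s :: real
      using that by (simp add: power2_eq_square)
    from this[of "real (Suc k)"] have "real (Suc k) * (1 / (2 * (real (Suc k))\<^sup>2)) = (1 / real (Suc k)) / 2" by simp
    thus ?thesis using 1 by (simp only:)
  qed
  ultimately have "(\<Sum>k<n. (1 / real (Suc k)) / 2) \<le> (\<Sum>a\<in>e ` T. 1 / real (gnorm a))"
    by (simp add: sum.reindex[OF inj] o_def)
  moreover have "(\<Sum>k<n. (1 / real (Suc k)) / 2) > C"
    unfolding sum_divide_distrib[symmetric] using n by linarith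
  ultimately show ?thesis using finT
    by (intro exI[of _ "e ` T"]) (auto simp: e_def zero_gauss_int_def)
qed

section \<open>The series of a character and its logarithmic derivative\<close>

definition L_series :: "(gauss_int \<Rightarrow> complex) \<Rightarrow> complex \<Rightarrow> complex" where
  "L_series \<psi> s = (\<Sum>\<^sub>\<infinity>a. \<psi> a * npow a s)"

definition ln_norm :: "gauss_int \<Rightarrow> real" where "ln_norm a = ln (real (gnorm a))"

definition prime_power_term :: "(gauss_int \<Rightarrow> complex) \<Rightarrow> complex \<Rightarrow> gauss_int \<times> nat \<Rightarrow> complex" where
  "prime_power_term \<psi> s = (\<lambda>(p, m). of_real (ln_norm p) * (\<psi> (p ^ m) * npow (p ^ m) s))"

text \<open>For a multiplicative \<open>\<psi>\<close> that is trivial on units this is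
  \<open>-4 L'/L\<close> on \<open>Re s > 1\<close>, the 4 counting the generators of each prime
  ideal.\<close>

definition prime_power_series :: "(gauss_int \<Rightarrow> complex) \<Rightarrow> complex \<Rightarrow> complex" where
  "prime_power_series \<psi> s = infsum (prime_power_term \<psi> s) prime_powers"

lemma ln_norm_nonneg: "ln_norm a \<ge> 0"
  unfolding ln_norm_def by (cases "a = 0") (use gnorm_ge_1[of a] in \<open>auto intro!: ln_ge_zero simp del: gnorm_pos_iff\<close>)

lemma half_plane_cball:
  assumes "Re z > c"
  obtains d x where "d > 0" "x > c" "\<And>s. s \<in> cball z d \<Longrightarrow> Re s \<ge> x" "cball z d \<subseteq> {s. Re s > c}"
proof -
  define d where "d = (Re z - c) / 2"
  have d: "d > 0" using assms by (simp add: d_def)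
  have *: "Re s \<ge> Re z - d" if "s \<in> cball z d" for s
    using that abs_Re_le_cmod[of "z - s"] by (auto simp: dist_norm)
  show ?thesis
  proof (rule that[of d "Re z - d"])
    show "cball z d \<subseteq> {s. Re s > c}" using * d by (force simp: d_def field_simps)
  qed (use d * in \<open>auto simp: d_def field_simps\<close>)
qed

lemma half_plane_dom:
  fixes f :: "'i \<Rightarrow> complex \<Rightarrow> complex"
  assumes M: "\<And>x. x > c \<Longrightarrow> M x summable_on I"
    and le: "\<And>i s x. i \<in> I \<Longrightarrow> x > c \<Longrightarrow> x \<le> Re s \<Longrightarrow> norm (f i s) \<le> M x i"
    and z: "z \<in> {s. Re s > c}"
  shows "\<exists>d>0. \<exists>M. cball z d \<subseteq> {s. Re s > c} \<and> M summable_on I \<and> (\<forall>i\<in>I. \<forall>s\<in>cball z d. norm (f i s) \<le> M i)"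
proof -
  obtain d x where d: "d > 0" "x > c" "\<And>s. s \<in> cball z d \<Longrightarrow> Re s \<ge> x" "cball z d \<subseteq> {s. Re s > c}"
    using half_plane_cball[of c z] z by auto
  show ?thesis
    by (intro exI[of _ d] conjI exI[of _ "M x"] ballI d M le) auto
qed

lemma open_Re_gt: "open {s. Re s > c}"
  by (rule open_halfspace_Re_gt)

context
  fixes \<psi> :: "gauss_int \<Rightarrow> complex"
  assumes le1: "norm (\<psi> a) \<le> 1"
begin

lemma norm_L_term: "x \<le> Re s \<Longrightarrow> norm (\<psi> a * npow a s) \<le> real (gnorm a) powr (- x)"
  using mult_mono[OF le1[of a] norm_npow_mono[of x s a]] by (simp add: norm_mult)

lemma L_series_dom:
  assumes "z \<in> {s. Re s > 1}"
  shows "\<exists>d>0. \<exists>M. cball z d \<subseteq> {s. Re s > 1} \<and> M summable_on UNIV \<and> (\<forall>a\<in>UNIV. \<forall>s\<in>cball z d. norm (\<psi> a * npow a s) \<le> M a)"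
  by (rule half_plane_dom[where M = "\<lambda>x a. real (gnorm a) powr (- x)"])
     (use assms norm_L_term summable_gnorm_powr in auto)

lemma L_series_holomorphic: "L_series \<psi> holomorphic_on {s. Re s > 1}"
  unfolding L_series_def[abs_def] using L_series_dom
  by (intro holomorphic_infsum[OF open_Re_gt] holomorphic_intros) auto

lemma L_series_summable: "Re s > 1 \<Longrightarrow> (\<lambda>a. \<psi> a * npow a s) summable_on UNIV"
  by (rule abs_summable_summable, rule Infinite_Sum.abs_summable_on_comparison_test'[OF summable_gnorm_powr[of "Re s"]])
     (auto intro: norm_L_term)

lemma L_series_has_sum: "Re s > 1 \<Longrightarrow> ((\<lambda>a. \<psi> a * npow a s) has_sum L_series \<psi> s) UNIV"
  unfolding L_series_def by (intro has_sum_infsum L_series_summable)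

lemma L_series_deriv:
  assumes s: "Re s > 1"
  shows "((\<lambda>a. - of_real (ln_norm a) * (\<psi> a * npow a s)) has_sum deriv (L_series \<psi>) s) UNIV"
proof -
  have "((\<lambda>a. (deriv ^^ 1) (\<lambda>s. \<psi> a * npow a s) s) has_sum (deriv ^^ 1) (\<lambda>s. \<Sum>\<^sub>\<infinity>a. \<psi> a * npow a s) s) UNIV"
    by (rule has_sum_higher_deriv[OF open_Re_gt[of 1]]) (use L_series_dom s in \<open>auto intro!: holomorphic_intros\<close>)
  moreover have "deriv (\<lambda>s. \<psi> a * npow a s) s = - of_real (ln_norm a) * (\<psi> a * npow a s)" for a
    using DERIV_imp_deriv[OF DERIV_cmult[OF deriv_npow[of a s], of "\<psi> a"]] by (simp add: ln_norm_def mult_ac)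
  ultimately show ?thesis by (simp add: L_series_def[abs_def])
qed

text \<open>The double sum over \<open>a\<close> and the prime powers dividing \<open>a\<close>,
  evaluated with the inner sum over prime powers: by \<open>sum_ln_prime_powers_dvd\<close> that
  inner sum is \<open>4 * ln_norm a\<close>, the factor which differentiation produces up to
  sign.\<close>

lemma prime_power_divisor_sum:
  assumes s: "Re s > 1"
  defines "F \<equiv> \<lambda>(a, p, m :: nat). of_real (ln_norm p) * (\<psi> a * npow a s)"
  shows "(\<lambda>x. norm (F x)) summable_on (SIGMA a:UNIV - {0}. {x \<in> prime_powers. fst x ^ snd x dvd a})"
    and "(F has_sum (- 4 * deriv (L_series \<psi>) s)) (SIGMA a:UNIV - {0}. {x \<in> prime_powers. fst x ^ snd x dvd a})"
proof -
  define B where "B a = {x \<in> prime_powers. fst x ^ snd x dvd a}" for a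
  have B: "B a = {(p, m). (p, m) \<in> prime_powers \<and> p ^ m dvd a}" for a by (auto simp: B_def)
  have fin: "finite (B a)" if "a \<noteq> 0" for a unfolding B using finite_prime_powers_dvd[OF that] .
  have sumB: "(\<Sum>x\<in>B a. ln_norm (fst x)) = 4 * ln_norm a" if "a \<noteq> 0" for a
    using sum_ln_prime_powers_dvd[OF that] unfolding B ln_norm_def by (simp add: case_prod_unfold)
  have fibre: "((\<lambda>x. F (a, x)) has_sum (of_real (4 * ln_norm a) * (\<psi> a * npow a s))) (B a)" if "a \<noteq> 0" for a
    using fin[OF that] unfolding sumB[OF that, symmetric]
    by (intro has_sum_finiteI) (auto simp: F_def case_prod_unfold sum_distrib_right)
  have fibre_norm: "infsum (\<lambda>x. norm (F (a, x))) (B a) = norm (of_real (4 * ln_norm a) * (\<psi> a * npow a s))" if "a \<noteq> 0" for a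
    using fin[OF that] ln_norm_nonneg unfolding sumB[OF that, symmetric]
    by (auto simp: F_def case_prod_unfold norm_mult sum_distrib_right sum_nonneg simp flip: of_real_sum)
  have "((\<lambda>a. (- 4) * (- of_real (ln_norm a) * (\<psi> a * npow a s))) has_sum (- 4 * deriv (L_series \<psi>) s)) UNIV"
    by (rule has_sum_cmult_right[OF L_series_deriv[OF s]])
  hence hs: "((\<lambda>a. of_real (4 * ln_norm a) * (\<psi> a * npow a s)) has_sum (- 4 * deriv (L_series \<psi>) s)) (UNIV - {0})"
    by (rule has_sum_cong_neutral[THEN iffD1, rotated -1]) auto
  hence "(\<lambda>a. norm (of_real (4 * ln_norm a) * (\<psi> a * npow a s))) summable_on (UNIV - {0})"
    by (intro iffD1[OF summable_on_iff_abs_summable_on_complex] has_sum_imp_summable)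
  hence "(\<lambda>a. norm (infsum (\<lambda>x. norm (F (a, x))) (B a))) summable_on (UNIV - {0})"
    by (rule summable_on_cong[THEN iffD1, rotated]) (simp add: fibre_norm)
  thus abs: "(\<lambda>x. norm (F x)) summable_on (SIGMA a:UNIV - {0}. {x \<in> prime_powers. fst x ^ snd x dvd a})"
    unfolding Infinite_Sum.abs_summable_on_Sigma_iff B_def[symmetric] using fin by auto
  show "(F has_sum (- 4 * deriv (L_series \<psi>) s)) (SIGMA a:UNIV - {0}. {x \<in> prime_powers. fst x ^ snd x dvd a})"
    unfolding B_def[symmetric]
    by (rule has_sum_SigmaI[OF fibre hs]) (use abs abs_summable_summable B_def in auto)
qed

end

text \<open>The terms with \<open>a = p ^ m\<close> form a subfamily of the absolutely convergent
  double sum for the constant function 1, so convergence over prime powers is inherited from the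
  lattice.\<close>

lemma summable_Pweight:
  assumes "x > 1"
  shows "(\<lambda>(p, m). ln_norm p * real (gnorm (p ^ m)) powr (- x)) summable_on prime_powers"
proof -
  define F where "F = (\<lambda>(a, p, m :: nat). of_real (ln_norm p) * ((1 :: complex) * npow a (of_real x)))"
  define e where "e = (\<lambda>(p :: gauss_int, m :: nat). (p ^ m, p, m))"
  have "(\<lambda>x. norm (F x)) summable_on (SIGMA a:UNIV - {0}. {x \<in> prime_powers. fst x ^ snd x dvd a})"
    unfolding F_def by (rule prime_power_divisor_sum(1)) (use assms in auto)
  hence "(\<lambda>x. norm (F x)) summable_on (e ` prime_powers)"
    by (rule summable_on_subset_banach) (auto simp: e_def prime_powers_def)
  moreover have "inj_on e prime_powers" by (auto simp: e_def inj_on_def)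
  ultimately have "((\<lambda>x. norm (F x)) \<circ> e) summable_on prime_powers" using summable_on_reindex by blast
  thus ?thesis
    by (rule summable_on_cong[THEN iffD1, rotated])
       (use ln_norm_nonneg in \<open>auto simp: F_def e_def norm_mult norm_npow\<close>)
qed

context
  fixes \<psi> :: "gauss_int \<Rightarrow> complex"
  assumes le1: "norm (\<psi> a) \<le> 1"
begin

lemma norm_prime_power_term: "x \<le> Re s \<Longrightarrow> norm (prime_power_term \<psi> s (p, m)) \<le> ln_norm p * real (gnorm (p ^ m)) powr (- x)"
  using norm_L_term[of \<psi> x s "p ^ m"] le1 mult_left_mono[OF _ ln_norm_nonneg[of p]]
  by (simp add: prime_power_term_def norm_mult ln_norm_nonneg)

lemma prime_power_series_dom:
  assumes "z \<in> {s. Re s > 1}"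
  shows "\<exists>d>0. \<exists>M. cball z d \<subseteq> {s. Re s > 1} \<and> M summable_on prime_powers \<and> (\<forall>a\<in>prime_powers. \<forall>s\<in>cball z d. norm (prime_power_term \<psi> s a) \<le> M a)"
  by (rule half_plane_dom[where M = "\<lambda>x (p, m). ln_norm p * real (gnorm (p ^ m)) powr (- x)"])
     (use assms norm_prime_power_term summable_Pweight in auto)

lemma prime_power_term_holomorphic: "(\<lambda>s. prime_power_term \<psi> s x) holomorphic_on S"
  unfolding prime_power_term_def by (cases x) (auto intro!: holomorphic_intros)

lemma prime_power_series_holomorphic: "prime_power_series \<psi> holomorphic_on {s. Re s > 1}"
  unfolding prime_power_series_def[abs_def] using prime_power_series_dom
  by (intro holomorphic_infsum[OF open_Re_gt] prime_power_term_holomorphic) auto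

lemma prime_power_series_summable: "Re s > 1 \<Longrightarrow> prime_power_term \<psi> s summable_on prime_powers"
  by (rule abs_summable_summable, rule Infinite_Sum.abs_summable_on_comparison_test'[OF summable_Pweight[of "Re s"]])
     (use norm_prime_power_term[of "Re s" s] in auto)

lemma prime_power_series_has_sum: "Re s > 1 \<Longrightarrow> (prime_power_term \<psi> s has_sum prime_power_series \<psi> s) prime_powers"
  unfolding prime_power_series_def by (intro has_sum_infsum prime_power_series_summable)

end

locale gauss_mult =
  fixes \<psi> :: "gauss_int \<Rightarrow> complex"
  assumes mult: "\<psi> (a * b) = \<psi> a * \<psi> b" and le1: "norm (\<psi> a) \<le> 1" and unit: "is_unit u \<Longrightarrow> \<psi> u = 1"
begin

text \<open>The double sum of \<open>prime_power_divisor_sum\<close>, now with the prime power fixed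
  first: the nonzero multiples of \<open>p ^ m\<close> are the \<open>p ^ m * b\<close>, and
  complete multiplicativity splits the summand.\<close>

lemma prime_power_series_times_L_series:
  assumes s: "Re s > 1"
  shows "prime_power_series \<psi> s * L_series \<psi> s = - 4 * deriv (L_series \<psi>) s"
proof -
  define F where "F = (\<lambda>(a, p, m :: nat). of_real (ln_norm p) * (\<psi> a * npow a s))"
  define C where "C x = {a. a \<noteq> 0 \<and> fst x ^ snd x dvd a}" for x :: "gauss_int \<times> nat"
  have 1: "(F has_sum (- 4 * deriv (L_series \<psi>) s)) (SIGMA a:UNIV - {0}. {x \<in> prime_powers. fst x ^ snd x dvd a})"
    unfolding F_def by (rule prime_power_divisor_sum(2)[OF le1 s])
  have bij: "bij_betw (\<lambda>(x, a). (a, x)) (SIGMA x:prime_powers. C x) (SIGMA a:UNIV - {0}. {x \<in> prime_powers. fst x ^ snd x dvd a})"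
    by (rule bij_betwI[of _ _ _ "\<lambda>(a, x). (x, a)"]) (auto simp: C_def)
  have 2: "((\<lambda>x. F (case x of (x, a) \<Rightarrow> (a, x))) has_sum (- 4 * deriv (L_series \<psi>) s)) (SIGMA x:prime_powers. C x)"
    using has_sum_reindex_bij_betw[OF bij, of F] 1 by simp
  have fibre: "((\<lambda>a. F (case (x, a) of (x, a) \<Rightarrow> (a, x))) has_sum (prime_power_term \<psi> s x * L_series \<psi> s)) (C x)" if x: "x \<in> prime_powers" for x
  proof -
    obtain p m where pm: "x = (p, m)" "prime_elem p" using x by (auto simp: prime_powers_def)
    have p0: "p \<noteq> 0" using pm by auto
    have bijC: "bij_betw (\<lambda>b. p ^ m * b) (UNIV - {0}) (C x)"
      unfolding bij_betw_def using p0 by (auto simp: inj_on_def C_def pm image_iff elim!: dvdE)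
    have "((\<lambda>b. \<psi> b * npow b s) has_sum L_series \<psi> s) (UNIV - {0})"
      using L_series_has_sum[of \<psi>, OF le1 s] by (rule has_sum_cong_neutral[THEN iffD1, rotated -1]) auto
    hence "((\<lambda>b. prime_power_term \<psi> s x * (\<psi> b * npow b s)) has_sum (prime_power_term \<psi> s x * L_series \<psi> s)) (UNIV - {0})"
      by (rule has_sum_cmult_right)
    moreover have "prime_power_term \<psi> s x * (\<psi> b * npow b s) = F (p ^ m * b, p, m)" for b
      by (simp add: F_def prime_power_term_def pm mult npow_mult mult_ac)
    ultimately show ?thesis
      using has_sum_reindex_bij_betw[OF bijC, of "\<lambda>a. F (a, p, m)"] by (simp add: pm)
  qed
  have "((\<lambda>x. prime_power_term \<psi> s x * L_series \<psi> s) has_sum (- 4 * deriv (L_series \<psi>) s)) prime_powers"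
    by (rule has_sum_SigmaD[OF 2 fibre])
  moreover have "((\<lambda>x. prime_power_term \<psi> s x * L_series \<psi> s) has_sum (prime_power_series \<psi> s * L_series \<psi> s)) prime_powers"
    by (rule has_sum_cmult_left[OF prime_power_series_has_sum[of \<psi>, OF le1 s]])
  ultimately show ?thesis by (rule has_sum_unique[rotated])
qed

text \<open>Far to the right the four units, each contributing 1, outweigh all other terms
  together.\<close>

lemma L_series_exists_nonzero: "\<exists>w. Re w > 1 \<and> L_series \<psi> w \<noteq> 0"
proof -
  define Z2 where "Z2 = (\<Sum>\<^sub>\<infinity>a. real (gnorm a) powr (- 2))"
  have sm2: "(\<lambda>a. real (gnorm a) powr (- 2)) summable_on UNIV" by (rule summable_gnorm_powr) simp
  \<comment> \<open>Nonunits have norm at least 2, so at \<open>2 + n\<close> their terms are at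
    most \<open>1 / 2 ^ n\<close> times the terms of \<open>Z2\<close>; this \<open>n\<close> brings
    their total below 1.\<close>
  obtain n :: nat where n: "Z2 < 2 ^ n" using real_arch_pow[of 2 Z2] by auto
  define x where "x = 2 + real n"
  define U where "U = {u :: gauss_int. is_unit u}"
  have Rex: "Re (of_real x) > 1" by (simp add: x_def)
  have hs: "((\<lambda>a. \<psi> a * npow a (of_real x)) has_sum L_series \<psi> (of_real x)) UNIV"
    by (rule L_series_has_sum[of \<psi>, OF le1 Rex])
  have sm: "(\<lambda>a. \<psi> a * npow a (of_real x)) summable_on A" for A
    by (rule summable_on_subset_banach[OF has_sum_imp_summable[OF hs]]) simp
  have "L_series \<psi> (of_real x) = infsum (\<lambda>a. \<psi> a * npow a (of_real x)) (U \<union> - U)" by (simp add: L_series_def)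
  also have "\<dots> = infsum (\<lambda>a. \<psi> a * npow a (of_real x)) U + infsum (\<lambda>a. \<psi> a * npow a (of_real x)) (- U)"
    by (intro infsum_Un_disjoint sm) auto
  also have "infsum (\<lambda>a. \<psi> a * npow a (of_real x)) U = (\<Sum>a\<in>U. 1)"
    using finite_gauss_units by (auto simp: U_def unit npow_def is_unit_iff_gnorm intro!: sum.cong)
  also have "\<dots> = 4" by (simp add: U_def card_gauss_units)
  finally have L: "L_series \<psi> (of_real x) = 4 + infsum (\<lambda>a. \<psi> a * npow a (of_real x)) (- U)" .
  have bnd: "norm (\<psi> a * npow a (of_real x)) \<le> (1 / 2 ^ n) * real (gnorm a) powr (- 2)" if "a \<notin> U" for a
  proof (cases "a = 0")
    case False
    have "gnorm a \<noteq> 1" "gnorm a > 0" using that False by (auto simp: U_def is_unit_iff_gnorm)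
    hence "real (gnorm a) \<ge> 2" by linarith
    hence "real (gnorm a) powr (- real n) \<le> 2 powr (- real n)" by (intro powr_mono2') auto
    hence "real (gnorm a) powr (- real n) \<le> 1 / 2 ^ n" by (simp add: powr_minus powr_realpow divide_inverse)
    hence "real (gnorm a) powr (- real n) * real (gnorm a) powr (- 2) \<le> (1 / 2 ^ n) * real (gnorm a) powr (- 2)"
      by (intro mult_right_mono) auto
    moreover have "real (gnorm a) powr (- real n) * real (gnorm a) powr (- 2) = real (gnorm a) powr (- x)"
      by (simp add: powr_add[symmetric] x_def algebra_simps)
    ultimately show ?thesis using norm_L_term[of \<psi> x "of_real x" a] le1 by simp
  qed simp
  have "norm (infsum (\<lambda>a. \<psi> a * npow a (of_real x)) (- U)) \<le> infsum (\<lambda>a. norm (\<psi> a * npow a (of_real x))) (- U)"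
    by (rule norm_infsum_bound) (rule iffD1[OF summable_on_iff_abs_summable_on_complex sm])
  also have "\<dots> \<le> infsum (\<lambda>a. (1 / 2 ^ n) * real (gnorm a) powr (- 2)) UNIV"
  proof (rule infsum_mono_neutral)
    show "(\<lambda>a. norm (\<psi> a * npow a (of_real x))) summable_on - U"
      by (rule iffD1[OF summable_on_iff_abs_summable_on_complex sm])
    show "(\<lambda>a. (1 / 2 ^ n) * real (gnorm a) powr (- 2)) summable_on UNIV"
      by (rule summable_on_cmult_right[OF sm2])
  qed (use bnd in auto)
  also have "\<dots> = (1 / 2 ^ n) * Z2" unfolding Z2_def by (rule infsum_cmult_right'[of _ _ UNIV])
  also have "\<dots> < 1" using n by (simp add: field_simps)
  finally have "norm (infsum (\<lambda>a. \<psi> a * npow a (of_real x)) (- U)) < 1" .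
  hence "L_series \<psi> (of_real x) \<noteq> 0" unfolding L
    by (metis add_eq_0_iff norm_minus_cancel norm_numeral not_numeral_less_one)
  thus ?thesis using Rex by blast
qed

text \<open>A zero would be a pole of \<open>L'/L\<close>. But the product identity makes
  \<open>L'/L\<close> equal to the holomorphic function
  \<open>- prime_power_series \<psi> / 4\<close> wherever \<open>L\<close> is nonzero. This argument
  takes the place of an Euler product.\<close>

lemma L_series_nonzero:
  assumes s: "Re s > 1"
  shows "L_series \<psi> s \<noteq> 0"
proof
  assume 0: "L_series \<psi> s = 0"
  obtain w where w: "w \<in> {s. Re s > 1}" "L_series \<psi> w \<noteq> 0" using L_series_exists_nonzero by blast
  have con: "connected {s. Re s > 1}" by (intro convex_connected convex_halfspace_Re_gt)
  obtain m where m: "((\<lambda>z. (z - s) * (deriv (L_series \<psi>) z / L_series \<psi> z)) \<longlongrightarrow> of_nat m) (at s)" "m > 0"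
    using log_derivative_limit[OF L_series_holomorphic[of \<psi>, OF le1] open_Re_gt con _ w, of s] s 0 by auto
  have "prime_power_series \<psi> holomorphic_on {s. Re s > 1}" by (rule prime_power_series_holomorphic[OF le1])
  hence "(prime_power_series \<psi> \<longlongrightarrow> prime_power_series \<psi> s) (at s)"
    using s open_Re_gt[of 1] by (auto simp: continuous_on_eq_continuous_at isCont_def dest!: holomorphic_on_imp_continuous_on)
  hence lim0: "((\<lambda>z. (z - s) * (- prime_power_series \<psi> z / 4)) \<longlongrightarrow> (s - s) * (- prime_power_series \<psi> s / 4)) (at s)"
    by (intro tendsto_intros) auto
  have "\<forall>\<^sub>F z in at s. Re z > 1"
    using s open_Re_gt[of 1] by (auto simp: eventually_at_topological)
  moreover have "\<forall>\<^sub>F z in at s. (z - s) * (deriv (L_series \<psi>) z / L_series \<psi> z) \<noteq> 0"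
    using tendsto_imp_eventually_ne[OF m(1), of 0] m(2) by simp
  ultimately have "\<forall>\<^sub>F z in at s. (z - s) * (deriv (L_series \<psi>) z / L_series \<psi> z) = (z - s) * (- prime_power_series \<psi> z / 4)"
  proof eventually_elim
    case (elim z)
    hence "L_series \<psi> z \<noteq> 0" by auto
    moreover have "deriv (L_series \<psi>) z = - prime_power_series \<psi> z / 4 * L_series \<psi> z" using prime_power_series_times_L_series[of z] elim by simp
    ultimately show ?case by simp
  qed
  hence "((\<lambda>z. (z - s) * (- prime_power_series \<psi> z / 4)) \<longlongrightarrow> of_nat m) (at s)"
    using m(1) by (rule Lim_transform_eventually[rotated])
  hence "of_nat m = (s - s) * (- prime_power_series \<psi> s / 4)" using lim0 tendsto_unique[OF at_neq_bot] by blast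
  thus False using m(2) by simp
qed

lemma prime_power_series_eq: "Re s > 1 \<Longrightarrow> prime_power_series \<psi> s = - 4 * (deriv (L_series \<psi>) s / L_series \<psi> s)"
  using prime_power_series_times_L_series[of s] L_series_nonzero[of s] by (simp add: field_simps)

end

section \<open>Analytic continuation\<close>

text \<open>The angular character times \<open>N(z)^(-s)\<close>, on all of \<open>\<complex>\<close> rather than the lattice, so that its second differences can be estimated.\<close>

definition lat :: "int \<Rightarrow> complex \<Rightarrow> complex \<Rightarrow> complex" where
  "lat k s z = sgn z powi k * of_real ((cmod z)\<^sup>2) powr (- s)"

lemma lat_cg: "lat k s (cg a) = sgn (cg a) powi k * npow a s"
  by (simp add: lat_def npow_def gnorm_cmod[symmetric])

lemma lat_mult: "lat k s (z * w) = lat k s z * lat k s w"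
proof -
  have "complex_of_real ((cmod (z * w))\<^sup>2) powr (- s) = of_real ((cmod z)\<^sup>2) powr (- s) * of_real ((cmod w)\<^sup>2) powr (- s)"
    unfolding norm_mult power_mult_distrib of_real_mult by (rule powr_times_real) auto
  thus ?thesis by (simp add: lat_def sgn_mult power_int_mult_distrib)
qed

lemma norm_sgn_powi_le: "norm (sgn (z :: complex) powi k) \<le> 1"
  by (cases "z = 0") (auto simp: norm_power_int norm_sgn power_int_0_left_if)

lemma lat_holomorphic: "(\<lambda>s. lat k s z) holomorphic_on S"
  unfolding lat_def by (intro holomorphic_intros)

lemma norm_lat_le: "norm (lat k s z) \<le> ((cmod z)\<^sup>2) powr (- Re s)"
proof -
  have "norm (complex_of_real ((cmod z)\<^sup>2) powr (- s)) = ((cmod z)\<^sup>2) powr (- Re s)"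
    by (subst norm_powr_real_powr) auto
  thus ?thesis unfolding lat_def norm_mult
    using mult_right_mono[OF norm_sgn_powi_le[of z k], of "((cmod z)\<^sup>2) powr (- Re s)"] by simp
qed

text \<open>In the right half plane the principal logarithm is smooth, and in terms of it
  \<open>lat\<close> is the exponential of a real-linear function.\<close>

lemma lat_Ln:
  assumes "Re z > 0"
  shows "lat k s z = exp (\<i> * of_int k * of_real (Im (Ln z)) - 2 * s * of_real (Re (Ln z)))"
proof -
  have z0: "z \<noteq> 0" using assms by auto
  have ln: "Re (Ln z) = ln (cmod z)" using z0 by simp
  have "exp (Ln z) = z" using z0 by simp
  hence "z = exp (of_real (Re (Ln z))) * exp (\<i> * of_real (Im (Ln z)))"
    by (metis complex_eq exp_add)
  moreover have "sgn (exp (of_real a) * exp (\<i> * of_real b)) = exp (\<i> * of_real b)" for a b :: real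
    by (simp add: sgn_mult sgn_eq norm_mult exp_of_real)
  ultimately have "sgn z = exp (\<i> * of_real (Im (Ln z)))" by metis
  hence "sgn z powi k = exp (\<i> * of_int k * of_real (Im (Ln z)))"
    by (simp add: exp_power_int mult_ac)
  moreover have "complex_of_real ((cmod z)\<^sup>2) powr (- s) = exp (- 2 * s * of_real (Re (Ln z)))"
  proof -
    have "Ln (complex_of_real ((cmod z)\<^sup>2)) = of_real (ln ((cmod z)\<^sup>2))"
      using z0 by (intro Ln_of_real) auto
    also have "ln ((cmod z)\<^sup>2) = 2 * ln (cmod z)" using z0 by (simp add: ln_realpow)
    finally show ?thesis using z0 unfolding ln powr_def by (simp add: mult_ac)
  qed
  ultimately show ?thesis by (simp add: lat_def exp_diff exp_minus divide_inverse mult_ac)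
qed

lemma exp_second_order: "norm (exp z - 1 - z) \<le> exp (norm z) * (norm z)\<^sup>2" for z :: complex
proof -
  have "norm (exp z - (\<Sum>i\<le>1. z ^ i / fact i)) \<le> exp (norm z) * (norm z ^ Suc 1) / fact 1"
    by (rule Taylor_exp_field)
  thus ?thesis by (simp add: power2_eq_square algebra_simps)
qed

text \<open>For the real-linear map \<open>l\<close>, \<open>lat k s (1 + u)\<close> is
  \<open>exp (l (Ln (1 + u)))\<close>. As \<open>Ln (1 + u)\<close> is \<open>u\<close> up to a
  quadratic error, the linear terms at \<open>u\<close> and \<open>- u\<close> cancel.
  \<open>B\<close> bounds the operator norm of \<open>l\<close>, so the constant is uniform for
  bounded \<open>s\<close>.\<close>

lemma lat_second_difference_1:
  assumes B: "\<bar>real_of_int k\<bar> + 2 * norm s \<le> B" and u: "norm u \<le> 1/2"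
  shows "norm (lat k s (1 + u) + lat k s (1 - u) - 2) \<le> (4 * B + 8 * B\<^sup>2 * exp B) * (norm u)\<^sup>2"
proof -
  define l where "l z = \<i> * of_int k * of_real (Im z) - 2 * s * of_real (Re z)" for z
  have B0: "B \<ge> 0" using B norm_ge_zero[of s] by linarith
  have l_add: "l (z + w) = l z + l w" for z w by (simp add: l_def algebra_simps)
  have l_le: "norm (l z) \<le> B * norm z" for z
  proof -
    have "norm (l z) \<le> \<bar>real_of_int k\<bar> * \<bar>Im z\<bar> + 2 * norm s * \<bar>Re z\<bar>"
      unfolding l_def by (rule order_trans[OF norm_triangle_ineq4]) (simp add: norm_mult)
    also have "\<dots> \<le> \<bar>real_of_int k\<bar> * norm z + 2 * norm s * norm z"
      by (intro add_mono mult_left_mono abs_Re_le_cmod abs_Im_le_cmod) auto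
    also have "\<dots> = (\<bar>real_of_int k\<bar> + 2 * norm s) * norm z" by (simp add: algebra_simps)
    also have "\<dots> \<le> B * norm z" by (intro mult_right_mono B) auto
    finally show ?thesis .
  qed
  have Re: "Re (1 + v) > 0" if "norm v \<le> 1/2" for v
    using that abs_Re_le_cmod[of v] by simp
  have lin: "norm (Ln (1 + v) - v) \<le> 2 * (norm v)\<^sup>2" if v: "norm v \<le> 1/2" for v
  proof -
    have "norm (Ln (1 + v) - v) \<le> (norm v)\<^sup>2 / (1 - norm v)"
      by (rule Ln_approx_linear) (use v in auto)
    also have "\<dots> \<le> (norm v)\<^sup>2 / (1/2)" using v by (intro divide_left_mono) auto
    finally show ?thesis by simp
  qed
  have l2: "norm (l (Ln (1 + v))) \<le> 2 * B * norm v" "norm (exp (l (Ln (1 + v))) - 1 - l (Ln (1 + v))) \<le> 4 * B\<^sup>2 * exp B * (norm v)\<^sup>2"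
    if v: "norm v \<le> 1/2" for v
  proof -
    have "norm (l (Ln (1 + v))) \<le> B * norm (Ln (1 + v))" by (rule l_le)
    also have "B * norm (Ln (1 + v)) \<le> B * (2 * norm v)"
    proof (rule mult_left_mono[OF _ B0])
      show "norm (Ln (1 + v)) \<le> 2 * norm v"
    proof -
      have "(norm v)\<^sup>2 \<le> norm v * (1/2)" unfolding power2_eq_square using v by (intro mult_left_mono) auto
      thus ?thesis using norm_triangle_ineq[of "Ln (1 + v) - v" v] lin[OF v] by simp
    qed
    qed
    finally show 1: "norm (l (Ln (1 + v))) \<le> 2 * B * norm v" by simp
    also have "\<dots> \<le> 2 * B * (1/2)" using v B0 by (intro mult_left_mono) auto
    finally have 2: "norm (l (Ln (1 + v))) \<le> B" by simp
    have "norm (exp (l (Ln (1 + v))) - 1 - l (Ln (1 + v))) \<le> exp (norm (l (Ln (1 + v)))) * (norm (l (Ln (1 + v))))\<^sup>2"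
      by (rule exp_second_order)
    also have "\<dots> \<le> exp B * (2 * B * norm v)\<^sup>2"
      using 1 2 by (intro mult_mono power_mono) auto
    finally show "norm (exp (l (Ln (1 + v))) - 1 - l (Ln (1 + v))) \<le> 4 * B\<^sup>2 * exp B * (norm v)\<^sup>2"
      by (simp add: power_mult_distrib mult_ac)
  qed
  have u': "norm (- u) \<le> 1/2" using u by simp
  have "lat k s (1 + u) + lat k s (1 - u) - 2
      = (exp (l (Ln (1 + u))) - 1 - l (Ln (1 + u))) + (exp (l (Ln (1 + - u))) - 1 - l (Ln (1 + - u)))
        + l ((Ln (1 + u) - u) + (Ln (1 + - u) - (- u)))"
    using lat_Ln[OF Re[OF u], of k s] lat_Ln[OF Re[OF u'], of k s] by (simp add: l_add l_def[symmetric])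
  also have "norm \<dots> \<le> (4 * B\<^sup>2 * exp B * (norm u)\<^sup>2 + 4 * B\<^sup>2 * exp B * (norm (- u))\<^sup>2) + B * (2 * (norm u)\<^sup>2 + 2 * (norm (- u))\<^sup>2)"
    by (intro order_trans[OF norm_triangle_ineq] add_mono l2 u u' order_trans[OF l_le] mult_left_mono lin B0)
  also have "\<dots> = (4 * B + 8 * B\<^sup>2 * exp B) * (norm u)\<^sup>2" by (simp add: algebra_simps)
  finally show ?thesis .
qed

text \<open>Multiplicativity of \<open>lat\<close> reduces the estimate to the point 1 with
  increment \<open>w / z\<close>. The square of that increment supplies the extra power
  \<open>N(z)^(-1)\<close>, which makes lattice sums converge for \<open>Re s > 0\<close>.\<close>

lemma lat_second_difference:
  assumes B: "\<bar>real_of_int k\<bar> + 2 * norm s \<le> B" and z: "z \<noteq> 0" and w: "2 * norm w \<le> norm z"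
  shows "norm (2 * lat k s z - lat k s (z + w) - lat k s (z - w))
    \<le> (4 * B + 8 * B\<^sup>2 * exp B) * (norm w)\<^sup>2 * ((cmod z)\<^sup>2) powr (- Re s - 1)"
proof -
  define u where "u = w / z"
  have u: "norm u \<le> 1/2" using z w by (simp add: u_def norm_divide field_simps)
  have B0: "B \<ge> 0" using B norm_ge_zero[of s] by linarith
  have "2 * lat k s z - lat k s (z + w) - lat k s (z - w) = - (lat k s z * (lat k s (1 + u) + lat k s (1 - u) - 2))"
  proof -
    have zw: "z + w = z * (1 + u)" "z - w = z * (1 - u)" using z by (auto simp: u_def field_simps)
    show ?thesis unfolding zw lat_mult by (simp add: right_diff_distrib distrib_left)
  qed
  also have "norm \<dots> \<le> ((cmod z)\<^sup>2) powr (- Re s) * ((4 * B + 8 * B\<^sup>2 * exp B) * (norm u)\<^sup>2)"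
    unfolding norm_minus_cancel norm_mult
    by (intro mult_mono norm_lat_le lat_second_difference_1 B u) auto
  also have "(norm u)\<^sup>2 = (norm w)\<^sup>2 / (cmod z)\<^sup>2" by (simp add: u_def norm_divide power_divide)
  also have "((cmod z)\<^sup>2) powr (- Re s) * ((4 * B + 8 * B\<^sup>2 * exp B) * ((norm w)\<^sup>2 / (cmod z)\<^sup>2))
     = (4 * B + 8 * B\<^sup>2 * exp B) * (norm w)\<^sup>2 * ((cmod z)\<^sup>2) powr (- Re s - 1)"
    using z by (simp add: powr_diff mult_ac)
  finally show ?thesis .
qed

lemma lattice_difference_holomorphic:
  fixes l g :: gauss_int and c :: "gauss_int \<Rightarrow> complex"
  assumes l: "l \<noteq> 0" and c: "\<And>a. norm (c a) \<le> 1"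
  shows "(\<lambda>s. \<Sum>\<^sub>\<infinity>a. c a * (2 * lat k s (cg (l * a)) - lat k s (cg (l * a + g)) - lat k s (cg (l * a - g))))
           holomorphic_on {s. Re s > 0}"
proof (rule holomorphic_infsum[OF open_Re_gt])
  show "(\<lambda>s. c a * (2 * lat k s (cg (l * a)) - lat k s (cg (l * a + g)) - lat k s (cg (l * a - g)))) holomorphic_on {s. Re s > 0}" for a
    by (intro holomorphic_intros lat_holomorphic)
next
  fix z :: complex assume "z \<in> {s. Re s > 0}"
  then obtain d x where d: "d > 0" "x > 0" "\<And>s. s \<in> cball z d \<Longrightarrow> Re s \<ge> x" "cball z d \<subseteq> {s. Re s > 0}"
    using half_plane_cball[of 0 z] by auto
  define B where "B = \<bar>real_of_int k\<bar> + 2 * (norm z + d)"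
  define C where "C = (4 * B + 8 * B\<^sup>2 * exp B) * (norm (cg g))\<^sup>2"
  have B0: "B \<ge> 0" using d(1) by (simp add: B_def)
  have C0: "C \<ge> 0" unfolding C_def using B0 by (intro mult_nonneg_nonneg add_nonneg_nonneg) auto
  \<comment> \<open>Outside this finite set \<open>l * a\<close> has modulus more than twice that of
    \<open>g\<close>, the range of the second difference estimate. Inside it every value of
    \<open>lat\<close> is at most 1 in modulus, whence the bound 4.\<close>
  define Z where "Z = {a. gnorm a \<le> 4 * gnorm g}"
  define M where "M a = C * real (gnorm a) powr (- (x + 1)) + (if a \<in> Z then 4 else 0)" for a
  have "(\<lambda>a. C * real (gnorm a) powr (- (x + 1))) summable_on UNIV"
    using summable_gnorm_powr[of "x + 1"] d(2) by (intro summable_on_cmult_right) auto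
  moreover have "(\<lambda>a. if a \<in> Z then 4 else (0::real)) summable_on UNIV"
    by (rule finite_nonzero_values_imp_summable_on) (simp add: Z_def finite_gnorm_le)
  ultimately have M: "M summable_on UNIV" unfolding M_def by (rule summable_on_add)
  have bound: "norm (c a * (2 * lat k s (cg (l * a)) - lat k s (cg (l * a + g)) - lat k s (cg (l * a - g)))) \<le> M a"
    if s: "s \<in> cball z d" for s a
  proof -
    have Res: "Re s \<ge> x" using d(3)[OF s] .
    have "norm s \<le> norm z + d" using s norm_triangle_ineq2[of s z] by (auto simp: dist_norm norm_minus_commute)
    hence B: "\<bar>real_of_int k\<bar> + 2 * norm s \<le> B" by (simp add: B_def)
    have "norm (2 * lat k s (cg (l * a)) - lat k s (cg (l * a + g)) - lat k s (cg (l * a - g))) \<le> M a"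
    proof (cases "a \<in> Z")
      case True
      have 1: "norm (lat k s (cg b)) \<le> 1" for b
      proof (cases "b = 0")
        case False
        have "norm (lat k s (cg b)) \<le> real (gnorm b) powr (- Re s)"
          using norm_lat_le[of k s "cg b"] by (simp add: gnorm_cmod)
        also have "\<dots> \<le> real (gnorm b) powr 0" using gnorm_ge_1[OF False] Res d(2) by (intro powr_mono) auto
        finally show ?thesis using False by simp
      qed (simp add: lat_def)
      have "norm (2 * lat k s (cg (l * a)) - lat k s (cg (l * a + g)) - lat k s (cg (l * a - g)))
         \<le> norm (2 * lat k s (cg (l * a))) + norm (lat k s (cg (l * a + g))) + norm (lat k s (cg (l * a - g)))"
        by (rule order_trans[OF norm_triangle_ineq4] add_right_mono norm_triangle_ineq4)+
      also have "\<dots> \<le> 2 * 1 + 1 + 1" using 1 by (intro add_mono) (auto simp: norm_mult simp del: cg_simps)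
      also have "\<dots> \<le> M a" using True C0 by (simp add: M_def)
      finally show ?thesis .
    next
      case False
      hence ga: "gnorm a > 4 * gnorm g" by (simp add: Z_def)
      hence a0: "a \<noteq> 0" by (cases "a = 0") auto
      have gl: "gnorm (l * a) \<ge> gnorm a" using l by (simp add: Suc_le_eq)
      have "4 * (norm (cg g))\<^sup>2 \<le> (norm (cg (l * a)))\<^sup>2"
        unfolding gnorm_cmod[symmetric] using ga gl by linarith
      hence "(2 * norm (cg g))\<^sup>2 \<le> (norm (cg (l * a)))\<^sup>2" by (simp add: power_mult_distrib)
      hence "2 * norm (cg g) \<le> norm (cg (l * a))" by (rule power2_le_imp_le) simp
      hence "norm (2 * lat k s (cg (l * a)) - lat k s (cg (l * a) + cg g) - lat k s (cg (l * a) - cg g))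
        \<le> C * ((cmod (cg (l * a)))\<^sup>2) powr (- Re s - 1)"
        unfolding C_def using l a0 by (intro lat_second_difference B) auto
      also have "\<dots> = C * real (gnorm (l * a)) powr (- Re s - 1)" by (simp only: gnorm_cmod)
      also have "\<dots> \<le> C * real (gnorm a) powr (- Re s - 1)"
        using gl a0 Res d(2) by (intro mult_left_mono C0 powr_mono2') auto
      also have "\<dots> \<le> C * real (gnorm a) powr (- (x + 1))"
        using gnorm_ge_1[OF a0] Res by (intro mult_left_mono C0 powr_mono) auto
      also have "\<dots> \<le> M a" by (simp add: M_def)
      finally show ?thesis by simp
    qed
    hence "norm (c a) * norm (2 * lat k s (cg (l * a)) - lat k s (cg (l * a + g)) - lat k s (cg (l * a - g))) \<le> 1 * M a"
      by (intro mult_mono c) auto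
    thus ?thesis by (simp add: norm_mult)
  qed
  show "\<exists>d>0. \<exists>M. cball z d \<subseteq> {s. Re s > 0} \<and> M summable_on UNIV \<and>
     (\<forall>a\<in>UNIV. \<forall>s\<in>cball z d. norm (c a * (2 * lat k s (cg (l * a)) - lat k s (cg (l * a + g)) - lat k s (cg (l * a - g)))) \<le> M a)"
    using d M bound by blast
qed

text \<open>The quotients \<open>E i / h i\<close> agree where both are defined; they cover the half plane since the \<open>h i\<close> have no common zero.\<close>

lemma glue_continuation:
  fixes E h :: "'i \<Rightarrow> complex \<Rightarrow> complex"
  assumes E: "\<And>i. i \<in> I \<Longrightarrow> E i holomorphic_on {s. Re s > 0}" and h: "\<And>i. i \<in> I \<Longrightarrow> h i holomorphic_on {s. Re s > 0}"
    and eq: "\<And>i s. i \<in> I \<Longrightarrow> Re s > 1 \<Longrightarrow> E i s = h i s * L s"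
    and nz: "\<And>s. Re s > 0 \<Longrightarrow> \<exists>i\<in>I. h i s \<noteq> 0"
  obtains W where "W holomorphic_on {s. Re s > 0}" "\<And>s. Re s > 1 \<Longrightarrow> W s = L s"
proof -
  have con: "connected {s. Re s > 0}" by (intro convex_connected convex_halfspace_Re_gt)
  have cross: "E i s * h j s = E j s * h i s" if "i \<in> I" "j \<in> I" "Re s > 0" for i j s
  proof (rule analytic_continuation_open[of "{s. Re s > 1}" "{s. Re s > 0}" "\<lambda>s. E i s * h j s" "\<lambda>s. E j s * h i s"])
    show "{s. Re s > 1} \<noteq> {}" by (auto intro!: exI[of _ 2])
    show "(\<lambda>s. E i s * h j s) holomorphic_on {s. Re s > 0}" "(\<lambda>s. E j s * h i s) holomorphic_on {s. Re s > 0}"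
      by (intro holomorphic_intros E h that)+
  qed (use that eq con open_Re_gt in auto)
  define j where "j s = (SOME i. i \<in> I \<and> h i s \<noteq> 0)" for s
  have j: "j s \<in> I \<and> h (j s) s \<noteq> 0" if "Re s > 0" for s
    unfolding j_def by (rule someI_ex) (use nz[OF that] in blast)
  define W where "W s = E (j s) s / h (j s) s" for s
  have W: "E i s = h i s * W s" if "i \<in> I" "Re s > 0" for i s
    using cross[of i "j s" s] j[OF that(2)] that by (simp add: W_def field_simps)
  have "W field_differentiable at s" if s: "Re s > 0" for s
  proof -
    obtain i where i: "i \<in> I" "h i s \<noteq> 0" using nz[OF s] by blast
    define U where "U = {z. Re z > 0} \<inter> h i -` (- {0})"
    have U: "open U" unfolding U_def
      by (rule continuous_open_preimage[OF holomorphic_on_imp_continuous_on[OF h[OF i(1)]] open_Re_gt]) auto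
    have sU: "s \<in> U" using s i by (simp add: U_def)
    have hol: "(\<lambda>z. E i z / h i z) holomorphic_on U"
      by (intro holomorphic_on_divide holomorphic_on_subset[OF E[OF i(1)]] holomorphic_on_subset[OF h[OF i(1)]])
         (auto simp: U_def)
    have "W z = E i z / h i z" if "z \<in> U" for z
      using W[OF i(1), of z] that by (auto simp: U_def)
    hence "W holomorphic_on U" by (intro holomorphic_transform[OF hol]) simp
    thus ?thesis using U sU by (rule holomorphic_on_imp_differentiable_at)
  qed
  hence "W holomorphic_on {s. Re s > 0}"
    by (simp add: holomorphic_on_def field_differentiable_at_within)
  moreover have "W s = L s" if "Re s > 1" for s
    using eq[OF _ that, of "j s"] j[of s] that by (simp add: W_def)
  ultimately show ?thesis using that by blast
qed

section \<open>Splitting the lattice along residues, and the resulting relation\<close>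

lemma (in gauss_mod) complete_residues:
  assumes l: "coprime l g" "l \<noteq> 0"
  obtains R where "finite R" "bij_betw (\<lambda>(a, d). l * a + g * d) (UNIV \<times> R) UNIV"
proof -
  interpret l: gauss_mod l by unfold_locales (rule l(2))
  have "coprime g l" using l(1) by (simp add: coprime_commute)
  \<comment> \<open>\<open>x\<close> inverts \<open>g\<close> modulo \<open>l\<close>, so
    \<open>g * d\<close> runs through the classes modulo \<open>l\<close> along with
    \<open>d\<close>. This is why increments divisible by \<open>g\<close> can fill the whole
    lattice.\<close>
  then obtain x where x: "l dvd g * x - 1" using l.coprime_iff_inverse by blast
  \<comment> \<open>The choice depends only on the class of \<open>b\<close> modulo
    \<open>l\<close>, so the range of \<open>r\<close> contains exactly one element of each
    class.\<close>
  define r where "r b = (SOME c. c \<in> l.reps \<and> l dvd c - b)" for b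
  have r: "r b \<in> l.reps \<and> l dvd r b - b" for b
    unfolding r_def by (rule someI_ex) (use l.exists_rep in blast)
  have r_cong: "r b = r c" if "l dvd b - c" for b c
  proof -
    have "(\<lambda>e. e \<in> l.reps \<and> l dvd e - b) = (\<lambda>e. e \<in> l.reps \<and> l dvd e - c)"
      using that l.gcong_sym l.gcong_trans by blast
    thus ?thesis by (simp add: r_def)
  qed
  define R where "R = range r"
  have "finite R" using finite_subset[OF _ l.finite_reps, of R] r by (auto simp: R_def)
  have gx: "l dvd g * (x * b) - b" for b
    using l.gcong_mult[OF x l.gcong_refl[of b]] by (simp add: mult_ac)
  have "inj_on (\<lambda>(a, d). l * a + g * d) (UNIV \<times> R)"
  proof (rule inj_onI, clarify)
    fix a d b e assume *: "d \<in> R" "e \<in> R" "l * a + g * d = l * b + g * e"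
    have "g * d - g * e = l * (b - a)" using *(3) by (simp add: algebra_simps)
    hence "l dvd g * d - g * e" by simp
    hence "l dvd d - e" using l.gcong_cancel[OF \<open>coprime g l\<close>] by blast
    hence "r d = r e" by (rule r_cong)
    moreover have "r d = d" "r e = e" using *(1,2) r r_cong by (auto simp: R_def)
    ultimately have "d = e" by simp
    thus "a = b \<and> d = e" using *(3) l(2) by simp
  qed
  moreover have "(\<lambda>(a, d). l * a + g * d) ` (UNIV \<times> R) = UNIV"
  proof -
    have "b \<in> (\<lambda>(a, d). l * a + g * d) ` (UNIV \<times> R)" for b
    proof -
      define d where "d = r (x * b)"
      have "l dvd g * d - g * (x * b)" unfolding d_def using r l.gcong_mult[OF l.gcong_refl] by blast
      hence "l dvd b - g * d" using gx[of b] l.gcong_sym l.gcong_trans by blast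
      then obtain a where "b - g * d = l * a" by (auto elim: dvdE)
      hence "b = (\<lambda>(a, d). l * a + g * d) (a, d)" by (simp add: algebra_simps)
      thus ?thesis by (rule image_eqI) (auto simp: R_def d_def)
    qed
    thus ?thesis by blast
  qed
  ultimately show ?thesis using that \<open>finite R\<close> by (auto simp: bij_betw_def)
qed

lemma has_sum_diff:
  fixes f h :: "'i \<Rightarrow> complex"
  assumes "(f has_sum a) I" "(h has_sum b) I"
  shows "((\<lambda>x. f x - h x) has_sum (a - b)) I"
  using has_sum_add[OF assms(1) iffD2[OF has_sum_uminus], of h "- b"] assms(2) by simp

lemma sum_over_residues:
  fixes T :: "gauss_int \<Rightarrow> complex"
  assumes R: "finite R" and bij: "bij_betw f (UNIV \<times> R) UNIV" and T: "T summable_on UNIV"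
  shows "(\<Sum>d\<in>R. \<Sum>\<^sub>\<infinity>a. T (f (a, d))) = infsum T UNIV" and "d \<in> R \<Longrightarrow> (\<lambda>a. T (f (a, d))) summable_on UNIV"
proof -
  have sw: "bij_betw (\<lambda>(d, a). (a, d)) (R \<times> UNIV) (UNIV \<times> R)"
    by (rule bij_betwI[of _ _ _ "\<lambda>(a, d). (d, a)"]) auto
  have b: "bij_betw (f \<circ> (\<lambda>(d, a). (a, d))) (R \<times> UNIV) UNIV" by (rule bij_betw_trans[OF sw bij])
  have sm: "(\<lambda>x. T ((f \<circ> (\<lambda>(d, a). (a, d))) x)) summable_on (Sigma R (\<lambda>_. UNIV))"
    using summable_on_reindex_bij_betw[OF b, of T] T by simp
  have "infsum T UNIV = infsum (\<lambda>x. T ((f \<circ> (\<lambda>(d, a). (a, d))) x)) (Sigma R (\<lambda>_. UNIV))"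
    using infsum_reindex_bij_betw[OF b, of T] by simp
  also have "\<dots> = infsum (\<lambda>d. \<Sum>\<^sub>\<infinity>a. T (f (a, d))) R"
    using infsum_Sigma_banach[OF sm] by simp
  also have "\<dots> = (\<Sum>d\<in>R. \<Sum>\<^sub>\<infinity>a. T (f (a, d)))" using R by simp
  finally show "(\<Sum>d\<in>R. \<Sum>\<^sub>\<infinity>a. T (f (a, d))) = infsum T UNIV" ..
  show "(\<lambda>a. T (f (a, d))) summable_on UNIV" if "d \<in> R"
    using summable_on_SigmaD1[of "\<lambda>d a. T (f (a, d))" R "\<lambda>_. UNIV" d] sm that by (simp add: case_prod_unfold)
qed

text \<open>Triviality on units makes the product a function of ideals, that is, a Hecke character.
  The remaining angular characters are treated by cancellation in
  \<open>angle_char_prime_sum\<close>.\<close>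

locale hecke = gauss_mod g for g +
  fixes \<phi> :: "gauss_int \<Rightarrow> complex" and k :: int
  assumes phi: "gchar \<phi>" and unit_triv: "is_unit u \<Longrightarrow> \<phi> u * sgn (cg u) powi k = 1"
begin

definition psi :: "gauss_int \<Rightarrow> complex" where "psi a = \<phi> a * sgn (cg a) powi k"

lemma norm_phi_le: "norm (\<phi> a) \<le> 1" using norm_gchar[OF phi] by simp

sublocale gauss_mult psi
proof
  show "psi (a * b) = psi a * psi b" for a b
    by (simp add: psi_def gchar_mult[OF phi] sgn_mult power_int_mult_distrib mult_ac)
  show "norm (psi a) \<le> 1" for a
    using mult_mono[OF norm_phi_le norm_sgn_powi_le] by (simp add: psi_def norm_mult)
  show "psi u = 1" if "is_unit u" for u using unit_triv[OF that] by (simp add: psi_def)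
qed

lemma psi_lat: "\<phi> a * lat k s (cg a) = psi a * npow a s"
  by (simp add: psi_def lat_cg mult_ac)

text \<open>Both \<open>l * a + g * d\<close> and \<open>l * a - g * d\<close> run once through the
  lattice, so the second differences add up to \<open>2 * card R\<close> copies of the series over
  multiples of \<open>l\<close> minus two copies of the full series; \<open>E\<close> is half of
  that. The increments are divisible by \<open>g\<close>, which makes \<open>\<phi>\<close> constant
  on each difference, so the smoothness of \<open>lat\<close> alone decides convergence.\<close>

lemma residue_relation:
  assumes l: "l \<noteq> 0" and R: "finite R" and bij: "bij_betw (\<lambda>(a, d). l * a + g * d) (UNIV \<times> R) UNIV"
  obtains E where "E holomorphic_on {s. Re s > 0}"
    "\<And>s. Re s > 1 \<Longrightarrow> E s = (of_nat (card R) * psi l * npow l s - 1) * L_series psi s"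
proof -
  define D where "D d s = (\<Sum>\<^sub>\<infinity>a. \<phi> (l * a) * (2 * lat k s (cg (l * a)) - lat k s (cg (l * a + g * d)) - lat k s (cg (l * a - g * d))))" for d s
  define E where "E s = (1/2) * (\<Sum>d\<in>R. D d s)" for s
  have "D d holomorphic_on {s. Re s > 0}" for d
    unfolding D_def[abs_def] by (rule lattice_difference_holomorphic[OF l norm_phi_le])
  hence "E holomorphic_on {s. Re s > 0}" unfolding E_def by (intro holomorphic_intros)
  moreover have "E s = (of_nat (card R) * psi l * npow l s - 1) * L_series psi s" if s: "Re s > 1" for s
  proof -
    define T where "T a = psi a * npow a s" for a
    have T: "T summable_on UNIV" "infsum T UNIV = L_series psi s"
      unfolding T_def using L_series_summable[of psi, OF le1 s] by (auto simp: L_series_def)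
    have neg: "bij_betw (\<lambda>(a, d). (- a, d)) (UNIV \<times> R) ((UNIV :: gauss_int set) \<times> R)"
      by (rule bij_betwI[of _ _ _ "\<lambda>(a, d). (- a, d)"]) auto
    have um: "bij_betw uminus UNIV (UNIV :: gauss_int set)" by (rule bij_betwI[of _ _ _ uminus]) auto
    have "bij_betw (uminus \<circ> ((\<lambda>(a, d). l * a + g * d) \<circ> (\<lambda>(a, d). (- a, d)))) (UNIV \<times> R) UNIV"
      by (intro bij_betw_trans[OF _ um] bij_betw_trans[OF neg bij])
    moreover have "uminus \<circ> ((\<lambda>(a, d). l * a + g * d) \<circ> (\<lambda>(a, d). (- a, d))) = (\<lambda>(a, d). l * a - g * d)"
      by (auto simp: fun_eq_iff)
    ultimately have bij': "bij_betw (\<lambda>(a, d). l * a - g * d) (UNIV \<times> R) UNIV" by simp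
    have sumT: "((\<lambda>a. T (l * a)) has_sum (psi l * npow l s * L_series psi s)) UNIV"
      using has_sum_cmult_right[OF L_series_has_sum[of psi, OF le1 s], of "psi l * npow l s"]
      by (simp add: T_def mult npow_mult mult_ac)
    have D: "D d s = 2 * (psi l * npow l s * L_series psi s) - (\<Sum>\<^sub>\<infinity>a. T (l * a + g * d)) - (\<Sum>\<^sub>\<infinity>a. T (l * a - g * d))"
      if d: "d \<in> R" for d
    proof -
      have ph: "\<phi> (l * a) = \<phi> (l * a + g * d)" "\<phi> (l * a) = \<phi> (l * a - g * d)" for a
        by (rule gchar_gcong[OF phi], simp)+
      have "\<phi> (l * a) * (2 * lat k s (cg (l * a)) - lat k s (cg (l * a + g * d)) - lat k s (cg (l * a - g * d)))
        = 2 * T (l * a) - T (l * a + g * d) - T (l * a - g * d)" for a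
      proof -
        have "\<phi> (l * a) * (2 * lat k s (cg (l * a)) - lat k s (cg (l * a + g * d)) - lat k s (cg (l * a - g * d)))
          = 2 * (\<phi> (l * a) * lat k s (cg (l * a))) - \<phi> (l * a + g * d) * lat k s (cg (l * a + g * d))
             - \<phi> (l * a - g * d) * lat k s (cg (l * a - g * d))"
          unfolding ph[symmetric] by (simp only: algebra_simps)
        thus ?thesis by (simp only: psi_lat T_def)
      qed
      hence "D d s = (\<Sum>\<^sub>\<infinity>a. 2 * T (l * a) - T (l * a + g * d) - T (l * a - g * d))" by (simp only: D_def)
      also have "((\<lambda>a. 2 * T (l * a) - T (l * a + g * d) - T (l * a - g * d)) has_sum
         (2 * (psi l * npow l s * L_series psi s) - (\<Sum>\<^sub>\<infinity>a. T (l * a + g * d)) - (\<Sum>\<^sub>\<infinity>a. T (l * a - g * d)))) UNIV"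
        using sum_over_residues(2)[OF R bij T(1) d] sum_over_residues(2)[OF R bij' T(1) d]
        by (intro has_sum_diff has_sum_cmult_right sumT has_sum_infsum) auto
      hence "(\<Sum>\<^sub>\<infinity>a. 2 * T (l * a) - T (l * a + g * d) - T (l * a - g * d)) =
         (2 * (psi l * npow l s * L_series psi s) - (\<Sum>\<^sub>\<infinity>a. T (l * a + g * d)) - (\<Sum>\<^sub>\<infinity>a. T (l * a - g * d)))"
        by (rule infsumI)
      finally show ?thesis .
    qed
    have "(\<Sum>d\<in>R. D d s) = (\<Sum>d\<in>R. 2 * (psi l * npow l s * L_series psi s)) - (\<Sum>d\<in>R. \<Sum>\<^sub>\<infinity>a. T (l * a + g * d))
        - (\<Sum>d\<in>R. \<Sum>\<^sub>\<infinity>a. T (l * a - g * d))"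
      by (simp add: D sum_subtractf)
    also have "\<dots> = of_nat (card R) * (2 * (psi l * npow l s * L_series psi s)) - L_series psi s - L_series psi s"
      using sum_over_residues(1)[OF R bij T(1)] sum_over_residues(1)[OF R bij' T(1)] T(2) by simp
    finally have X: "(\<Sum>d\<in>R. D d s) = of_nat (card R) * (2 * (psi l * npow l s * L_series psi s)) - L_series psi s - L_series psi s" .
    show ?thesis unfolding E_def X by (simp add: algebra_simps)
  qed
  ultimately show ?thesis using that by blast
qed

end

text \<open>The numbers \<open>1 + 2 * g * a\<close> are coprime to \<open>g\<close>, nonzero by
  parity of the real part, and of norm at most \<open>K\<close> times that of \<open>a\<close>.
  Finitely many of them already make the sum at 1 exceed any bound, and a finite sum is continuous
  in \<open>x\<close>.\<close>

lemma (in gauss_mod) principal_unbounded: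
  "\<forall>\<^sub>F x in at_right 1. Re (L_series principal (of_real x)) > C"
proof -
  define K where "K = (1 + 2 * norm (cg g))\<^sup>2"
  have K: "K \<ge> 1" unfolding K_def by (intro one_le_power) simp
  obtain F where F: "finite F" "0 \<notin> F" "(\<Sum>a\<in>F. 1 / real (gnorm a)) > K * \<bar>C\<bar>"
    using not_summable_gnorm[of "K * \<bar>C\<bar>"] K by auto
  have cg2: "cg 2 = 2" using cg_of_nat[of 2] by simp
  have inj: "inj_on (\<lambda>a. 1 + 2 * g * a) F"
  proof (rule inj_onI)
    fix a b assume "1 + 2 * g * a = 1 + 2 * g * b"
    hence "cg (1 + 2 * g * a) = cg (1 + 2 * g * b)" by (rule arg_cong)
    thus "a = b" using g0 by (simp add: cg2)
  qed
  have nb: "real (gnorm (1 + 2 * g * a)) \<le> K * real (gnorm a)" "1 + 2 * g * a \<noteq> 0" "coprime (1 + 2 * g * a) g" if "a \<in> F" for a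
  proof -
    have a0: "a \<noteq> 0" using that F by auto
    have 1: "1 \<le> norm (cg a)" using gnorm_ge_1[OF a0] power2_le_imp_le[of 1 "norm (cg a)"] by (simp add: gnorm_cmod)
    have "norm (cg (1 + 2 * g * a)) \<le> 1 + 2 * norm (cg g) * norm (cg a)"
      using norm_triangle_ineq[of 1 "2 * cg g * cg a"] by (simp add: norm_mult cg2)
    also have "\<dots> \<le> (1 + 2 * norm (cg g)) * norm (cg a)" using 1 by (simp add: algebra_simps)
    finally have "(norm (cg (1 + 2 * g * a)))\<^sup>2 \<le> ((1 + 2 * norm (cg g)) * norm (cg a))\<^sup>2" by (intro power_mono) auto
    thus "real (gnorm (1 + 2 * g * a)) \<le> K * real (gnorm a)" by (simp only: gnorm_cmod K_def power_mult_distrib)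
    have "1 + 2 * g * a - 1 = g * (2 * a)" by (simp add: algebra_simps)
    hence "1 + 2 * g * a \<simeq> 1" by simp
    thus "coprime (1 + 2 * g * a) g" using coprime_gcong[of "1 + 2 * g * a" 1] by simp
    show "1 + 2 * g * a \<noteq> 0"
    proof
      assume "1 + 2 * g * a = 0"
      hence "2 * (g * a) = - 1" by (simp add: algebra_simps add_eq_0_iff)
      hence "ReZ (2 * (g * a)) = - 1" by (simp add: one_gauss_int_def uminus_gauss_int_def)
      moreover have "ReZ (2 * (g * a)) = 2 * ReZ (g * a)"
        unfolding mult_2 by (simp add: plus_gauss_int_def)
      ultimately show False by presburger
    qed
  qed
  define S where "S x = (\<Sum>a\<in>F. (K * real (gnorm a)) powr (- x))" for x
  have "(S \<longlongrightarrow> S 1) (at_right 1)"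
    unfolding S_def using K F by (intro tendsto_intros) auto
  moreover have "S 1 = (\<Sum>a\<in>F. 1 / real (gnorm a)) / K"
    using K unfolding S_def sum_divide_distrib by (intro sum.cong) (auto simp: powr_minus divide_simps)
  hence "K * S 1 > K * \<bar>C\<bar>" using F(3) K by simp
  hence "S 1 > \<bar>C\<bar>" using K by (simp add: mult_less_cancel_left_pos)
  ultimately have "\<forall>\<^sub>F x in at_right 1. S x > \<bar>C\<bar>" by (intro order_tendstoD(1))
  moreover have "\<forall>\<^sub>F x in at_right (1::real). x > 1" by (simp add: eventually_at_filter)
  ultimately show ?thesis
  proof eventually_elim
    case (elim x)
    have le1: "norm (principal a) \<le> 1" for a by (simp add: principal_def)
    have "((\<lambda>a. Re (principal a * npow a (of_real x))) has_sum Re (L_series principal (of_real x))) UNIV"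
      by (rule has_sum_Re[OF L_series_has_sum[OF le1]]) (use elim in auto)
    moreover have Ret: "Re (principal a * npow a (of_real x)) = (if coprime a g then real (gnorm a) powr (- x) else 0)" for a
    proof -
      have "npow a (of_real x) = of_real (real (gnorm a) powr (- x))"
        unfolding npow_def by (simp add: powr_of_real[symmetric])
      thus ?thesis by (simp add: principal_def)
    qed
    ultimately have hs: "((\<lambda>a. if coprime a g then real (gnorm a) powr (- x) else 0) has_sum Re (L_series principal (of_real x))) UNIV"
      by simp
    have "S x \<le> (\<Sum>a\<in>F. if coprime (1 + 2 * g * a) g then real (gnorm (1 + 2 * g * a)) powr (- x) else 0)"
      unfolding S_def
    proof (rule sum_mono)
      fix a assume a: "a \<in> F"
      show "(K * real (gnorm a)) powr (- x) \<le> (if coprime (1 + 2 * g * a) g then real (gnorm (1 + 2 * g * a)) powr (- x) else 0)"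
        using nb[OF a] elim(2) by (auto intro!: powr_mono2')
    qed
    also have "\<dots> = (\<Sum>a\<in>(\<lambda>a. 1 + 2 * g * a) ` F. if coprime a g then real (gnorm a) powr (- x) else 0)"
      by (simp add: sum.reindex[OF inj] o_def)
    also have "\<dots> \<le> Re (L_series principal (of_real x))"
      by (rule finite_sum_le_has_sum[OF hs]) (use F in auto)
    finally show ?case using elim by linarith
  qed
qed

lemma (in gauss_mod) hecke_principal: "hecke g principal 0"
proof
  show "gchar principal" by (rule gchar_principal)
  show "principal u * sgn (cg u) powi 0 = 1" if "is_unit u" for u
    using that by (simp add: principal_def is_unit_left_imp_coprime)
qed

lemma (in gauss_mod) psi_principal: "hecke.psi principal 0 = principal"
  by (simp add: hecke.psi_def[OF hecke_principal] fun_eq_iff)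

lemma tendsto_at_right_complex:
  assumes "f holomorphic_on S" "open S" "of_real x0 \<in> S"
  shows "((\<lambda>x. f (of_real x)) \<longlongrightarrow> f (of_real x0)) (at_right x0)"
proof -
  have "isCont f (of_real x0)"
    using holomorphic_on_imp_differentiable_at[OF assms] by (rule field_differentiable_imp_continuous_at)
  moreover have "(complex_of_real \<longlongrightarrow> of_real x0) (at_right x0)" by (intro tendsto_intros)
  ultimately show ?thesis by (rule isCont_tendsto_compose)
qed

lemma (in gauss_mod) principal_no_limit:
  "\<not> ((\<lambda>x. L_series principal (of_real x)) \<longlongrightarrow> c) (at_right 1)"
proof
  assume "((\<lambda>x. L_series principal (of_real x)) \<longlongrightarrow> c) (at_right 1)"
  hence "((\<lambda>x. Re (L_series principal (of_real x))) \<longlongrightarrow> Re c) (at_right 1)" by (rule tendsto_Re)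
  hence "\<forall>\<^sub>F x in at_right 1. Re (L_series principal (of_real x)) < Re c + 1" by (rule order_tendstoD(2)) simp
  moreover have "\<forall>\<^sub>F x in at_right 1. Re (L_series principal (of_real x)) > Re c + 1" by (rule principal_unbounded)
  ultimately have "\<forall>\<^sub>F x in at_right (1::real). False" by eventually_elim simp
  thus False by simp
qed

lemma eventually_at_right_gt: "\<forall>\<^sub>F x in at_right (c::real). x > c"
  by (simp add: eventually_at_filter)

text \<open>The count comes from analysis: if the factor \<open>card R * npow l s - 1\<close> did
  not vanish at 1, dividing by it would give the principal series a finite limit there, against
  \<open>principal_no_limit\<close>.\<close>

lemma (in gauss_mod) card_complete_residues:
  assumes l: "coprime l g" "l \<noteq> 0" and R: "finite R" and bij: "bij_betw (\<lambda>(a, d). l * a + g * d) (UNIV \<times> R) UNIV"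
  shows "card R = gnorm l"
proof -
  interpret P: hecke g principal 0 by (rule hecke_principal)
  note pp = psi_principal
  obtain E where E: "E holomorphic_on {s. Re s > 0}"
      "\<And>s. Re s > 1 \<Longrightarrow> E s = (of_nat (card R) * P.psi l * npow l s - 1) * L_series P.psi s"
    using P.residue_relation[OF l(2) R bij] by blast
  define h where "h s = of_nat (card R) * npow l s - 1" for s
  have pl: "principal l = 1" using l by (simp add: principal_def)
  have hol: "h holomorphic_on UNIV" unfolding h_def by (intro holomorphic_intros)
  have lim: "((\<lambda>x. E (of_real x)) \<longlongrightarrow> E (of_real 1)) (at_right 1)" "((\<lambda>x. h (of_real x)) \<longlongrightarrow> h (of_real 1)) (at_right 1)"
    by (rule tendsto_at_right_complex[OF E(1) open_Re_gt] tendsto_at_right_complex[OF hol open_UNIV]; simp)+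
  have "h 1 = 0"
  proof (rule ccontr)
    assume h1: "h 1 \<noteq> 0"
    have "((\<lambda>x. E (of_real x) / h (of_real x)) \<longlongrightarrow> E (of_real 1) / h (of_real 1)) (at_right 1)"
      using h1 by (intro tendsto_divide lim) simp
    moreover have "\<forall>\<^sub>F x in at_right 1. h (of_real x) \<noteq> 0"
      using h1 by (intro tendsto_imp_eventually_ne[OF lim(2)]) simp
    hence "\<forall>\<^sub>F x in at_right 1. E (of_real x) / h (of_real x) = L_series principal (of_real x)"
      using eventually_at_right_gt[of 1]
    proof eventually_elim
      case (elim x)
      thus ?case using E(2)[of "of_real x"] by (simp add: h_def pp pl)
    qed
    ultimately have "((\<lambda>x. L_series principal (of_real x)) \<longlongrightarrow> E (of_real 1) / h (of_real 1)) (at_right 1)"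
      by (rule Lim_transform_eventually)
    thus False using principal_no_limit by blast
  qed
  hence "(of_nat (card R) :: complex) = of_nat (gnorm l)"
    using l by (simp add: h_def npow_def powr_minus field_simps)
  thus ?thesis by (simp only: of_nat_eq_iff)
qed

lemma (in gauss_mod) dvd_gnorm: "g dvd of_nat (gnorm g)"
  using mult_gcnj[of g] by (metis dvd_triv_left)

lemma of_nat_gauss: "(of_nat n :: gauss_int) = Gauss_Int (int n) 0"
  by (induction n) (auto simp: zero_gauss_int_def one_gauss_int_def plus_gauss_int_def)

section \<open>The explicit factors and their common zeros\<close>

context hecke
begin

definition hecke_factor :: "gauss_int \<Rightarrow> complex \<Rightarrow> complex" where
  "hecke_factor l s = of_nat (gnorm l) * psi l * npow l s - 1"

lemma hecke_factor_holomorphic: "hecke_factor l holomorphic_on S"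
  unfolding hecke_factor_def by (intro holomorphic_intros)

lemma hecke_factor_relation:
  assumes l: "coprime l g" "l \<noteq> 0"
  shows "\<exists>E. E holomorphic_on {s. Re s > 0} \<and> (\<forall>s. Re s > 1 \<longrightarrow> E s = hecke_factor l s * L_series psi s)"
proof -
  obtain R where R: "finite R" "bij_betw (\<lambda>(a, d). l * a + g * d) (UNIV \<times> R) UNIV"
    using complete_residues[OF l] .
  show ?thesis
    using residue_relation[OF l(2) R] card_complete_residues[OF l R] unfolding hecke_factor_def by metis
qed

text \<open>Positive rational integers congruent to 1 modulo \<open>g\<close>: every character and
  every angular power equals 1 on them, so the same two factors serve all \<open>\<phi>\<close> and
  \<open>k\<close>.\<close>

definition cong_one :: "nat \<Rightarrow> gauss_int" where "cong_one j = of_nat (1 + j * gnorm g)"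

lemma cong_one: "coprime (cong_one j) g" "cong_one j \<noteq> 0" "psi (cong_one j) = 1" "gnorm (cong_one j) = (1 + j * gnorm g)\<^sup>2"
proof -
  have "cong_one j - 1 = of_nat j * of_nat (gnorm g)" by (simp add: cong_one_def)
  hence c: "cong_one j \<simeq> 1" using dvd_gnorm by simp
  thus "coprime (cong_one j) g" using coprime_gcong[of "cong_one j" 1] by simp
  have cgn: "cg (cong_one j) = of_real (1 + real j * real (gnorm g))" by (simp add: cong_one_def)
  have pos: "1 + real j * real (gnorm g) > 0" by (simp add: add_pos_nonneg)
  hence "cg (cong_one j) \<noteq> 0" unfolding cgn by (simp only: of_real_eq_0_iff)
  thus "cong_one j \<noteq> 0" by auto
  have "sgn (cg (cong_one j)) = 1" unfolding cgn sgn_of_real using pos by simp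
  thus "psi (cong_one j) = 1" using gchar_gcong[OF phi c] gchar_1[OF phi] by (simp add: psi_def)
  show "gnorm (cong_one j) = (1 + j * gnorm g)\<^sup>2" unfolding cong_one_def by (rule gnorm_of_nat)
qed

text \<open>Away from the line the two terms of the factor have different moduli.\<close>

lemma hecke_factor_nonzero_off_line:
  assumes "Re s \<noteq> 1"
  shows "hecke_factor (cong_one 1) s \<noteq> 0"
proof
  assume "hecke_factor (cong_one 1) s = 0"
  hence "norm (of_nat (gnorm (cong_one 1)) * npow (cong_one 1) s) = 1" by (simp add: hecke_factor_def cong_one)
  hence "real (gnorm (cong_one 1)) * real (gnorm (cong_one 1)) powr (- Re s) = 1" by (simp add: norm_mult norm_npow)
  moreover have "gnorm (cong_one 1) > 1" using g0 by (simp add: cong_one(4) power2_eq_square)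
  ultimately have "real (gnorm (cong_one 1)) powr (1 - Re s) = 1"
    by (simp add: powr_diff powr_minus divide_inverse)
  thus False using \<open>gnorm (cong_one 1) > 1\<close> assms by (simp add: powr_eq_one_iff_gen)
qed

text \<open>If both factors vanish, the logarithms of \<open>1 + N(g)\<close> and \<open>1 + 2 N(g)\<close> are commensurable, which is impossible
  for coprime integers.\<close>

lemma hecke_factor_nonzero_on_line:
  assumes s: "Re s = 1" "Im s \<noteq> 0"
  shows "hecke_factor (cong_one 1) s \<noteq> 0 \<or> hecke_factor (cong_one 2) s \<noteq> 0"
proof (rule ccontr)
  assume "\<not> ?thesis"
  hence 0: "hecke_factor (cong_one j) s = 0" if "j = 1 \<or> j = 2" for j using that by auto
  define N where "N j = 1 + j * gnorm g" for j
  have N1: "N j > 1" if "j = 1 \<or> j = 2" for j using g0 that by (auto simp: N_def)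
  have "\<exists>a::int. Im s * ln (real (N j)) = of_int a * pi" if j: "j = 1 \<or> j = 2" for j
  proof -
    have s_eq: "s = 1 + \<i> * of_real (Im s)" using s by (simp add: complex_eq_iff)
    have "of_nat (gnorm (cong_one j)) * npow (cong_one j) s = 1" using 0[OF j] by (simp add: hecke_factor_def cong_one)
    moreover have "of_nat (gnorm (cong_one j)) * npow (cong_one j) s = of_nat (gnorm (cong_one j)) powr (- \<i> * of_real (Im s))"
    proof -
      have nz: "(of_nat (gnorm (cong_one j)) :: complex) \<noteq> 0" using cong_one(2) by simp
      have *: "npow (cong_one j) s = of_nat (gnorm (cong_one j)) powr (- 1 + (- \<i> * of_real (Im s)))"
        unfolding npow_def by (subst s_eq) simp
      have "of_nat (gnorm (cong_one j)) * (of_nat (gnorm (cong_one j)) powr (- 1 :: complex)) = 1" using nz by (simp add: powr_minus)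
      thus ?thesis unfolding * powr_add by (simp only: mult.assoc[symmetric] mult_1)
    qed
    moreover have "of_nat (gnorm (cong_one j)) powr (- \<i> * of_real (Im s)) = exp (- \<i> * of_real (Im s) * of_real (2 * ln (real (N j))))"
    proof -
      have "Ln (of_nat (gnorm (cong_one j))) = of_real (ln (real (gnorm (cong_one j))))"
        using Ln_of_real[of "real (gnorm (cong_one j))"] cong_one(2) by simp
      also have "ln (real (gnorm (cong_one j))) = 2 * ln (real (N j))"
        unfolding cong_one(4) using N1[OF j] by (simp add: N_def ln_realpow flip: of_nat_Suc)
      finally show ?thesis using cong_one(2) by (simp add: powr_def)
    qed
    ultimately have "exp (- \<i> * of_real (Im s) * of_real (2 * ln (real (N j)))) = 1" by simp
    then obtain n :: int where "Im (- \<i> * of_real (Im s) * of_real (2 * ln (real (N j)))) = of_int (2 * n) * pi"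
      unfolding exp_eq_1 by blast
    moreover have "Im (- \<i> * of_real x * of_real y) = - (x * y)" for x y :: real by simp
    ultimately have e: "- (Im s * (2 * ln (real (N j)))) = 2 * of_int n * pi"
      by (simp only: of_int_mult of_int_numeral)
    have "x * y = - n * p" if "- (x * (2 * y)) = 2 * n * p" for x y n p :: real
      using that by (linarith | algebra | simp add: algebra_simps)
    from this[OF e] have "Im s * ln (real (N j)) = of_int (- n) * pi" by simp
    thus ?thesis by blast
  qed
  from this[of 1] this[of 2] obtain a b :: int
    where ab: "Im s * ln (real (N 1)) = of_int a * pi" "Im s * ln (real (N 2)) = of_int b * pi" by auto
  have ln0: "ln (real (N 1)) > 0" "ln (real (N 2)) > 0" using N1[of 1] N1[of 2] by auto
  have a0: "a \<noteq> 0" and b0: "b \<noteq> 0" using ab s(2) ln0 by auto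
  have "Im s * pi * (of_int b * ln (real (N 1))) = Im s * pi * (of_int a * ln (real (N 2)))"
    using ab by algebra
  hence "of_int b * ln (real (N 1)) = of_int a * ln (real (N 2))" using s(2) by simp
  hence "\<bar>of_int b * ln (real (N 1))\<bar> = \<bar>of_int a * ln (real (N 2))\<bar>" by simp
  hence "real (nat \<bar>b\<bar>) * ln (real (N 1)) = real (nat \<bar>a\<bar>) * ln (real (N 2))"
    using ln0 by (simp add: abs_mult)
  hence "ln (real (N 1) ^ nat \<bar>b\<bar>) = ln (real (N 2) ^ nat \<bar>a\<bar>)"
    using N1 by (simp add: ln_realpow)
  hence "real (N 1) ^ nat \<bar>b\<bar> = real (N 2) ^ nat \<bar>a\<bar>"
    using N1[of 1] N1[of 2] by (subst (asm) ln_inj_iff) auto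
  hence eq: "N 1 ^ nat \<bar>b\<bar> = N 2 ^ nat \<bar>a\<bar>" by (simp only: of_nat_power[symmetric] of_nat_eq_iff)
  have "coprime (N 1) (N 2)"
  proof (rule coprimeI)
    fix d assume d: "d dvd N 1" "d dvd N 2"
    hence "d dvd 2 * N 1 - N 2" by (intro dvd_diff_nat) auto
    thus "is_unit d" by (simp add: N_def)
  qed
  hence "coprime (N 1 ^ nat \<bar>b\<bar>) (N 2 ^ nat \<bar>a\<bar>)" by simp
  hence "coprime (N 1 ^ nat \<bar>b\<bar>) (N 1 ^ nat \<bar>b\<bar>)" unfolding eq[symmetric] .
  hence "N 1 ^ nat \<bar>b\<bar> = 1" by (simp only: coprime_self nat_dvd_1_iff_1)
  thus False using N1[of 1] b0 by simp
qed

text \<open>At 1 the factor is \<open>psi l - 1\<close>. For \<open>k = 0\<close> a nonprincipal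
  \<open>\<phi>\<close> provides \<open>l\<close>. Otherwise take
  \<open>l = 1 + 2 N(g) \<i>\<close>: if a positive power of its direction were 1,
  \<open>l ^ K\<close> would equal its conjugate; the conjugate of \<open>l\<close> is
  \<open>2 - l\<close>, so \<open>l\<close> would divide \<open>2 ^ K\<close>, which is impossible
  for odd norm above 1.\<close>

lemma hecke_factor_nonzero_at_1:
  assumes "k \<noteq> 0 \<or> \<phi> \<noteq> principal"
  shows "\<exists>l. coprime l g \<and> l \<noteq> 0 \<and> hecke_factor l 1 \<noteq> 0"
proof -
  have h1: "hecke_factor l 1 = psi l - 1" if "l \<noteq> 0" for l
    using that by (simp add: hecke_factor_def npow_def powr_minus)
  show ?thesis
  proof (cases "k = 0")
    case True
    hence "\<phi> \<noteq> principal" using assms by simp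
    then obtain a where a: "\<phi> a \<noteq> principal a" by blast
    hence cop: "coprime a g" using gchar_nz[OF phi, of a] by (auto simp: principal_def)
    hence pa: "\<phi> a \<noteq> 1" using a by (simp add: principal_def)
    have "a \<noteq> 0"
    proof
      assume "a = 0"
      hence "is_unit g" using cop by simp
      hence "a \<simeq> 1" by (meson dvd_trans one_dvd)
      thus False using pa gchar_gcong[OF phi] gchar_1[OF phi] by metis
    qed
    moreover have "psi a = \<phi> a" unfolding psi_def by (simp add: True)
    ultimately show ?thesis using cop pa h1[of a] by (intro exI[of _ a] conjI) simp_all
  next
    case False
    \<comment> \<open>A multiple of \<open>gnorm g\<close> makes \<open>l\<close> congruent to 1,
      and evenness makes the norm \<open>1 + M^2\<close> of \<open>l\<close> odd.\<close>
    define M where "M = 2 * gnorm g"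
    define l where "l = Gauss_Int 1 (int M)"
    have Mp: "M \<ge> 2" using g0 by (simp add: M_def Suc_le_eq)
    have "l - 1 = of_nat (gnorm g) * Gauss_Int 0 2"
      by (simp add: l_def M_def of_nat_gauss one_gauss_int_def minus_gauss_int_def times_gauss_int_def)
    hence l1: "l \<simeq> 1" using dvd_gnorm by simp
    have l0: "l \<noteq> 0" by (simp add: l_def zero_gauss_int_def)
    have cop: "coprime l g" using coprime_gcong[OF l1] by simp
    have "psi l \<noteq> 1"
    proof
      assume p1: "psi l = 1"
      hence s1: "sgn (cg l) powi k = 1" using gchar_gcong[OF phi l1] gchar_1[OF phi] by (simp add: psi_def)
      define K where "K = nat \<bar>k\<bar>"
      have K0: "K > 0" using False by (simp add: K_def)
      have "sgn (cg l) ^ K = 1"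
        using s1 by (auto simp: K_def power_int_def power_inverse split: if_splits)
      hence "cg l ^ K = of_real (norm (cg l)) ^ K"
        using l0 by (simp add: sgn_eq power_divide)
      hence "cnj (cg l ^ K) = cg l ^ K" by (metis complex_cnj_complex_of_real of_real_power)
      hence "cg (gcnj l ^ K) = cg (l ^ K)" by simp
      hence eq: "gcnj l ^ K = l ^ K" by (simp only: cg_eq_iff)
      interpret l: gauss_mod l by unfold_locales (rule l0)
      have two: "(2 :: gauss_int) = Gauss_Int 2 0" using of_nat_gauss[of 2] by simp
      have "gcnj l = 2 - l" by (simp add: gcnj_def l_def two minus_gauss_int_def)
      hence "l dvd gcnj l - 2" by (simp add: dvd_minus_iff)
      hence "l dvd gcnj l ^ K - 2 ^ K" by (rule l.gcong_power)
      hence "l dvd l ^ K - 2 ^ K" by (simp only: eq)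
      moreover have "l dvd l ^ K" using K0 by (intro dvd_power) auto
      ultimately have "l dvd 2 ^ K" by (simp only: dvd_diff_right_iff)
      then obtain c where "2 ^ K = l * c" by (auto elim: dvdE)
      hence "gnorm (2 ^ K) = gnorm l * gnorm c" by (metis gnorm_mult)
      hence "gnorm l dvd (gnorm 2) ^ K" by simp
      moreover have "gnorm 2 = 4" using gnorm_of_nat[of 2] by simp
      moreover have gl: "gnorm l = 1 + M\<^sup>2"
        by (simp add: gnorm_def l_def nat_add_distrib nat_power_eq)
      moreover have "coprime (1 + M\<^sup>2) 4"
      proof -
        have "odd (1 + M\<^sup>2)" by (simp add: M_def)
        hence "coprime (1 + M\<^sup>2) 2" by (simp only: coprime_right_2_iff_odd not_False_eq_True)
        hence "coprime (1 + M\<^sup>2) (2 ^ 2)" by (simp only: coprime_power_right_iff simp_thms)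
        thus ?thesis by simp
      qed
      ultimately have "1 + M\<^sup>2 dvd 1" by (metis coprime_common_divisor coprime_power_right_iff dvd_refl)
      thus False using Mp by simp
    qed
    thus ?thesis using l0 cop h1 by (intro exI[of _ l]) simp
  qed
qed

text \<open>The factors of \<open>cong_one 1\<close> and \<open>cong_one 2\<close> have no common
  zero other than 1, and at 1 the hypothesis supplies a further factor.\<close>

lemma continuation_nonprincipal:
  assumes "k \<noteq> 0 \<or> \<phi> \<noteq> principal"
  obtains W where "W holomorphic_on {s. Re s > 0}" "\<And>s. Re s > 1 \<Longrightarrow> W s = L_series psi s"
proof -
  define I where "I = {l. coprime l g \<and> l \<noteq> 0}"
  have "\<forall>l\<in>I. \<exists>E. E holomorphic_on {s. Re s > 0} \<and> (\<forall>s. Re s > 1 \<longrightarrow> E s = hecke_factor l s * L_series psi s)"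
    using hecke_factor_relation by (auto simp: I_def)
  then obtain E where E: "\<And>l. l \<in> I \<Longrightarrow> E l holomorphic_on {s. Re s > 0}"
    "\<And>l s. l \<in> I \<Longrightarrow> Re s > 1 \<Longrightarrow> E l s = hecke_factor l s * L_series psi s"
    by metis
  have nnI: "cong_one j \<in> I" for j using cong_one by (simp add: I_def)
  have nz: "\<exists>l\<in>I. hecke_factor l s \<noteq> 0" for s
  proof (cases "Re s = 1")
    case True
    show ?thesis
    proof (cases "Im s = 0")
      case True
      hence "s = 1" using \<open>Re s = 1\<close> by (simp add: complex_eq_iff)
      thus ?thesis using hecke_factor_nonzero_at_1[OF assms] by (auto simp: I_def)
    qed (use hecke_factor_nonzero_on_line[OF True] nnI in blast)
  qed (use hecke_factor_nonzero_off_line nnI in blast)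
  show ?thesis
  proof (rule glue_continuation[of I E hecke_factor "L_series psi"])
    fix W assume W: "W holomorphic_on {s. Re s > 0}" "\<And>s. Re s > 1 \<Longrightarrow> W s = L_series psi s"
    show thesis by (rule that[OF W])
  qed (use E hecke_factor_holomorphic nz in auto)
qed

end

text \<open>At 1 all factors vanish, and that of \<open>cong_one 1\<close> does so simply, its
  derivative being minus the logarithm of the norm. Division by \<open>s - 1\<close> therefore
  yields factors without common zero for \<open>(s - 1) L\<close>. A zero of \<open>W\<close> at 1
  would give the series a finite limit there.\<close>

lemma (in gauss_mod) continuation_principal:
  obtains W where "W holomorphic_on {s. Re s > 0}" "\<And>s. Re s > 1 \<Longrightarrow> W s = (s - 1) * L_series principal s" "W 1 \<noteq> 0"
proof -
  interpret P: hecke g principal 0 by (rule hecke_principal)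
  note pp = psi_principal
  define h' where "h' l s = (if s = 1 then deriv (P.hecke_factor l) 1 else P.hecke_factor l s / (s - 1))" for l s
  have "\<forall>j. \<exists>E. E holomorphic_on {s. Re s > 0} \<and> (\<forall>s. Re s > 1 \<longrightarrow> E s = P.hecke_factor (P.cong_one j) s * L_series principal s)"
    using P.hecke_factor_relation[OF P.cong_one(1,2)] by (simp add: pp)
  then obtain E where E: "\<And>j. E j holomorphic_on {s. Re s > 0}"
    "\<And>j s. Re s > 1 \<Longrightarrow> E j s = P.hecke_factor (P.cong_one j) s * L_series principal s"
    by metis
  have h1: "P.hecke_factor (P.cong_one j) 1 = 0" for j
    using P.cong_one(2)[of j] by (simp add: P.hecke_factor_def P.cong_one npow_def powr_minus del: P.cong_one(4))
  have A1: "h' (P.cong_one j) holomorphic_on {s. Re s > 0}" for j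
    by (rule pole_theorem_open_0[of "P.hecke_factor (P.cong_one j)" _ 1])
       (auto simp: h'_def h1 open_Re_gt intro: P.hecke_factor_holomorphic)
  have A2: "E j s = h' (P.cong_one j) s * ((s - 1) * L_series principal s)" if "Re s > 1" for j s
    using E(2)[OF that, of j] that by (auto simp: h'_def)
  have A3: "\<exists>j\<in>{1, 2}. h' (P.cong_one j) s \<noteq> 0" for s
  proof (cases "Re s = 1")
    case True
    show ?thesis
    proof (cases "Im s = 0")
      case Im: True
      hence s1: "s = 1" using \<open>Re s = 1\<close> by (simp add: complex_eq_iff)
      define l where "l = P.cong_one 1"
      have N: "gnorm l > 1" using g0 by (simp add: l_def P.cong_one(4) power2_eq_square)
      have "(P.hecke_factor l has_field_derivative of_nat (gnorm l) * P.psi l * (- of_real (ln (real (gnorm l))) * npow l 1) - 0) (at 1)"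
        unfolding P.hecke_factor_def by (intro DERIV_diff DERIV_cmult deriv_npow DERIV_const)
      hence "deriv (P.hecke_factor l) 1 = of_nat (gnorm l) * P.psi l * (- of_real (ln (real (gnorm l))) * npow l 1)"
        by (simp add: DERIV_imp_deriv)
      moreover have "P.psi l = 1" "l \<noteq> 0" "npow l 1 \<noteq> 0" using P.cong_one(2,3) by (auto simp: l_def npow_def)
      ultimately have "h' l s \<noteq> 0" using N by (simp add: h'_def s1)
      thus ?thesis by (auto simp: l_def)
    qed (use P.hecke_factor_nonzero_on_line[OF True] in \<open>auto simp: h'_def\<close>)
  next
    case False
    thus ?thesis using P.hecke_factor_nonzero_off_line[OF False] by (auto simp: h'_def)
  qed
  obtain W where W: "W holomorphic_on {s. Re s > 0}" "\<And>s. Re s > 1 \<Longrightarrow> W s = (s - 1) * L_series principal s"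
  proof (rule glue_continuation[of "{1, 2}" E "\<lambda>j. h' (P.cong_one j)" "\<lambda>s. (s - 1) * L_series principal s", OF E(1) A1 A2 A3])
    fix W assume *: "W holomorphic_on {s. Re s > 0}" "\<And>s. Re s > 1 \<Longrightarrow> W s = (s - 1) * L_series principal s"
    show thesis by (rule that[OF *])
  qed
  have "W 1 \<noteq> 0"
  proof
    assume W1: "W 1 = 0"
    define V where "V s = (if s = 1 then deriv W 1 else W s / (s - 1))" for s
    have V: "V holomorphic_on {s. Re s > 0}"
      by (rule pole_theorem_open_0[of W _ 1]) (auto simp: V_def W1 W(1) open_Re_gt)
    have "((\<lambda>x. V (of_real x)) \<longlongrightarrow> V (of_real 1)) (at_right 1)"
      by (rule tendsto_at_right_complex[OF V open_Re_gt]) simp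
    moreover have "\<forall>\<^sub>F x in at_right 1. V (of_real x) = L_series principal (of_real x)"
      using eventually_at_right_gt[of 1] by eventually_elim (auto simp: V_def W(2))
    ultimately have "((\<lambda>x. L_series principal (of_real x)) \<longlongrightarrow> V (of_real 1)) (at_right 1)"
      by (rule Lim_transform_eventually)
    thus False using principal_no_limit by blast
  qed
  thus ?thesis using that W by blast
qed

section \<open>Nonvanishing on the line \<open>Re s = 1\<close>\<close>

lemma powi_double: "x powi (2 * k) = (x powi k)\<^sup>2" for x :: complex
proof -
  have "x powi (k * 2) = (x powi k) powi 2" by (rule power_int_mult)
  also have "\<dots> = (x powi k)\<^sup>2" by (rule power_int_numeral)
  finally show ?thesis by (simp only: mult.commute)
qed

lemma Re_of_real_mult: "Re (of_real x * z) = x * Re z"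
  by simp

context hecke
begin

definition trivial :: bool where "trivial \<longleftrightarrow> \<phi> = principal \<and> k = 0"

definition pole_factor :: "complex \<Rightarrow> complex" where "pole_factor s = (if trivial then s - 1 else 1)"

text \<open>\<open>pole_factor\<close> removes the possible pole. The last clause, that the pole is
  genuine, is what nonvanishing at 1 means for the trivial character.\<close>

definition is_continuation :: "(complex \<Rightarrow> complex) \<Rightarrow> bool" where
  "is_continuation W \<longleftrightarrow> W holomorphic_on {s. Re s > 0} \<and> (\<forall>s. Re s > 1 \<longrightarrow> W s = pole_factor s * L_series psi s) \<and> (trivial \<longrightarrow> W 1 \<noteq> 0)"

lemma is_continuationD:
  assumes "is_continuation W"
  shows "W holomorphic_on {s. Re s > 0}" "Re s > 1 \<Longrightarrow> W s = pole_factor s * L_series psi s" "trivial \<Longrightarrow> W 1 \<noteq> 0"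
  using assms unfolding is_continuation_def by blast+

lemma exists_continuation: "\<exists>W. is_continuation W"
proof (cases trivial)
  case True
  obtain W where W: "W holomorphic_on {s. Re s > 0}" "\<And>s. Re s > 1 \<Longrightarrow> W s = (s - 1) * L_series principal s" "W 1 \<noteq> 0"
    using continuation_principal by blast
  have "psi = principal" using True psi_principal by (simp add: trivial_def)
  hence "is_continuation W" unfolding is_continuation_def pole_factor_def using W True by simp
  thus ?thesis by blast
next
  case False
  hence *: "k \<noteq> 0 \<or> \<phi> \<noteq> principal" by (auto simp: trivial_def)
  obtain W where W: "W holomorphic_on {s. Re s > 0}" "\<And>s. Re s > 1 \<Longrightarrow> W s = L_series psi s"
  proof (rule continuation_nonprincipal[OF *])
    fix W assume **: "W holomorphic_on {s. Re s > 0}" "\<And>s. Re s > 1 \<Longrightarrow> W s = L_series psi s"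
    show thesis by (rule that[OF **])
  qed
  hence "is_continuation W" unfolding is_continuation_def pole_factor_def using False by simp
  thus ?thesis by blast
qed

lemma pole_factor_nonzero: "Re s > 1 \<Longrightarrow> pole_factor s \<noteq> 0" by (auto simp: pole_factor_def)

lemma log_derivative_cont:
  assumes W: "is_continuation W" and s: "Re s > 1"
  shows "W s \<noteq> 0" "deriv W s / W s = (if trivial then 1 / (s - 1) else 0) - prime_power_series psi s / 4"
proof -
  have L0: "L_series psi s \<noteq> 0" by (rule L_series_nonzero[OF s])
  show W0: "W s \<noteq> 0" using is_continuationD(2)[OF W s] L0 pole_factor_nonzero[OF s] by simp
  have L': "(L_series psi has_field_derivative deriv (L_series psi) s) (at s)"
    by (rule holomorphic_derivI[OF L_series_holomorphic[of psi, OF le1] open_Re_gt]) (use s in simp)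
  have q': "(pole_factor has_field_derivative (if trivial then 1 else 0)) (at s)"
    unfolding pole_factor_def by (cases trivial) (auto intro!: derivative_eq_intros)
  have "((\<lambda>s. pole_factor s * L_series psi s) has_field_derivative (if trivial then 1 else 0) * L_series psi s + deriv (L_series psi) s * pole_factor s) (at s)"
    by (rule DERIV_mult[OF q' L'])
  hence "(W has_field_derivative (if trivial then 1 else 0) * L_series psi s + deriv (L_series psi) s * pole_factor s) (at s)"
    by (rule has_field_derivative_transform_within_open[where S = "{s. Re s > 1}"])
       (use s is_continuationD(2)[OF W] open_Re_gt in auto)
  hence "deriv W s = (if trivial then 1 else 0) * L_series psi s + deriv (L_series psi) s * pole_factor s" by (rule DERIV_imp_deriv)
  hence "deriv W s / W s = (if trivial then 1 else 0) / pole_factor s + deriv (L_series psi) s / L_series psi s"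
    unfolding is_continuationD(2)[OF W s] using L0 pole_factor_nonzero[OF s] by (simp add: field_simps)
  thus "deriv W s / W s = (if trivial then 1 / (s - 1) else 0) - prime_power_series psi s / 4"
    using prime_power_series_eq[OF s] by (simp add: pole_factor_def)
qed

text \<open>The limit is 4 times the order of the pole of the series minus the order of the zero of
  \<open>W\<close> at \<open>1 + it\<close>. It is taken along real parts decreasing to 1, where
  inequalities between convergent series are available.\<close>

lemma pole_limit:
  assumes W: "is_continuation W"
  obtains m :: nat where
    "((\<lambda>x. of_real (x - 1) * prime_power_series psi (of_real x + \<i> * of_real t)) \<longlongrightarrow>
        4 * ((if trivial \<and> t = 0 then 1 else 0) - of_nat m)) (at_right 1)"
    "m > 0 \<longleftrightarrow> W (1 + \<i> * of_real t) = 0"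
proof -
  define z0 where "z0 = 1 + \<i> * of_real t"
  have con: "connected {s. Re s > 0}" by (intro convex_connected convex_halfspace_Re_gt)
  have W2: "W 2 \<noteq> 0" by (rule log_derivative_cont[OF W]) simp
  obtain m where m: "((\<lambda>z. (z - z0) * (deriv W z / W z)) \<longlongrightarrow> of_nat m) (at z0)" "m > 0 \<longleftrightarrow> W z0 = 0"
    by (rule log_derivative_limit[OF is_continuationD(1)[OF W] open_Re_gt con _ _ W2, of z0]) (auto simp: z0_def)
  have fl: "filterlim (\<lambda>x. of_real x + \<i> * of_real t) (at z0) (at_right 1)"
  proof (rule filterlim_atI)
    have "((\<lambda>x. complex_of_real x + \<i> * of_real t) \<longlongrightarrow> of_real 1 + \<i> * of_real t) (at_right 1)"
      by (intro tendsto_intros)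
    thus "((\<lambda>x. complex_of_real x + \<i> * of_real t) \<longlongrightarrow> z0) (at_right 1)" by (simp add: z0_def)
    show "\<forall>\<^sub>F x in at_right 1. complex_of_real x + \<i> * of_real t \<noteq> z0"
      using eventually_at_right_gt[of 1] by eventually_elim (auto simp: z0_def complex_eq_iff)
  qed
  have lim1: "((\<lambda>x. of_real (x - 1) * (deriv W (of_real x + \<i> * of_real t) / W (of_real x + \<i> * of_real t))) \<longlongrightarrow> of_nat m) (at_right 1)"
    using filterlim_compose[OF m(1) fl] by (simp add: z0_def)
  have lim2: "((\<lambda>x. of_real (x - 1) * (if trivial then 1 / (of_real x + \<i> * of_real t - 1) else 0)) \<longlongrightarrow>
      (if trivial \<and> t = 0 then 1 else 0)) (at_right (1::real))"
  proof (cases "trivial \<and> t = 0")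
    case True
    have "\<forall>\<^sub>F x in at_right (1::real). 1 = complex_of_real (x - 1) * (if trivial then 1 / (of_real x + \<i> * of_real t - 1) else 0)"
      using eventually_at_right_gt[of 1]
    proof eventually_elim
      case (elim x)
      hence "complex_of_real x - 1 \<noteq> 0" by (simp add: complex_eq_iff)
      thus ?case using True by simp
    qed
    thus ?thesis using True by (intro Lim_transform_eventually[OF tendsto_const]) auto
  next
    case False
    show ?thesis
    proof (cases trivial)
      case T: True
      hence t: "t \<noteq> 0" using False by simp
      have "((\<lambda>x. complex_of_real (x - 1) * (1 / (of_real x + \<i> * of_real t - 1))) \<longlongrightarrow>
        of_real (1 - 1) * (1 / (of_real 1 + \<i> * of_real t - 1))) (at_right 1)"
        using t by (intro tendsto_intros) auto
      thus ?thesis using T t by simp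
    qed simp
  qed
  have "((\<lambda>x. 4 * (of_real (x - 1) * (if trivial then 1 / (of_real x + \<i> * of_real t - 1) else 0)
       - of_real (x - 1) * (deriv W (of_real x + \<i> * of_real t) / W (of_real x + \<i> * of_real t)))) \<longlongrightarrow>
        4 * ((if trivial \<and> t = 0 then 1 else 0) - of_nat m)) (at_right (1::real))"
    by (intro tendsto_mult_left tendsto_diff lim1 lim2)
  moreover have "\<forall>\<^sub>F x in at_right (1::real). 4 * (of_real (x - 1) * (if trivial then 1 / (of_real x + \<i> * of_real t - 1) else 0)
       - of_real (x - 1) * (deriv W (of_real x + \<i> * of_real t) / W (of_real x + \<i> * of_real t)))
      = of_real (x - 1) * prime_power_series psi (of_real x + \<i> * of_real t)"
    using eventually_at_right_gt[of 1]
  proof eventually_elim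
    case (elim x)
    have eq: "deriv W (of_real x + \<i> * of_real t) / W (of_real x + \<i> * of_real t)
      = (if trivial then 1 / (of_real x + \<i> * of_real t - 1) else 0) - prime_power_series psi (of_real x + \<i> * of_real t) / 4"
      by (rule log_derivative_cont(2)[OF W]) (use elim in simp)
    have "4 * (r * q - r * (q - p / 4)) = r * p" for r q p :: complex by (simp add: algebra_simps)
    thus ?case unfolding eq .
  qed
  ultimately have "((\<lambda>x. of_real (x - 1) * prime_power_series psi (of_real x + \<i> * of_real t)) \<longlongrightarrow>
        4 * ((if trivial \<and> t = 0 then 1 else 0) - of_nat m)) (at_right 1)"
    by (rule Lim_transform_eventually)
  thus ?thesis using that m(2) by (simp add: z0_def)
qed

lemma hecke_square: "hecke g (\<lambda>a. \<phi> a * \<phi> a) (2 * k)"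
proof
  show "gchar (\<lambda>a. \<phi> a * \<phi> a)" by (rule gchar_times[OF phi phi])
  show "\<phi> u * \<phi> u * sgn (cg u) powi (2 * k) = 1" if "is_unit u" for u
  proof -
    have "sgn (cg u) powi (2 * k) = (sgn (cg u) powi k)\<^sup>2" by (rule powi_double)
    hence "\<phi> u * \<phi> u * sgn (cg u) powi (2 * k) = (\<phi> u * sgn (cg u) powi k)\<^sup>2" by (simp add: power2_eq_square mult_ac)
    thus ?thesis using unit_triv[OF that] by simp
  qed
qed

lemma psi_square: "hecke.psi (\<lambda>a. \<phi> a * \<phi> a) (2 * k) a = (psi a)\<^sup>2"
proof -
  have "sgn (cg a) powi (2 * k) = (sgn (cg a) powi k)\<^sup>2" by (rule powi_double)
  thus ?thesis unfolding hecke.psi_def[OF hecke_square] psi_def by (simp add: power2_eq_square mult_ac)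
qed

lemma norm_psi: "a \<noteq> 0 \<Longrightarrow> norm (psi a) = (if coprime a g then 1 else 0)"
  using norm_gchar[OF phi, of a] by (simp add: psi_def norm_mult norm_power_int norm_sgn)

text \<open>Term by term, with \<open>u = psi(a) N(a)^(-it)\<close> of modulus 1:
  \<open>3 + 4 Re u + Re (u^2) = 2 (1 + Re u)^2\<close>. The principal character replaces the
  constant 1 because the other two terms vanish when \<open>a\<close> is not coprime to
  \<open>g\<close>.\<close>

lemma three_four_one:
  assumes x: "x > 1"
  shows "3 * Re (prime_power_series principal (of_real x)) + 4 * Re (prime_power_series psi (of_real x + \<i> * of_real t))
     + Re (prime_power_series (\<lambda>a. (psi a)\<^sup>2) (of_real x + \<i> * of_real (2 * t))) \<ge> 0"
proof -
  have b: "norm (principal a) \<le> 1" "norm ((psi a)\<^sup>2) \<le> 1" for a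
    using le1[of a] by (auto simp: principal_def norm_power power_le_one)
  have "((\<lambda>z. 3 * Re (prime_power_term principal (of_real x) z) + 4 * Re (prime_power_term psi (of_real x + \<i> * of_real t) z)
     + Re (prime_power_term (\<lambda>a. (psi a)\<^sup>2) (of_real x + \<i> * of_real (2 * t)) z)) has_sum
     (3 * Re (prime_power_series principal (of_real x)) + 4 * Re (prime_power_series psi (of_real x + \<i> * of_real t))
     + Re (prime_power_series (\<lambda>a. (psi a)\<^sup>2) (of_real x + \<i> * of_real (2 * t))))) prime_powers"
    using x by (intro has_sum_add has_sum_cmult_right has_sum_Re prime_power_series_has_sum b le1) auto
  moreover have "3 * Re (prime_power_term principal (of_real x) z) + 4 * Re (prime_power_term psi (of_real x + \<i> * of_real t) z)
     + Re (prime_power_term (\<lambda>a. (psi a)\<^sup>2) (of_real x + \<i> * of_real (2 * t)) z) \<ge> 0" if z: "z \<in> prime_powers" for z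
  proof -
    obtain p m where pm: "z = (p, m)" "prime_elem p" using z by (auto simp: prime_powers_def)
    define a where "a = p ^ m"
    have a0: "a \<noteq> 0" using pm by (auto simp: a_def)
    define y where "y = real (gnorm a) powr (- x)"
    have np: "npow a (of_real x) = of_real y" by (simp add: npow_def y_def powr_of_real[symmetric])
    define u where "u = psi a * npow a (\<i> * of_real t)"
    have u: "prime_power_term psi (of_real x + \<i> * of_real t) z = of_real (ln_norm p * y) * u"
      by (simp add: prime_power_term_def pm a_def[symmetric] npow_add np u_def mult_ac)
    have "npow a (\<i> * of_real (2 * t)) = (npow a (\<i> * of_real t))\<^sup>2"
      by (simp add: power2_eq_square npow_add[symmetric] algebra_simps)
    hence u2: "prime_power_term (\<lambda>a. (psi a)\<^sup>2) (of_real x + \<i> * of_real (2 * t)) z = of_real (ln_norm p * y) * u\<^sup>2"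
      by (simp add: prime_power_term_def pm a_def[symmetric] npow_add np u_def power_mult_distrib mult_ac)
    have u0: "prime_power_term principal (of_real x) z = of_real (ln_norm p * y) * principal a"
      by (simp add: prime_power_term_def pm a_def[symmetric] np mult_ac)
    have nu: "norm u = (if coprime a g then 1 else 0)"
      using norm_psi[OF a0] a0 by (simp add: u_def norm_mult norm_npow)
    have "3 * Re (principal a) + 4 * Re u + Re (u\<^sup>2) \<ge> 0"
    proof (cases "coprime a g")
      case True
      hence "(Re u)\<^sup>2 + (Im u)\<^sup>2 = 1" using nu by (simp add: cmod_def)
      moreover have "Re (u\<^sup>2) = (Re u)\<^sup>2 - (Im u)\<^sup>2" by (simp add: power2_eq_square)
      ultimately have "3 * Re (principal a) + 4 * Re u + Re (u\<^sup>2) = 2 * (1 + Re u)\<^sup>2"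
        using True by (simp add: principal_def power2_eq_square algebra_simps)
      thus ?thesis by simp
    qed (use nu in \<open>simp add: principal_def\<close>)
    hence "ln_norm p * y * (3 * Re (principal a) + 4 * Re u + Re (u\<^sup>2)) \<ge> 0"
      using ln_norm_nonneg by (intro mult_nonneg_nonneg) (auto simp: y_def)
    thus ?thesis unfolding u u2 u0 Re_of_real_mult by (simp add: algebra_simps)
  qed
  ultimately show ?thesis by (rule has_sum_nonneg)
qed

text \<open>Multiplying the inequality by \<open>x - 1\<close> and letting \<open>x\<close> decrease
  to 1 gives \<open>12 - 16 m - 4 m2 \<ge> 0\<close>, where \<open>m\<close> and \<open>m2\<close>
  are orders of zeros; this excludes \<open>m \<ge> 1\<close>. In the excluded case the squared
  character has a pole of its own at \<open>1 + 2it\<close>, whose extra 4 would leave room for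
  \<open>m = 1\<close>.\<close>

lemma nonvanishing_complex:
  assumes W: "is_continuation W" and nr: "\<not> ((\<lambda>a. \<phi> a * \<phi> a) = principal \<and> k = 0 \<and> t = 0)"
  shows "W (1 + \<i> * of_real t) \<noteq> 0"
proof
  assume W0: "W (1 + \<i> * of_real t) = 0"
  interpret P: hecke g principal 0 by (rule hecke_principal)
  interpret S: hecke g "\<lambda>a. \<phi> a * \<phi> a" "2 * k" by (rule hecke_square)
  obtain V where V: "P.is_continuation V" using P.exists_continuation by blast
  obtain U where U: "S.is_continuation U" using S.exists_continuation by blast
  have Spsi: "S.psi = (\<lambda>a. (psi a)\<^sup>2)" using psi_square by auto
  have Ptriv: "P.trivial" by (simp add: P.trivial_def)
  have Striv: "\<not> (S.trivial \<and> 2 * t = 0)" using nr by (auto simp: S.trivial_def)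
  have trivial: "\<not> (trivial \<and> t = 0)"
  proof
    assume "trivial \<and> t = 0"
    hence "\<phi> = principal" "k = 0" "t = 0" by (auto simp: trivial_def)
    moreover have "principal a * principal a = principal a" for a by (simp add: principal_def)
    ultimately show False using nr by (simp add: fun_eq_iff)
  qed
  obtain m0 where m0: "((\<lambda>x. of_real (x - 1) * prime_power_series P.psi (of_real x + \<i> * of_real 0)) \<longlongrightarrow>
        4 * ((if P.trivial \<and> (0::real) = 0 then 1 else 0) - of_nat m0)) (at_right 1)" "m0 > 0 \<longleftrightarrow> V (1 + \<i> * of_real 0) = 0"
    by (rule P.pole_limit[OF V])
  have "m0 = 0" using m0(2) P.is_continuationD(3)[OF V Ptriv] by simp
  hence l0: "((\<lambda>x. of_real (x - 1) * prime_power_series principal (of_real x)) \<longlongrightarrow> 4) (at_right 1)"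
    using m0(1) Ptriv by (simp add: psi_principal)
  obtain m where m: "((\<lambda>x. of_real (x - 1) * prime_power_series psi (of_real x + \<i> * of_real t)) \<longlongrightarrow>
        4 * ((if trivial \<and> t = 0 then 1 else 0) - of_nat m)) (at_right 1)" "m > 0 \<longleftrightarrow> W (1 + \<i> * of_real t) = 0"
    by (rule pole_limit[OF W])
  hence l1: "((\<lambda>x. of_real (x - 1) * prime_power_series psi (of_real x + \<i> * of_real t)) \<longlongrightarrow> 4 * (- of_nat m)) (at_right 1)"
    using trivial by (simp add: if_not_P)
  obtain m2 where m2: "((\<lambda>x. of_real (x - 1) * prime_power_series S.psi (of_real x + \<i> * of_real (2 * t))) \<longlongrightarrow>
        4 * ((if S.trivial \<and> 2 * t = 0 then 1 else 0) - of_nat m2)) (at_right 1)"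
    by (rule S.pole_limit[OF U])
  hence l2: "((\<lambda>x. of_real (x - 1) * prime_power_series (\<lambda>a. (psi a)\<^sup>2) (of_real x + \<i> * of_real (2 * t))) \<longlongrightarrow> 4 * (- of_nat m2)) (at_right 1)"
    using Striv unfolding Spsi by (simp only: if_not_P) simp
  have "((\<lambda>x. 3 * Re (of_real (x - 1) * prime_power_series principal (of_real x)) + 4 * Re (of_real (x - 1) * prime_power_series psi (of_real x + \<i> * of_real t))
     + Re (of_real (x - 1) * prime_power_series (\<lambda>a. (psi a)\<^sup>2) (of_real x + \<i> * of_real (2 * t)))) \<longlongrightarrow>
      3 * Re 4 + 4 * Re (4 * (- of_nat m)) + Re (4 * (- of_nat m2))) (at_right 1)"
    by (intro tendsto_add tendsto_mult_left tendsto_Re l0 l1 l2)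
  moreover have "\<forall>\<^sub>F x in at_right 1. 3 * Re (of_real (x - 1) * prime_power_series principal (of_real x)) + 4 * Re (of_real (x - 1) * prime_power_series psi (of_real x + \<i> * of_real t))
     + Re (of_real (x - 1) * prime_power_series (\<lambda>a. (psi a)\<^sup>2) (of_real x + \<i> * of_real (2 * t))) \<ge> 0"
    using eventually_at_right_gt[of 1]
  proof eventually_elim
    case (elim x)
    have "(x - 1) * (3 * Re (prime_power_series principal (of_real x)) + 4 * Re (prime_power_series psi (of_real x + \<i> * of_real t))
     + Re (prime_power_series (\<lambda>a. (psi a)\<^sup>2) (of_real x + \<i> * of_real (2 * t)))) \<ge> 0"
      using three_four_one[OF elim, of t] elim by (intro mult_nonneg_nonneg) auto
    thus ?case unfolding Re_of_real_mult by (simp only: algebra_simps)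
  qed
  ultimately have "3 * Re 4 + 4 * Re (4 * (- of_nat m)) + Re (4 * (- of_nat m2)) \<ge> 0"
    by (rule tendsto_lowerbound) simp
  hence "12 - 16 * real m - 4 * real m2 \<ge> 0" by simp
  moreover have "m \<ge> 1" using m(2) W0 by simp
  ultimately show False by linarith
qed

end

section \<open>Real characters at the point 1\<close>

lemma sum_nonneg_Reals: "(\<And>i. i \<in> I \<Longrightarrow> f i \<in> \<real>\<^sub>\<ge>\<^sub>0) \<Longrightarrow> sum f I \<in> (\<real>\<^sub>\<ge>\<^sub>0 :: complex set)"
  by (induction I rule: infinite_finite_induct) auto

lemma higher_deriv_npow: "(deriv ^^ n) (\<lambda>s. C * npow a s) = (\<lambda>s. C * (- of_real (ln_norm a)) ^ n * npow a s)"
proof (induction n)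
  case (Suc n)
  have "deriv (\<lambda>s. C * (- of_real (ln_norm a)) ^ n * npow a s) s = C * (- of_real (ln_norm a)) ^ Suc n * npow a s" for s
    using DERIV_imp_deriv[OF DERIV_cmult[OF deriv_npow[of a s], of "C * (- of_real (ln_norm a)) ^ n"]]
    by (simp add: ln_norm_def mult_ac)
  thus ?case unfolding funpow.simps o_apply Suc by (intro ext)
qed simp

text \<open>A completely monotone logarithmic derivative keeps \<open>Q\<close> above its value at 2, all the way down to the
  boundary of the disc of holomorphy: the Taylor coefficients of \<open>Q\<close> at 2 alternate in sign.\<close>

lemma completely_monotone_lower_bound:
  assumes Q: "Q holomorphic_on {s. Re s > 1/2}" and A: "A holomorphic_on {s. Re s > 1}" and Q2: "Q 2 = 1"
    and Q': "\<And>s. Re s > 1 \<Longrightarrow> deriv Q s = - A s * Q s"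
    and mono: "\<And>n. (- 1) ^ n * (deriv ^^ n) A 2 \<in> \<real>\<^sub>\<ge>\<^sub>0"
    and x: "1/2 < x" "x \<le> 2"
  shows "Re (Q (of_real x)) \<ge> 1"
proof -
  define q where "q n = (- 1) ^ n * (deriv ^^ n) Q 2" for n
  have half: "{s. Re s > 1} \<subseteq> {s. Re s > 1/2}" by auto
  have Q1: "Q holomorphic_on {s. Re s > 1}" using Q half holomorphic_on_subset by blast
  have two: "2 \<in> {s. Re s > 1}" by simp
  \<comment> \<open>Leibniz's rule for \<open>Q' = - A * Q\<close>, with the signs distributed so
    that every coefficient of the recursion is nonnegative.\<close>
  have rec: "q (Suc n) = (\<Sum>i = 0..n. of_nat (n choose i) * ((- 1) ^ i * (deriv ^^ i) A 2) * q (n - i))" for n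
  proof -
    have "(deriv ^^ Suc n) Q 2 = (deriv ^^ n) (deriv Q) 2" by (simp add: funpow_swap1)
    also have "\<dots> = (deriv ^^ n) (\<lambda>s. - A s * Q s) 2"
      by (rule higher_deriv_transform_within_open[OF _ _ open_Re_gt[of 1] two Q'])
         (use A Q1 open_Re_gt in \<open>auto intro!: holomorphic_intros holomorphic_deriv\<close>)
    also have "\<dots> = (\<Sum>i = 0..n. of_nat (n choose i) * (deriv ^^ i) (\<lambda>s. - A s) 2 * (deriv ^^ (n - i)) Q 2)"
      by (rule higher_deriv_mult[OF _ Q1 open_Re_gt two]) (intro holomorphic_intros A)
    also have "\<dots> = (\<Sum>i = 0..n. of_nat (n choose i) * (- (deriv ^^ i) A 2) * (deriv ^^ (n - i)) Q 2)"
      using higher_deriv_uminus[OF A open_Re_gt two] by simp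
    finally have "q (Suc n) = (- 1) ^ Suc n * (\<Sum>i = 0..n. of_nat (n choose i) * (- (deriv ^^ i) A 2) * (deriv ^^ (n - i)) Q 2)"
      by (simp only: q_def)
    also have "\<dots> = (\<Sum>i = 0..n. of_nat (n choose i) * ((- 1) ^ i * (deriv ^^ i) A 2) * q (n - i))"
      unfolding sum_distrib_left
    proof (rule sum.cong[OF refl])
      fix i assume "i \<in> {0..n}"
      hence "(- 1 :: complex) ^ n = (- 1) ^ i * (- 1) ^ (n - i)" by (simp add: power_add[symmetric])
      thus "(- 1) ^ Suc n * (of_nat (n choose i) * (- (deriv ^^ i) A 2) * (deriv ^^ (n - i)) Q 2) =
          of_nat (n choose i) * ((- 1) ^ i * (deriv ^^ i) A 2) * q (n - i)"
        by (simp add: q_def mult_ac)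
    qed
    finally show ?thesis .
  qed
  have qn: "q n \<in> \<real>\<^sub>\<ge>\<^sub>0" for n
  proof (induction n rule: less_induct)
    case (less n)
    show ?case
    proof (cases n)
      case 0 thus ?thesis by (simp add: q_def Q2)
    next
      case (Suc m)
      show ?thesis unfolding Suc rec
        by (intro sum_nonneg_Reals nonneg_Reals_mult_I mono less nonneg_Reals_of_nat_I) (use Suc in auto)
    qed
  qed
  \<comment> \<open>The Taylor series at 2 converges on this ball, which reaches down to 1/2, the
    edge of the half plane.\<close>
  have "ball 2 (3/2) \<subseteq> {s. Re s > 1/2}"
  proof
    fix s :: complex assume "s \<in> ball 2 (3/2)"
    thus "s \<in> {s. Re s > 1/2}" using abs_Re_le_cmod[of "2 - s"] by (simp add: dist_norm)
  qed
  hence Qb: "Q holomorphic_on ball 2 (3/2)" using Q holomorphic_on_subset by blast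
  have "of_real x \<in> ball (2::complex) (3/2)"
  proof -
    have "dist (2::complex) (of_real x) = \<bar>2 - x\<bar>" using dist_of_real[of 2 x] by (simp add: dist_real_def)
    thus ?thesis using x by simp
  qed
  from holomorphic_power_series[OF Qb this]
  have "(\<lambda>n. Re ((deriv ^^ n) Q 2 / fact n * (of_real x - 2) ^ n)) sums Re (Q (of_real x))" by (rule sums_Re)
  moreover have eq: "(deriv ^^ n) Q 2 / fact n * (of_real x - 2) ^ n = q n * of_real ((2 - x) ^ n / fact n)" for n
  proof -
    have "(of_real x - 2 :: complex) ^ n = ((- 1) * of_real (2 - x)) ^ n" by simp
    also have "\<dots> = (- 1) ^ n * of_real (2 - x) ^ n" by (rule power_mult_distrib)
    finally show ?thesis by (simp add: q_def mult_ac)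
  qed
  ultimately have s: "(\<lambda>n. Re (q n * of_real ((2 - x) ^ n / fact n))) sums Re (Q (of_real x))" by simp
  have nn: "Re (q n * of_real ((2 - x) ^ n / fact n)) \<ge> 0" for n
  proof -
    have "q n * of_real ((2 - x) ^ n / fact n) \<in> \<real>\<^sub>\<ge>\<^sub>0"
      using x by (intro nonneg_Reals_mult_I qn) (simp only: nonneg_Reals_of_real_iff, simp)
    thus ?thesis by (simp add: complex_nonneg_Reals_iff)
  qed
  have "sum (\<lambda>n. Re (q n * of_real ((2 - x) ^ n / fact n))) {0} \<le> suminf (\<lambda>n. Re (q n * of_real ((2 - x) ^ n / fact n)))"
    by (rule sum_le_suminf[OF sums_summable[OF s]]) (use nn in auto)
  thus ?thesis using sums_unique[OF s] by (simp add: q_def Q2)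
qed

context hecke
begin

text \<open>\<open>A\<close> is minus the logarithmic derivative of
  \<open>Z(s) L(s) / Z(2 s)\<close>, with \<open>Z\<close> the principal series. Since
  \<open>\<phi> p\<close> is 1 or -1 for \<open>p\<close> coprime to \<open>g\<close>, the prime
  power \<open>p ^ m\<close> has weight \<open>1 + \<phi> p\<close> for odd \<open>m\<close>. For
  even \<open>m\<close> the weight \<open>1 + 1\<close> is cancelled by the doubled argument, which
  moves \<open>p ^ m\<close> to \<open>p ^ (2 m)\<close>. Nonnegative weights make \<open>A\<close>
  completely monotone.\<close>

lemma real_log_derivative:
  assumes k0: "k = 0" and sq: "(\<lambda>a. \<phi> a * \<phi> a) = principal"
  obtains A where "A holomorphic_on {s. Re s > 1}"
    "\<And>n. (- 1) ^ n * (deriv ^^ n) A 2 \<in> \<real>\<^sub>\<ge>\<^sub>0"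
    "\<And>s. Re s > 1 \<Longrightarrow> 4 * A s = prime_power_series principal s + prime_power_series psi s - 2 * prime_power_series principal (2 * s)"
proof -
  have psi: "psi a = \<phi> a" for a unfolding psi_def by (simp add: k0)
  have sqa: "\<phi> a * \<phi> a = principal a" for a using sq by (rule fun_cong)
  have pm1: "\<phi> a = 1 \<or> \<phi> a = - 1" if "coprime a g" for a
    using sqa[of a] that by (simp add: principal_def square_eq_1_iff)
  define c where "c = (\<lambda>(p, m :: nat). if coprime p g \<and> odd m then 1 + Re (\<phi> p) else 0 :: real)"
  have c: "0 \<le> c z" "c z \<le> 2" for z
  proof -
    obtain p m where z: "z = (p, m)" by (cases z)
    show "0 \<le> c z" "c z \<le> 2" using pm1[of p] by (auto simp: c_def z)
  qed
  define C where "C = (\<lambda>(p, m). ln_norm p * c (p, m) / 4)"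
  define b where "b = (\<lambda>(p :: gauss_int, m :: nat). p ^ m)"
  define A where "A s = (\<Sum>\<^sub>\<infinity>z\<in>prime_powers. of_real (C z) * npow (b z) s)" for s
  have C0: "C z \<ge> 0" for z using c(1)[of z] ln_norm_nonneg by (cases z) (auto simp: C_def)
  have dom: "\<exists>d>0. \<exists>M. cball z d \<subseteq> {s. Re s > 1} \<and> M summable_on prime_powers \<and> (\<forall>i\<in>prime_powers. \<forall>s\<in>cball z d. norm (of_real (C i) * npow (b i) s) \<le> M i)"
    if "z \<in> {s. Re s > 1}" for z
  proof (rule half_plane_dom[where M = "\<lambda>x (p, m). ln_norm p * real (gnorm (p ^ m)) powr (- x)", OF _ _ that])
    show "(\<lambda>(p, m). ln_norm p * real (gnorm (p ^ m)) powr (- x)) summable_on prime_powers" if "x > 1" for x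
      by (rule summable_Pweight[OF that])
    fix i :: "gauss_int \<times> nat" and s x assume x: "(1::real) < x" "x \<le> Re s"
    obtain p m where i: "i = (p, m)" by (cases i)
    have "C i \<le> ln_norm p" using mult_left_mono[OF c(2)[of "(p, m)"] ln_norm_nonneg[of p]] ln_norm_nonneg[of p] by (simp add: C_def i)
    hence "\<bar>C i\<bar> * norm (npow (b i) s) \<le> ln_norm p * real (gnorm (p ^ m)) powr (- x)"
      using norm_npow_mono[OF x(2), of "p ^ m"] C0[of i] ln_norm_nonneg by (intro mult_mono) (auto simp: b_def i)
    thus "norm (of_real (C i) * npow (b i) s) \<le> (case i of (p, m) \<Rightarrow> ln_norm p * real (gnorm (p ^ m)) powr (- x))"
      by (simp add: norm_mult i)
  qed
  have hol: "A holomorphic_on {s. Re s > 1}"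
    unfolding A_def[abs_def] by (rule holomorphic_infsum[OF open_Re_gt]) (use dom in \<open>auto intro!: holomorphic_intros\<close>)
  have mono: "(- 1) ^ n * (deriv ^^ n) A 2 \<in> \<real>\<^sub>\<ge>\<^sub>0" for n
  proof -
    have "((\<lambda>z. (deriv ^^ n) (\<lambda>s. of_real (C z) * npow (b z) s) 2) has_sum (deriv ^^ n) A 2) prime_powers"
      unfolding A_def[abs_def] by (rule has_sum_higher_deriv[OF open_Re_gt[of 1]]) (use dom in \<open>auto intro!: holomorphic_intros\<close>)
    hence hs: "((\<lambda>z. (- 1) ^ n * (of_real (C z) * (- of_real (ln_norm (b z))) ^ n * npow (b z) 2)) has_sum (- 1) ^ n * (deriv ^^ n) A 2) prime_powers"
      unfolding higher_deriv_npow by (rule has_sum_cmult_right)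
    have eqn: "(- 1) ^ n * (of_real (C z) * (- of_real (ln_norm (b z))) ^ n * npow (b z) 2)
       = of_real (C z * ln_norm (b z) ^ n * real (gnorm (b z)) powr (- 2))" for z
    proof -
      have "npow (b z) 2 = of_real (real (gnorm (b z)) powr (- 2))"
        using powr_of_real[of "real (gnorm (b z))" "- 2"] by (simp add: npow_def)
      moreover have "(- 1 :: complex) ^ n * (- of_real (ln_norm (b z))) ^ n = of_real (ln_norm (b z) ^ n)"
        by (simp flip: power_mult_distrib)
      ultimately show ?thesis by (simp add: mult_ac)
    qed
    have hs': "((\<lambda>z. complex_of_real (C z * ln_norm (b z) ^ n * real (gnorm (b z)) powr (- 2))) has_sum (- 1) ^ n * (deriv ^^ n) A 2) prime_powers"
      using hs unfolding eqn .
    have "Re ((- 1) ^ n * (deriv ^^ n) A 2) \<ge> 0"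
      by (rule has_sum_nonneg[OF has_sum_Re[OF hs']]) (use C0 ln_norm_nonneg in auto)
    moreover have "((\<lambda>_. 0) has_sum Im ((- 1) ^ n * (deriv ^^ n) A 2)) prime_powers"
      using has_sum_Im[OF hs'] by simp
    hence "Im ((- 1) ^ n * (deriv ^^ n) A 2) = 0" using has_sum_unique has_sum_0_simp by blast
    ultimately show ?thesis by (simp add: complex_nonneg_Reals_iff)
  qed
  have id: "4 * A s = prime_power_series principal s + prime_power_series psi s - 2 * prime_power_series principal (2 * s)" if s: "Re s > 1" for s
  proof -
    have prin1: "norm (principal a) \<le> 1" for a by (simp add: principal_def)
    have h1: "(prime_power_term principal s has_sum prime_power_series principal s) prime_powers" by (rule prime_power_series_has_sum[OF prin1 s])
    have h2: "(prime_power_term psi s has_sum prime_power_series psi s) prime_powers" by (rule prime_power_series_has_sum[OF le1 s])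
    have h3: "(prime_power_term principal (2 * s) has_sum prime_power_series principal (2 * s)) prime_powers" by (rule prime_power_series_has_sum[OF prin1]) (use s in simp)
    define G where "G = {z \<in> prime_powers. even (snd z)}"
    have bij: "bij_betw (\<lambda>(p, m). (p, 2 * m)) prime_powers G"
      by (rule bij_betwI[of _ _ _ "\<lambda>(p, m). (p, m div 2)"]) (auto simp: G_def prime_powers_def elim!: evenE)
    have t: "prime_power_term principal (2 * s) (p, m) = prime_power_term principal s (p, 2 * m)" for p m
    proof -
      have "npow (p ^ m) (2 * s) = npow (p ^ (2 * m)) s"
      proof -
        have "npow (p ^ m) (2 * s) = npow (p ^ m) s * npow (p ^ m) s" by (simp add: npow_add[symmetric])
        also have "\<dots> = npow (p ^ (2 * m)) s" unfolding npow_mult[symmetric] power_add[symmetric] mult_2 ..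
        finally show ?thesis .
      qed
      moreover have "principal (p ^ m) = principal (p ^ (2 * m))"
        unfolding mult_2 power_add by (simp add: principal_def coprime_mult_iff)
      ultimately show ?thesis by (simp add: prime_power_term_def)
    qed
    have "(prime_power_term principal s has_sum prime_power_series principal (2 * s)) G"
      using has_sum_reindex_bij_betw[OF bij, of "prime_power_term principal s"] h3 by (simp add: case_prod_unfold t[symmetric])
    hence h4: "((\<lambda>z. if even (snd z) then prime_power_term principal s z else 0) has_sum prime_power_series principal (2 * s)) prime_powers"
      by (rule has_sum_cong_neutral[THEN iffD1, rotated -1]) (auto simp: G_def)
    have "((\<lambda>z. prime_power_term principal s z + prime_power_term psi s z - 2 * (if even (snd z) then prime_power_term principal s z else 0)) has_sum
        (prime_power_series principal s + prime_power_series psi s - 2 * prime_power_series principal (2 * s))) prime_powers"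
      by (intro has_sum_diff has_sum_add h1 h2 has_sum_cmult_right h4)
    moreover have "prime_power_term principal s z + prime_power_term psi s z - 2 * (if even (snd z) then prime_power_term principal s z else 0)
        = 4 * (of_real (C z) * npow (b z) s)" if "z \<in> prime_powers" for z
    proof -
      obtain p m where z: "z = (p, m)" and m: "m \<ge> 1" using \<open>z \<in> prime_powers\<close> by (auto simp: prime_powers_def)
      have phm: "\<phi> (p ^ m) = \<phi> p ^ m" by (rule gchar_power[OF phi])
      have "principal (p ^ m) = principal p ^ m" by (rule gchar_power[OF gchar_principal])
      also have "\<dots> = (if coprime p g then 1 else 0)" using m by (simp add: principal_def)
      finally have prm: "principal (p ^ m) = (if coprime p g then 1 else 0)" .
      have "principal (p ^ m) + psi (p ^ m) - 2 * (if even m then principal (p ^ m) else 0) = of_real (c z)"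
      proof (cases "coprime p g")
        case False
        hence "\<phi> p = 0" using gchar_nz[OF phi, of p] by blast
        thus ?thesis using False m by (simp add: psi phm prm z c_def)
      next
        case True
        show ?thesis
        proof (cases "even m")
          case even: True
          hence "\<phi> p ^ m = 1" using pm1[OF True] by (auto simp: power_even_eq)
          thus ?thesis using True even by (simp add: psi phm prm z c_def)
        next
          case odd: False
          hence "\<phi> p ^ m = \<phi> p" using pm1[OF True] by auto
          thus ?thesis using True odd pm1[OF True] by (auto simp: psi phm prm z c_def)
        qed
      qed
      hence "of_real (ln_norm p) * (principal (p ^ m) + psi (p ^ m) - 2 * (if even m then principal (p ^ m) else 0)) * npow (p ^ m) s
         = of_real (ln_norm p) * of_real (c z) * npow (p ^ m) s" by (simp only:)
      moreover have "prime_power_term principal s z + prime_power_term psi s z - 2 * (if even (snd z) then prime_power_term principal s z else 0)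
         = of_real (ln_norm p) * (principal (p ^ m) + psi (p ^ m) - 2 * (if even m then principal (p ^ m) else 0)) * npow (p ^ m) s"
        by (simp add: prime_power_term_def z algebra_simps)
      ultimately show ?thesis by (simp add: C_def z b_def)
    qed
    ultimately have "((\<lambda>z. 4 * (of_real (C z) * npow (b z) s)) has_sum
        (prime_power_series principal s + prime_power_series psi s - 2 * prime_power_series principal (2 * s))) prime_powers"
      using has_sum_cong[of prime_powers "\<lambda>z. prime_power_term principal s z + prime_power_term psi s z - 2 * (if even (snd z) then prime_power_term principal s z else 0)"
          "\<lambda>z. 4 * (of_real (C z) * npow (b z) s)"] by blast
    hence "infsum (\<lambda>z. 4 * (of_real (C z) * npow (b z) s)) prime_powers = prime_power_series principal s + prime_power_series psi s - 2 * prime_power_series principal (2 * s)"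
      by (rule infsumI)
    thus ?thesis unfolding A_def by (simp add: infsum_cmult_right')
  qed
  show ?thesis by (rule that[OF hol mono id])
qed

text \<open>A zero at 1 would make \<open>Q(s) = Z(s) L(s) / Z(2 s)\<close>, where \<open>Z\<close> is the series of the principal character, holomorphic for
  \<open>Re s > 1/2\<close>, with \<open>Q(x)\<close> tending to 0 as \<open>x\<close> decreases to \<open>1/2\<close> because of the pole of \<open>Z\<close>; but \<open>-Q'/Q\<close> has
  nonnegative coefficients.\<close>

lemma real_nonvanishing:
  assumes k0: "k = 0" and sq: "(\<lambda>a. \<phi> a * \<phi> a) = principal" and nt: "\<not> trivial" and W: "is_continuation W"
  shows "W 1 \<noteq> 0"
proof
  assume W1: "W 1 = 0"
  obtain V where V: "V holomorphic_on {s. Re s > 0}" "\<And>s. Re s > 1 \<Longrightarrow> V s = (s - 1) * L_series principal s" "V 1 \<noteq> 0"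
    using continuation_principal by blast
  obtain A where A: "A holomorphic_on {s. Re s > 1}" "\<And>n. (- 1) ^ n * (deriv ^^ n) A 2 \<in> \<real>\<^sub>\<ge>\<^sub>0"
    "\<And>s. Re s > 1 \<Longrightarrow> 4 * A s = prime_power_series principal s + prime_power_series psi s - 2 * prime_power_series principal (2 * s)"
    using real_log_derivative[OF k0 sq] by blast
  interpret P: hecke g principal 0 by (rule hecke_principal)
  define L0 where "L0 = L_series principal"
  have L0hol: "L0 holomorphic_on {s. Re s > 1}"
    using L_series_holomorphic[of principal, OF P.le1[unfolded psi_principal]] by (simp add: L0_def)
  have L0nz: "L0 s \<noteq> 0" if "Re s > 1" for s using P.L_series_nonzero[OF that] by (simp add: L0_def psi_principal)
  have L0P: "prime_power_series principal s = - 4 * (deriv L0 s / L0 s)" if "Re s > 1" for s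
    using P.prime_power_series_eq[OF that] by (simp add: L0_def psi_principal)
  \<comment> \<open>The supposed zero of \<open>W\<close> absorbs the pole of the principal series:
    \<open>V * U\<close> continues \<open>L0 * L_series psi\<close> to \<open>Re s > 0\<close>,
    hence past 1/2.\<close>
  define U where "U s = (if s = 1 then deriv W 1 else W s / (s - 1))" for s
  have U: "U holomorphic_on {s. Re s > 0}"
    by (rule pole_theorem_open_0[of W _ 1]) (auto simp: U_def W1 is_continuationD(1)[OF W] open_Re_gt)
  have VU: "V s * U s = L0 s * L_series psi s" if "Re s > 1" for s
    using V(2)[OF that] is_continuationD(2)[OF W that] nt that by (auto simp: U_def L0_def pole_factor_def)
  define E where "E s = L0 (2 * s)" for s
  have E: "E holomorphic_on {s. Re s > 1/2}"
  proof -
    have "(L0 \<circ> (\<lambda>s. 2 * s)) holomorphic_on {s. Re s > 1/2}"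
      by (rule holomorphic_on_compose_gen[OF _ L0hol]) (auto intro!: holomorphic_intros)
    thus ?thesis by (simp add: E_def[abs_def] o_def)
  qed
  have Enz: "E s \<noteq> 0" if "Re s > 1/2" for s unfolding E_def by (rule L0nz) (use that in simp)
  define c where "c = E 2 / (V 2 * U 2)"
  have "V 2 * U 2 \<noteq> 0" using VU[of 2] L0nz[of 2] L_series_nonzero[of 2] by simp
  hence c0: "c \<noteq> 0" using Enz[of 2] by (simp add: c_def)
  define Q where "Q s = c * (V s * U s) / E s" for s
  have "Q holomorphic_on {s. Re s > 1/2}"
    unfolding Q_def using V(1) U E Enz by (intro holomorphic_intros) (auto elim: holomorphic_on_subset)
  moreover have "Q 2 = 1" using \<open>V 2 * U 2 \<noteq> 0\<close> Enz[of 2] by (simp add: Q_def c_def)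
  moreover have "deriv Q s = - A s * Q s" if s: "Re s > 1" for s
  proof -
    have s2: "Re (2 * s) > 1" using s by simp
    have d0: "(L0 has_field_derivative deriv L0 s) (at s)"
      by (rule holomorphic_derivI[OF L0hol open_Re_gt]) (use s in simp)
    have d1: "(L_series psi has_field_derivative deriv (L_series psi) s) (at s)"
      by (rule holomorphic_derivI[OF L_series_holomorphic[of psi, OF le1] open_Re_gt]) (use s in simp)
    have "(L0 has_field_derivative deriv L0 (2 * s)) (at (2 * s))"
      by (rule holomorphic_derivI[OF L0hol open_Re_gt]) (use s2 in simp)
    moreover have "((\<lambda>s. 2 * s) has_field_derivative 2) (at s)" by (auto intro!: derivative_eq_intros)
    ultimately have d2: "(E has_field_derivative deriv L0 (2 * s) * 2) (at s)"
      unfolding E_def by (rule DERIV_chain2)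
    have nz: "L0 s \<noteq> 0" "L_series psi s \<noteq> 0" "E s \<noteq> 0" using L0nz L_series_nonzero Enz s by auto
    have "((\<lambda>s. c * (L0 s * L_series psi s) / E s) has_field_derivative
        ((c * (deriv L0 s * L_series psi s + deriv (L_series psi) s * L0 s)) * E s - c * (L0 s * L_series psi s) * (deriv L0 (2 * s) * 2)) / (E s * E s)) (at s)"
      by (intro DERIV_divide DERIV_cmult DERIV_mult d0 d1 d2 nz)
    hence "(Q has_field_derivative
        ((c * (deriv L0 s * L_series psi s + deriv (L_series psi) s * L0 s)) * E s - c * (L0 s * L_series psi s) * (deriv L0 (2 * s) * 2)) / (E s * E s)) (at s)"
      by (rule has_field_derivative_transform_within_open[where S = "{s. Re s > 1}"])
         (use s VU open_Re_gt in \<open>auto simp: Q_def\<close>)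
    hence "deriv Q s = ((c * (deriv L0 s * L_series psi s + deriv (L_series psi) s * L0 s)) * E s - c * (L0 s * L_series psi s) * (deriv L0 (2 * s) * 2)) / (E s * E s)"
      by (rule DERIV_imp_deriv)
    also have "\<dots> = (c * (L0 s * L_series psi s) / E s) * (deriv L0 s / L0 s + deriv (L_series psi) s / L_series psi s - 2 * (deriv L0 (2 * s) / E s))"
      using nz by (simp add: field_simps)
    also have "c * (L0 s * L_series psi s) / E s = Q s" using VU[OF s] by (simp add: Q_def)
    also have "deriv L0 s / L0 s + deriv (L_series psi) s / L_series psi s - 2 * (deriv L0 (2 * s) / E s) = - A s"
    proof -
      have "4 * A s = - 4 * (deriv L0 s / L0 s) + - 4 * (deriv (L_series psi) s / L_series psi s) - 2 * (- 4 * (deriv L0 (2 * s) / E s))"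
        using A(3)[OF s] L0P[OF s] L0P[OF s2] prime_power_series_eq[OF s] by (simp only: E_def)
      moreover have "a + b - 2 * d = - A0" if "4 * A0 = - 4 * a + - 4 * b - 2 * (- 4 * d)" for a b d A0 :: complex
      proof -
        have "- A0 = - (4 * A0) / 4" by simp
        also have "\<dots> = a + b - 2 * d" unfolding that by (simp add: field_simps)
        finally show ?thesis ..
      qed
      ultimately show ?thesis by blast
    qed
    finally show ?thesis by (simp only: mult.commute)
  qed
  ultimately have lower: "Re (Q (of_real x)) \<ge> 1" if "1/2 < x" "x \<le> 2" for x
    using completely_monotone_lower_bound[of Q A x] A(1,2) that by blast
  have "(\<lambda>s. V s * U s) holomorphic_on {s. Re s > 0}" by (intro holomorphic_intros V U)
  hence limD: "((\<lambda>x. V (of_real x) * U (of_real x)) \<longlongrightarrow> V (of_real (1/2)) * U (of_real (1/2))) (at_right (1/2))"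
    by (rule tendsto_at_right_complex[OF _ open_Re_gt]) simp
  define K where "K = norm (c * (V (of_real (1/2)) * U (of_real (1/2)))) + 1"
  have "\<forall>\<^sub>F x in at_right (1/2). norm (c * (V (of_real x) * U (of_real x))) < K"
    by (rule order_tendstoD(2)[OF tendsto_norm[OF tendsto_mult_left[OF limD]]]) (simp add: K_def)
  moreover have "\<forall>\<^sub>F x in at_right (1/2). norm (E (of_real x)) > K"
  proof -
    obtain b where b: "b > 1" "\<And>y. 1 < y \<Longrightarrow> y < b \<Longrightarrow> Re (L_series principal (of_real y)) > K"
      using principal_unbounded[of K] unfolding eventually_at_right_field by blast
    have "norm (E (of_real x)) > K" if "1/2 < x" "x < b/2" for x
      using b(2)[of "2 * x"] that complex_Re_le_cmod[of "L_series principal (of_real (2 * x))"]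
      by (simp add: E_def L0_def)
    thus ?thesis unfolding eventually_at_right_field using b(1) by (intro exI[of _ "b/2"]) auto
  qed
  moreover have "\<forall>\<^sub>F x in at_right (1/2::real). x < 2"
    by (auto simp: eventually_at_right_field intro!: exI[of _ 2])
  ultimately have "\<forall>\<^sub>F x in at_right (1/2::real). False"
    using eventually_at_right_gt[of "1/2"]
  proof eventually_elim
    case (elim x)
    have "1 \<le> norm (Q (of_real x))" using lower[of x] elim complex_Re_le_cmod order_trans by force
    hence "norm (E (of_real x)) \<le> norm (c * (V (of_real x) * U (of_real x)))"
      using Enz[of "of_real x"] elim by (simp add: Q_def norm_divide)
    thus False using elim by linarith
  qed
  thus False by simp
qed

lemma continuation_nonzero:
  assumes W: "is_continuation W" and s: "Re s \<ge> 1"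
  shows "W s \<noteq> 0"
proof (cases "Re s = 1")
  case False
  thus ?thesis using log_derivative_cont(1)[OF W] s by simp
next
  case True
  have s_eq: "s = 1 + \<i> * of_real (Im s)" using True by (simp add: complex_eq_iff)
  show ?thesis
  proof (cases "(\<lambda>a. \<phi> a * \<phi> a) = principal \<and> k = 0 \<and> Im s = 0")
    case False
    show ?thesis by (subst s_eq) (rule nonvanishing_complex[OF W False])
  next
    case c: True
    hence "s = 1" using s_eq by simp
    thus ?thesis using real_nonvanishing[OF _ _ _ W] is_continuationD(3)[OF W] c by (cases trivial) auto
  qed
qed

text \<open>Nonvanishing of \<open>W\<close> on the closed half plane makes \<open>- 4 W'/W\<close>
  continuous up to the boundary; the pole comes from \<open>pole_factor\<close> alone.\<close>

lemma prime_power_series_extension: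
  obtains G where "continuous_on {s. Re s \<ge> 1} G" "\<And>s. Re s > 1 \<Longrightarrow> prime_power_series psi s = G s + (if trivial then 4 / (s - 1) else 0)"
proof -
  obtain W where W: "is_continuation W" using exists_continuation by blast
  have sub: "{s. Re s \<ge> 1} \<subseteq> {s. Re s > 0}" by auto
  have "deriv W holomorphic_on {s. Re s > 0}" by (rule holomorphic_deriv[OF is_continuationD(1)[OF W] open_Re_gt])
  hence "continuous_on {s. Re s \<ge> 1} (deriv W)" "continuous_on {s. Re s \<ge> 1} W"
    using is_continuationD(1)[OF W] sub by (blast intro: holomorphic_on_imp_continuous_on continuous_on_subset)+
  hence "continuous_on {s. Re s \<ge> 1} (\<lambda>s. - 4 * (deriv W s / W s))"
    using continuation_nonzero[OF W] by (intro continuous_intros) auto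
  moreover have "prime_power_series psi s = - 4 * (deriv W s / W s) + (if trivial then 4 / (s - 1) else 0)" if "Re s > 1" for s
    unfolding log_derivative_cont(2)[OF W that] by (simp add: algebra_simps)
  ultimately show ?thesis using that by blast
qed

end

lemma infsum_finite_sum:
  fixes f :: "'i \<Rightarrow> 'a \<Rightarrow> complex"
  assumes "finite F" "\<And>i. i \<in> F \<Longrightarrow> f i summable_on A"
  shows "(\<Sum>\<^sub>\<infinity>x\<in>A. \<Sum>i\<in>F. f i x) = (\<Sum>i\<in>F. infsum (f i) A)"
proof -
  have "((\<lambda>x. \<Sum>i\<in>F. f i x) has_sum (\<Sum>i\<in>F. infsum (f i) A)) A"
    using assms by (induction F rule: finite_induct) (auto intro!: has_sum_add)
  thus ?thesis by (rule infsumI)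
qed

section \<open>Primes in a residue class\<close>

definition gauss_primes :: "gauss_int set" where "gauss_primes = {p. prime_elem p}"

definition prime_term :: "(gauss_int \<Rightarrow> complex) \<Rightarrow> complex \<Rightarrow> gauss_int \<Rightarrow> complex" where
  "prime_term f s p = of_real (ln_norm p) * (f p * npow p s)"

lemma summable_prime_weight:
  assumes "x > 1"
  shows "(\<lambda>p. ln_norm p * real (gnorm p) powr (- x)) summable_on gauss_primes"
proof -
  have "(\<lambda>(p, m). ln_norm p * real (gnorm (p ^ m)) powr (- x)) summable_on ((\<lambda>p. (p, 1)) ` gauss_primes)"
    by (rule summable_on_subset_banach[OF summable_Pweight[OF assms]]) (auto simp: prime_powers_def gauss_primes_def)
  thus ?thesis by (subst (asm) summable_on_reindex) (auto simp: inj_on_def o_def)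
qed

lemma norm_prime_term: "norm (f p) \<le> 1 \<Longrightarrow> x \<le> Re s \<Longrightarrow> norm (prime_term f s p) \<le> ln_norm p * real (gnorm p) powr (- x)"
proof -
  assume "norm (f p) \<le> 1" "x \<le> Re s"
  hence "norm (f p) * norm (npow p s) \<le> 1 * real (gnorm p) powr (- x)"
    by (intro mult_mono norm_npow_mono) auto
  thus ?thesis using ln_norm_nonneg[of p] by (simp add: prime_term_def norm_mult mult_left_mono)
qed

lemma prime_term_summable:
  assumes "\<And>p. norm (f p) \<le> 1" "Re s > 1" "A \<subseteq> gauss_primes"
  shows "prime_term f s summable_on A"
proof -
  have "(\<lambda>p. norm (prime_term f s p)) summable_on gauss_primes"
    by (rule Infinite_Sum.abs_summable_on_comparison_test'[OF summable_prime_weight[OF assms(2)]])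
       (use norm_prime_term assms(1) in auto)
  hence "prime_term f s summable_on gauss_primes" by (rule abs_summable_summable)
  thus ?thesis using assms(3) by (rule summable_on_subset_banach)
qed

text \<open>Proper prime powers converge absolutely even at real part 1: for
  \<open>m \<ge> 2\<close>, \<open>N(p)^(-m) \<le> N(p)^(-3/2) * 2^(3/2 - m)\<close>. The exponent
  3/2 lies above 1, which sums over primes, and below 2, which leaves a geometric series in
  \<open>m\<close>.\<close>

lemma summable_higher_powers:
  "(\<lambda>(p, m). ln_norm p * real (gnorm (p ^ m)) powr (- 1)) summable_on {z \<in> prime_powers. snd z \<ge> 2}"
proof -
  define h where "h p = ln_norm p * real (gnorm p) powr (- (3/2))" for p
  have h: "h summable_on gauss_primes" unfolding h_def by (rule summable_prime_weight) simp
  have geo: "((\<lambda>m::nat. (1/2 :: real) ^ m) has_sum 1) {1..}"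
    using has_sum_geometric_from_1[of "1/2 :: real"] by simp
  have "(\<lambda>(p, m). h p * (1/2) ^ m) summable_on (Sigma gauss_primes (\<lambda>_. {1..}))"
  proof (rule summable_on_SigmaI)
    show "((\<lambda>m. case (p, m) of (p, m) \<Rightarrow> h p * (1/2) ^ m) has_sum h p * 1) {1..}" for p
      using has_sum_cmult_right[OF geo, of "h p"] by simp
    show "(\<lambda>p. h p * 1) summable_on gauss_primes" by (rule summable_on_cmult_left[OF h])
  qed (auto simp: h_def ln_norm_nonneg)
  hence "(\<lambda>z. 4 * (case z of (p, m) \<Rightarrow> h p * (1/2) ^ m)) summable_on (Sigma gauss_primes (\<lambda>_. {1..}))"
    by (rule summable_on_cmult_right)
  hence 1: "(\<lambda>z. 4 * (case z of (p, m) \<Rightarrow> h p * (1/2) ^ m)) summable_on {z \<in> prime_powers. snd z \<ge> 2}"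
    by (rule summable_on_subset_banach) (auto simp: prime_powers_def gauss_primes_def)
  show ?thesis
  proof (rule summable_on_comparison_test[OF 1])
    fix z assume "z \<in> {z \<in> prime_powers. snd z \<ge> 2}"
    then obtain p m where z: "z = (p, m)" "prime_elem p" "m \<ge> 2" by (auto simp: prime_powers_def)
    have N: "real (gnorm p) \<ge> 2" using gnorm_prime_ge[OF z(2)] by simp
    have "real (gnorm (p ^ m)) powr (- 1) = real (gnorm p) powr (- real m)"
      using N powr_realpow[of "real (gnorm p)" m] by (simp add: powr_minus del: gnorm_pos_iff of_nat_0_less_iff)
    also have "\<dots> = real (gnorm p) powr (- (3/2)) * real (gnorm p) powr (- (real m - 3/2))"
      by (simp add: powr_add[symmetric])
    also have "\<dots> \<le> real (gnorm p) powr (- (3/2)) * 2 powr (- (real m - 3/2))"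
      using N z(3) by (intro mult_left_mono powr_mono2') auto
    also have "2 powr (- (real m - 3/2)) = 2 powr (3/2) * (1/2 :: real) ^ m"
    proof -
      have "2 powr (- real m) = (1/2 :: real) ^ m"
        by (simp add: powr_minus powr_realpow power_one_over inverse_eq_divide)
      moreover have "- (real m - 3/2) = 3/2 + - real m" by simp
      ultimately show ?thesis by (simp only: powr_add)
    qed
    also have "\<dots> \<le> 4 * (1/2) ^ m"
      using powr_mono[of "3/2" 2 "2::real"] by (intro mult_right_mono) auto
    finally have "real (gnorm (p ^ m)) powr (- 1) \<le> real (gnorm p) powr (- (3/2)) * (4 * (1/2) ^ m)"
      by (simp add: mult_left_mono)
    hence "ln_norm p * real (gnorm (p ^ m)) powr (- 1) \<le> ln_norm p * (real (gnorm p) powr (- (3/2)) * (4 * (1/2) ^ m))"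
      by (intro mult_left_mono ln_norm_nonneg)
    thus "(case z of (p, m) \<Rightarrow> ln_norm p * real (gnorm (p ^ m)) powr (- 1)) \<le> 4 * (case z of (p, m) \<Rightarrow> h p * (1/2) ^ m)"
      by (simp add: z h_def mult_ac)
    show "0 \<le> (case z of (p, m) \<Rightarrow> ln_norm p * real (gnorm (p ^ m)) powr (- 1))"
      using ln_norm_nonneg by (simp add: z)
  qed
qed

context hecke
begin

text \<open>Proper prime powers contribute a function continuous up to \<open>Re s = 1\<close>, so
  the primes alone carry the pole.\<close>

lemma prime_sum_extension:
  obtains G where "continuous_on {s. Re s \<ge> 1} G"
    "\<And>s. Re s > 1 \<Longrightarrow> infsum (prime_term psi s) gauss_primes = G s + (if trivial then 4 / (s - 1) else 0)"
proof -
  obtain G where G: "continuous_on {s. Re s \<ge> 1} G"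
    "\<And>s. Re s > 1 \<Longrightarrow> prime_power_series psi s = G s + (if trivial then 4 / (s - 1) else 0)"
    using prime_power_series_extension by blast
  define X where "X = {z \<in> prime_powers. snd z \<ge> 2}"
  define H where "H s = infsum (prime_power_term psi s) X" for s
  have ul: "uniform_limit {s. Re s \<ge> 1} (\<lambda>Y s. \<Sum>z\<in>Y. prime_power_term psi s z) (\<lambda>s. infsum (\<lambda>z. prime_power_term psi s z) X) (finite_subsets_at_top X)"
  proof (rule Weierstrass_m_test_general)
    show "norm (prime_power_term psi s z) \<le> (case z of (p, m) \<Rightarrow> ln_norm p * real (gnorm (p ^ m)) powr (- 1))"
      if "s \<in> {s. Re s \<ge> 1}" for z s
      using norm_prime_power_term[of psi 1 s, OF le1] that by (cases z) auto
    show "(\<lambda>(p, m). ln_norm p * real (gnorm (p ^ m)) powr (- 1)) summable_on X"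
      unfolding X_def by (rule summable_higher_powers)
  qed
  have "continuous_on {s. Re s \<ge> 1} H"
    unfolding H_def
  proof (rule uniform_limit_theorem[OF _ ul])
    show "\<forall>\<^sub>F Y in finite_subsets_at_top X. continuous_on {s. Re s \<ge> 1} (\<lambda>s. \<Sum>z\<in>Y. prime_power_term psi s z)"
      by (intro always_eventually allI holomorphic_on_imp_continuous_on holomorphic_intros prime_power_term_holomorphic[of psi] le1)
  qed simp
  hence "continuous_on {s. Re s \<ge> 1} (\<lambda>s. G s - H s)" by (intro continuous_intros G(1))
  moreover have "infsum (prime_term psi s) gauss_primes = G s - H s + (if trivial then 4 / (s - 1) else 0)" if s: "Re s > 1" for s
  proof -
    have sm: "prime_power_term psi s summable_on prime_powers" by (rule prime_power_series_summable[OF le1 s])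
    have split: "prime_powers = (\<lambda>p. (p, 1)) ` gauss_primes \<union> X" by (auto simp: prime_powers_def gauss_primes_def X_def)
    have "prime_power_series psi s = infsum (prime_power_term psi s) ((\<lambda>p. (p, 1)) ` gauss_primes) + infsum (prime_power_term psi s) X"
      unfolding prime_power_series_def by (subst split, rule infsum_Un_disjoint)
        (auto simp: X_def intro: summable_on_subset_banach[OF sm] simp: prime_powers_def gauss_primes_def)
    also have "infsum (prime_power_term psi s) ((\<lambda>p. (p, 1)) ` gauss_primes) = infsum (prime_term psi s) gauss_primes"
      by (subst infsum_reindex) (auto simp: inj_on_def o_def prime_power_term_def prime_term_def intro!: infsum_cong)
    finally show ?thesis using G(2)[OF s] by (simp add: H_def algebra_simps)
  qed
  ultimately show ?thesis using that by blast
qed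

end

section \<open>From characters to a residue class\<close>

context gauss_mod
begin

definition angle_char :: "(gauss_int \<Rightarrow> complex) \<Rightarrow> int \<Rightarrow> gauss_int \<Rightarrow> complex" where
  "angle_char \<phi> k a = \<phi> a * sgn (cg a) powi k"

lemma norm_angle_char_le: "gchar \<phi> \<Longrightarrow> norm (angle_char \<phi> k a) \<le> 1"
  using mult_mono[OF _ norm_sgn_powi_le[of "cg a" k], of "norm (\<phi> a)" 1] norm_gchar[of \<phi> a]
  by (simp add: angle_char_def norm_mult)

text \<open>If \<open>\<psi>\<close> is nontrivial on units, the primes of one class of associates cancel in the sum.\<close>

lemma angle_char_prime_sum:
  assumes phi: "gchar \<phi>"
  shows "\<exists>G. continuous_on {s. Re s \<ge> 1} G \<and>
    (\<forall>s. Re s > 1 \<longrightarrow> infsum (prime_term (angle_char \<phi> k) s) gauss_primes = G s + (if \<phi> = principal \<and> k = 0 then 4 / (s - 1) else 0))"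
proof (cases "\<forall>u. is_unit u \<longrightarrow> \<phi> u * sgn (cg u) powi k = 1")
  case True
  interpret hecke g \<phi> k by unfold_locales (use phi True in auto)
  have "angle_char \<phi> k = psi" by (simp add: angle_char_def psi_def fun_eq_iff)
  thus ?thesis using prime_sum_extension unfolding trivial_def by metis
next
  case False
  then obtain u where u: "is_unit u" "angle_char \<phi> k u \<noteq> 1" by (auto simp: angle_char_def)
  have mult: "angle_char \<phi> k (a * b) = angle_char \<phi> k a * angle_char \<phi> k b" for a b
    by (simp add: angle_char_def gchar_mult[OF phi] sgn_mult power_int_mult_distrib mult_ac)
  have np: "\<not> (\<phi> = principal \<and> k = 0)"
    using u by (auto simp: angle_char_def principal_def is_unit_left_imp_coprime)
  have z: "infsum (prime_term (angle_char \<phi> k) s) gauss_primes = 0" for s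
  proof -
    obtain w where w: "u * w = 1" using u(1) by (metis dvdE)
    have pu: "prime_elem (v * p)" if "is_unit v" "prime_elem p" for v p :: gauss_int
    proof -
      have "v \<noteq> 0" using that(1) by auto
      thus ?thesis using that by (auto simp: prime_elem_def mult_unit_dvd_iff' is_unit_mult_iff)
    qed
    have wu: "is_unit w" using w by (metis dvdI mult.commute)
    have bij: "bij_betw (\<lambda>p. u * p) gauss_primes gauss_primes"
    proof (rule bij_betwI[of _ _ _ "\<lambda>p. w * p"])
      show "(\<lambda>p. u * p) \<in> gauss_primes \<rightarrow> gauss_primes" using pu[OF u(1)] by (auto simp: gauss_primes_def)
      show "(\<lambda>p. w * p) \<in> gauss_primes \<rightarrow> gauss_primes" using pu[OF wu] by (auto simp: gauss_primes_def)
      show "w * (u * p) = p" "u * (w * p) = p" for p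
        using w by (metis mult.assoc mult.commute mult_1)+
    qed
    have t: "prime_term (angle_char \<phi> k) s (u * p) = angle_char \<phi> k u * prime_term (angle_char \<phi> k) s p" for p
      using u(1) by (simp add: prime_term_def mult npow_mult ln_norm_def is_unit_iff_gnorm npow_def mult_ac)
    have "infsum (prime_term (angle_char \<phi> k) s) gauss_primes = infsum (\<lambda>p. prime_term (angle_char \<phi> k) s (u * p)) gauss_primes"
      by (rule infsum_reindex_bij_betw[OF bij, symmetric])
    also have "\<dots> = angle_char \<phi> k u * infsum (prime_term (angle_char \<phi> k) s) gauss_primes"
      unfolding t by (rule infsum_cmult_right')
    finally show ?thesis using u(2) by (metis mult_cancel_right1)
  qed
  show ?thesis using np z by (intro exI[of _ "\<lambda>_. 0"]) auto
qed

lemma card_gchars_pos: "card {\<phi>. gchar \<phi>} > 0"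
  using gchar_principal finite_gchars by (auto simp: card_gt_0_iff)

text \<open>Orthogonality writes the sum over the class as a combination of
  \<open>angle_char\<close> sums. Only the principal character with \<open>k = 0\<close> has a pole,
  and its coefficient \<open>1 / h\<close> accounts for the residue \<open>4 / h\<close>.\<close>

lemma progression_prime_sum:
  assumes b: "coprime b g"
  shows "\<exists>G. continuous_on {s. Re s \<ge> 1} G \<and>
    (\<forall>s. Re s > 1 \<longrightarrow> infsum (prime_term (\<lambda>a. sgn (cg a) powi k) s) {p \<in> gauss_primes. p \<simeq> b}
       = G s + (if k = 0 then of_real (4 / real (card {\<phi>. gchar \<phi>})) / (s - 1) else 0))"
proof -
  define h where "h = card {\<phi>. gchar \<phi>}"
  have h0: "h > 0" unfolding h_def by (rule card_gchars_pos)
  have "\<forall>\<phi>\<in>{\<phi>. gchar \<phi>}. \<exists>G. continuous_on {s. Re s \<ge> 1} G \<and>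
    (\<forall>s. Re s > 1 \<longrightarrow> infsum (prime_term (angle_char \<phi> k) s) gauss_primes = G s + (if \<phi> = principal \<and> k = 0 then 4 / (s - 1) else 0))"
    using angle_char_prime_sum by blast
  from bchoice[OF this] obtain G where G: "\<And>\<phi>. gchar \<phi> \<Longrightarrow> continuous_on {s. Re s \<ge> 1} (G \<phi>)"
    "\<And>\<phi> s. gchar \<phi> \<Longrightarrow> Re s > 1 \<Longrightarrow> infsum (prime_term (angle_char \<phi> k) s) gauss_primes = G \<phi> s + (if \<phi> = principal \<and> k = 0 then 4 / (s - 1) else 0)"
    by blast
  define G' where "G' s = (\<Sum>\<phi> | gchar \<phi>. cnj (\<phi> b) * G \<phi> s) / of_nat h" for s
  have "continuous_on {s. Re s \<ge> 1} G'" unfolding G'_def using h0 by (intro continuous_intros G(1)) auto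
  moreover have "infsum (prime_term (\<lambda>a. sgn (cg a) powi k) s) {p \<in> gauss_primes. p \<simeq> b}
       = G' s + (if k = 0 then of_real (4 / real h) / (s - 1) else 0)" if s: "Re s > 1" for s
  proof -
    have tm: "(if p \<simeq> b then prime_term (\<lambda>a. sgn (cg a) powi k) s p else 0)
        = (\<Sum>\<phi> | gchar \<phi>. cnj (\<phi> b) / of_nat h * prime_term (angle_char \<phi> k) s p)" for p
    proof -
      have "(\<Sum>\<phi> | gchar \<phi>. cnj (\<phi> b) / of_nat h * prime_term (angle_char \<phi> k) s p)
          = (\<Sum>\<phi> | gchar \<phi>. cnj (\<phi> b) * \<phi> p) * (prime_term (\<lambda>a. sgn (cg a) powi k) s p / of_nat h)"
        unfolding sum_distrib_right by (intro sum.cong) (auto simp: prime_term_def angle_char_def mult_ac)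
      also have "\<dots> = (if p \<simeq> b then prime_term (\<lambda>a. sgn (cg a) powi k) s p else 0)"
        using gchar_orthogonality[OF b, of p] h0 by (simp add: h_def)
      finally show ?thesis ..
    qed
    have "infsum (prime_term (\<lambda>a. sgn (cg a) powi k) s) {p \<in> gauss_primes. p \<simeq> b} = infsum (\<lambda>p. if p \<simeq> b then prime_term (\<lambda>a. sgn (cg a) powi k) s p else 0) gauss_primes"
      by (rule infsum_cong_neutral) auto
    also have "\<dots> = (\<Sum>\<^sub>\<infinity>p\<in>gauss_primes. \<Sum>\<phi> | gchar \<phi>. cnj (\<phi> b) / of_nat h * prime_term (angle_char \<phi> k) s p)"
      by (simp only: tm)
    also have "\<dots> = (\<Sum>\<phi> | gchar \<phi>. \<Sum>\<^sub>\<infinity>p\<in>gauss_primes. cnj (\<phi> b) / of_nat h * prime_term (angle_char \<phi> k) s p)"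
      by (rule infsum_finite_sum[OF finite_gchars]) (intro summable_on_cmult_right prime_term_summable norm_angle_char_le s, auto)
    also have "\<dots> = (\<Sum>\<phi> | gchar \<phi>. cnj (\<phi> b) / of_nat h * (G \<phi> s + (if \<phi> = principal \<and> k = 0 then 4 / (s - 1) else 0)))"
      unfolding infsum_cmult_right' by (intro sum.cong refl) (simp add: G(2)[OF _ s])
    also have "\<dots> = G' s + (\<Sum>\<phi> | gchar \<phi>. cnj (\<phi> b) / of_nat h * (if \<phi> = principal \<and> k = 0 then 4 / (s - 1) else 0))"
      by (simp add: distrib_left sum.distrib G'_def sum_divide_distrib)
    also have "(\<Sum>\<phi> | gchar \<phi>. cnj (\<phi> b) / of_nat h * (if \<phi> = principal \<and> k = 0 then 4 / (s - 1) else 0))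
        = (\<Sum>\<phi> | gchar \<phi>. if \<phi> = principal then (if k = 0 then 4 / of_nat h / (s - 1) else 0) else 0)"
      using b by (intro sum.cong) (auto simp: principal_def)
    also have "\<dots> = (if k = 0 then 4 / of_nat h / (s - 1) else 0)"
      by (subst sum.delta) (auto simp: finite_gchars gchar_principal)
    finally show ?thesis by simp
  qed
  ultimately show ?thesis unfolding h_def by blast
qed

end

section \<open>Kernels\<close>

text \<open>\<open>h\<close> is uniformly close to a polynomial, for which integration by parts
  gains a factor \<open>1 / v\<close>.\<close>

lemma riemann_lebesgue:
  fixes h :: "real \<Rightarrow> complex"
  assumes h: "continuous_on {0..1} h"
  shows "((\<lambda>v. integral {0..1} (\<lambda>t. h t * cis (v * t))) \<longlongrightarrow> 0) at_infinity"
proof (rule tendstoI)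
  fix e :: real assume e: "e > 0"
  obtain g where g: "polynomial_function g" "\<And>t. t \<in> {0..1} \<Longrightarrow> norm (h t - g t) < e / 2"
    using Stone_Weierstrass_polynomial_function[OF compact_Icc h, of "e / 2"] e by auto
  obtain g' where g': "polynomial_function g'" "\<And>t. (g has_vector_derivative g' t) (at t)"
    using has_vector_derivative_polynomial_function[OF g(1)] by blast
  have cg: "continuous_on {0..1} g" "continuous_on {0..1} g'"
    using g(1) g'(1) by (auto intro: continuous_on_polymonial_function)
  obtain B where B: "\<And>t. t \<in> {0..1} \<Longrightarrow> norm (g' t) \<le> B"
    using compact_imp_bounded[OF compact_continuous_image[OF cg(2) compact_Icc]] unfolding bounded_iff by blast
  define C where "C = norm (g 1) + norm (g 0) + B"
  have "\<forall>\<^sub>F v in at_infinity. norm v > 2 * C / e \<and> v \<noteq> (0 :: real)"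
  proof -
    define L where "L = 2 * C / e"
    show ?thesis unfolding L_def[symmetric] eventually_at_infinity by (intro exI[of _ "\<bar>L\<bar> + 1"]) auto
  qed
  thus "\<forall>\<^sub>F v in at_infinity. dist (integral {0..1} (\<lambda>t. h t * cis (v * t))) 0 < e"
  proof eventually_elim
    case (elim v)
    have int: "(\<lambda>t. k t * cis (v * t)) integrable_on {0..1}" if "continuous_on {0..1} k" for k
      by (intro integrable_continuous_real continuous_intros that)
    have dc: "((\<lambda>t. cis (v * t)) has_vector_derivative \<i> * of_real v * cis (v * t)) (at t within {0..1})" for t
    proof -
      have "((\<lambda>t. exp (\<i> * of_real v * of_real t)) has_vector_derivative \<i> * of_real v * exp (\<i> * of_real v * of_real t)) (at t within {0..1})"
        by (rule has_vector_derivative_real_field) (auto intro!: derivative_eq_intros)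
      thus ?thesis by (simp add: cis_conv_exp mult.assoc)
    qed
    have "((\<lambda>t. g t * (cis (v * t) / (\<i> * of_real v))) has_vector_derivative
        g t * (\<i> * of_real v * cis (v * t) / (\<i> * of_real v)) + g' t * (cis (v * t) / (\<i> * of_real v))) (at t within {0..1})" for t
      by (intro has_vector_derivative_mult has_vector_derivative_divide dc has_vector_derivative_at_within[OF g'(2)])
    hence "((\<lambda>t. g t * (\<i> * of_real v * cis (v * t) / (\<i> * of_real v)) + g' t * (cis (v * t) / (\<i> * of_real v)))
        has_integral (g 1 * (cis (v * 1) / (\<i> * of_real v)) - g 0 * (cis (v * 0) / (\<i> * of_real v)))) {0..1}"
      by (intro fundamental_theorem_of_calculus) auto
    moreover have "\<i> * of_real v * cis (v * t) / (\<i> * of_real v) = cis (v * t)" for t using elim by simp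
    ultimately have ftc: "((\<lambda>t. g t * cis (v * t) + g' t * (cis (v * t) / (\<i> * of_real v)))
        has_integral (g 1 * (cis (v * 1) / (\<i> * of_real v)) - g 0 * (cis (v * 0) / (\<i> * of_real v)))) {0..1}" by simp
    have i2: "(\<lambda>t. g' t * (cis (v * t) / (\<i> * of_real v))) integrable_on {0..1}"
      using elim by (intro integrable_continuous_real continuous_intros cg) auto
    have "integral {0..1} (\<lambda>t. g t * cis (v * t)) + integral {0..1} (\<lambda>t. g' t * (cis (v * t) / (\<i> * of_real v)))
       = g 1 * (cis (v * 1) / (\<i> * of_real v)) - g 0 * (cis (v * 0) / (\<i> * of_real v))"
      using integral_unique[OF ftc] integral_add[OF int[OF cg(1)] i2] by simp
    hence "integral {0..1} (\<lambda>t. g t * cis (v * t))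
       = g 1 * (cis (v * 1) / (\<i> * of_real v)) - g 0 * (cis (v * 0) / (\<i> * of_real v)) - integral {0..1} (\<lambda>t. g' t * (cis (v * t) / (\<i> * of_real v)))"
      by (simp add: algebra_simps)
    also have "norm \<dots> \<le> norm (g 1 * (cis (v * 1) / (\<i> * of_real v))) + norm (g 0 * (cis (v * 0) / (\<i> * of_real v)))
        + norm (integral {0..1} (\<lambda>t. g' t * (cis (v * t) / (\<i> * of_real v))))"
      by (intro order_trans[OF norm_triangle_ineq4] add_mono norm_triangle_ineq4 order_refl)
    also have "norm (integral {0..1} (\<lambda>t. g' t * (cis (v * t) / (\<i> * of_real v)))) \<le> (B / \<bar>v\<bar>) * (1 - 0)"
      by (rule integral_bound)
         (use elim B in \<open>auto intro!: continuous_intros cg simp: norm_mult norm_divide divide_right_mono\<close>)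
    finally have "norm (integral {0..1} (\<lambda>t. g t * cis (v * t))) \<le> C / \<bar>v\<bar>"
      by (simp add: norm_mult norm_divide C_def add_divide_distrib)
    also have "C / \<bar>v\<bar> < e / 2" using elim e by (simp add: field_simps)
    finally have 1: "norm (integral {0..1} (\<lambda>t. g t * cis (v * t))) < e / 2" .
    have "norm (integral {0..1} (\<lambda>t. (h t - g t) * cis (v * t))) \<le> (e / 2) * (1 - 0)"
      by (rule integral_bound) (use g(2) in \<open>auto intro!: continuous_intros cg h simp: norm_mult less_imp_le\<close>)
    moreover have "integral {0..1} (\<lambda>t. (h t - g t) * cis (v * t)) = integral {0..1} (\<lambda>t. h t * cis (v * t)) - integral {0..1} (\<lambda>t. g t * cis (v * t))"
      unfolding left_diff_distrib by (rule integral_diff[OF int[OF h] int[OF cg(1)]])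
    ultimately have "norm (integral {0..1} (\<lambda>t. h t * cis (v * t)) - integral {0..1} (\<lambda>t. g t * cis (v * t))) \<le> e / 2" by simp
    hence "norm (integral {0..1} (\<lambda>t. h t * cis (v * t))) < e"
      using 1 norm_triangle_sub[of "integral {0..1} (\<lambda>t. h t * cis (v * t))" "integral {0..1} (\<lambda>t. g t * cis (v * t))"] by linarith
    thus ?case by simp
  qed
qed

lemma riemann_lebesgue_scaled:
  fixes h :: "real \<Rightarrow> complex"
  assumes h: "continuous_on {0..1} h" and T: "T \<noteq> 0"
  shows "((\<lambda>v. integral {0..1} (\<lambda>t. h t * cis (T * t * v))) \<longlongrightarrow> 0) at_top"
proof -
  have "filterlim (\<lambda>v. T * v) at_infinity at_top"
  proof (cases "T > 0")
    case True
    hence "filterlim (\<lambda>v. T * v) at_top at_top" by (intro filterlim_tendsto_pos_mult_at_top[OF tendsto_const] filterlim_ident)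
    thus ?thesis using at_top_le_at_infinity filterlim_mono by blast
  next
    case False
    hence "filterlim (\<lambda>v. T * v) at_bot at_top" using T by (intro filterlim_tendsto_neg_mult_at_bot[OF tendsto_const] filterlim_ident) auto
    thus ?thesis using at_bot_le_at_infinity filterlim_mono by blast
  qed
  from filterlim_compose[OF riemann_lebesgue[OF h] this] show ?thesis by (simp add: mult_ac)
qed

lemma difference_quotient:
  assumes q: "continuous_on UNIV q" and d: "(q has_real_derivative d) (at 0)"
  obtains r where "continuous_on UNIV r" "\<And>t. q t = q 0 + t * r t"
proof -
  obtain r where r: "\<And>z. q z - q 0 = r z * (z - 0)" "isCont r 0" using d unfolding CARAT_DERIV by blast
  have "isCont r t" for t
  proof (cases "t = 0")
    case False
    have "isCont (\<lambda>z. (q z - q 0) / z) t"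
      using False q by (intro continuous_intros) (auto simp: continuous_on_eq_continuous_at)
    moreover have "\<forall>\<^sub>F z in nhds t. (q z - q 0) / z = r z"
      using t1_space_nhds[OF False] by eventually_elim (use r(1) in auto)
    ultimately show ?thesis by (simp add: isCont_cong)
  qed (use r(2) in simp)
  hence "continuous_on UNIV r" by (simp add: continuous_on_eq_continuous_at)
  moreover have "q t = q 0 + t * r t" for t using r(1)[of t] by (simp add: algebra_simps)
  ultimately show ?thesis using that by blast
qed

section \<open>Poisson and Dirichlet kernels on the unit interval\<close>

lemma poisson_integral:
  assumes "T > 0" "\<sigma> > 0"
  shows "((\<lambda>t. \<sigma> / (\<sigma>\<^sup>2 + (T * t)\<^sup>2)) has_integral arctan (T / \<sigma>) / T) {0..1}"
proof -
  have "((\<lambda>t. \<sigma> / (\<sigma>\<^sup>2 + (T * t)\<^sup>2)) has_integral (arctan (T * 1 / \<sigma>) / T - arctan (T * 0 / \<sigma>) / T)) {0..1}"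
  proof (intro fundamental_theorem_of_calculus)
    fix t assume "t \<in> {0..1::real}"
    have "((\<lambda>t. arctan (T * t / \<sigma>) / T) has_real_derivative (inverse (1 + (T * t / \<sigma>)\<^sup>2) * (T / \<sigma>)) / T) (at t within {0..1})"
      using assms by (auto intro!: derivative_eq_intros)
    moreover have "(inverse (1 + (T * t / \<sigma>)\<^sup>2) * (T / \<sigma>)) / T = \<sigma> / (\<sigma>\<^sup>2 + (T * t)\<^sup>2)"
    proof -
      have "1 + (T * t / \<sigma>)\<^sup>2 = (\<sigma>\<^sup>2 + (T * t)\<^sup>2) / \<sigma>\<^sup>2" using assms by (simp add: power_divide add_divide_distrib)
      thus ?thesis using assms by (simp add: power2_eq_square)
    qed
    ultimately show "((\<lambda>t. arctan (T * t / \<sigma>) / T) has_vector_derivative \<sigma> / (\<sigma>\<^sup>2 + (T * t)\<^sup>2)) (at t within {0..1})"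
      by (simp add: has_real_derivative_iff_has_vector_derivative)
  qed simp
  thus ?thesis by simp
qed

lemma poisson_denominator: "T > 0 \<Longrightarrow> \<sigma> > 0 \<Longrightarrow> \<sigma>\<^sup>2 + (T * t)\<^sup>2 > (0 :: real)"
  by (simp add: add_pos_nonneg)

lemma poisson_moment:
  fixes T \<sigma> :: real
  assumes "T > 0" "\<sigma> > 0"
  shows "((\<lambda>t. \<sigma> * t / (\<sigma>\<^sup>2 + (T * t)\<^sup>2)) has_integral \<sigma> / (2 * T\<^sup>2) * (ln (\<sigma>\<^sup>2 + T\<^sup>2) - ln (\<sigma>\<^sup>2))) {0..1}"
proof -
  have "((\<lambda>t. \<sigma> * t / (\<sigma>\<^sup>2 + (T * t)\<^sup>2)) has_integral
     (\<sigma> / (2 * T\<^sup>2) * ln (\<sigma>\<^sup>2 + (T * 1)\<^sup>2) - \<sigma> / (2 * T\<^sup>2) * ln (\<sigma>\<^sup>2 + (T * 0)\<^sup>2))) {0..1}"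
  proof (intro fundamental_theorem_of_calculus)
    fix t assume "t \<in> {0..1::real}"
    have "((\<lambda>t. \<sigma> / (2 * T\<^sup>2) * ln (\<sigma>\<^sup>2 + (T * t)\<^sup>2)) has_real_derivative
        \<sigma> / (2 * T\<^sup>2) * ((2 * T\<^sup>2 * t) / (\<sigma>\<^sup>2 + (T * t)\<^sup>2))) (at t within {0..1})"
      using poisson_denominator[OF assms, of t] by (auto intro!: derivative_eq_intros simp: power2_eq_square)
    moreover have "\<sigma> / (2 * T\<^sup>2) * ((2 * T\<^sup>2 * t) / (\<sigma>\<^sup>2 + (T * t)\<^sup>2)) = \<sigma> * t / (\<sigma>\<^sup>2 + (T * t)\<^sup>2)"
      using assms by simp
    ultimately show "((\<lambda>t. \<sigma> / (2 * T\<^sup>2) * ln (\<sigma>\<^sup>2 + (T * t)\<^sup>2)) has_vector_derivative \<sigma> * t / (\<sigma>\<^sup>2 + (T * t)\<^sup>2)) (at t within {0..1})"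
      using assms by (simp add: has_real_derivative_iff_has_vector_derivative)
  qed simp
  thus ?thesis by (simp add: right_diff_distrib)
qed

lemma poisson_limits:
  assumes "T > 0"
  shows "((\<lambda>\<sigma>. arctan (T / \<sigma>) / T) \<longlongrightarrow> pi / (2 * T)) (at_right 0)"
    and "((\<lambda>\<sigma>. \<sigma> / (2 * T\<^sup>2) * (ln (\<sigma>\<^sup>2 + T\<^sup>2) - ln (\<sigma>\<^sup>2))) \<longlongrightarrow> 0) (at_right 0)"
  using assms by (real_asymp simp: field_simps)+

lemma bounded_continuous_Icc:
  assumes "continuous_on UNIV (r :: real \<Rightarrow> real)"
  obtains B where "B \<ge> 0" "\<And>t. t \<in> {0..1} \<Longrightarrow> \<bar>r t\<bar> \<le> B"
proof -
  obtain B where B: "\<And>t. t \<in> {0..1} \<Longrightarrow> norm (r t) \<le> B"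
    using compact_imp_bounded[OF compact_continuous_image[OF continuous_on_subset[OF assms subset_UNIV] compact_Icc[of 0 1]]]
    unfolding bounded_iff by blast
  show ?thesis using that[of B] B B[of 0] by force
qed

lemma weighted_integral_bound:
  fixes r w :: "real \<Rightarrow> real"
  assumes r: "continuous_on {0..1} (\<lambda>t. r t * w t)" and B: "\<And>t. t \<in> {0..1} \<Longrightarrow> \<bar>r t\<bar> \<le> B"
    and w: "\<And>t. t \<in> {0..1} \<Longrightarrow> w t \<ge> 0" "(w has_integral I) {0..1}"
  shows "\<bar>integral {0..1} (\<lambda>t. r t * w t)\<bar> \<le> B * I"
proof -
  have "norm (integral {0..1} (\<lambda>t. r t * w t)) \<le> integral {0..1} (\<lambda>t. B * w t)"
  proof (rule integral_norm_bound_integral)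
    show "(\<lambda>t. r t * w t) integrable_on {0..1}" by (rule integrable_continuous_real[OF r])
    show "(\<lambda>t. B * w t) integrable_on {0..1}" using has_integral_mult_right[OF w(2), of B] by blast
    show "norm (r t * w t) \<le> B * w t" if "t \<in> {0..1}" for t
      using B[OF that] w(1)[OF that] by (simp add: abs_mult mult_right_mono)
  qed
  also have "\<dots> = B * I" using has_integral_mult_right[OF w(2), of B] by (rule integral_unique)
  finally show ?thesis by simp
qed

text \<open>Write \<open>h t = h 0 + t * r t\<close>. The constant part picks up
  \<open>arctan (T / \<sigma>) / T\<close>, half the mass of the kernel since only
  \<open>t \<ge> 0\<close> is seen. The rest is at most a constant times the first moment of the
  kernel, which tends to 0.\<close>

lemma poisson_kernel_limit:
  assumes T: "T > 0" and h: "continuous_on UNIV h" "(h has_real_derivative d) (at 0)"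
  shows "((\<lambda>\<sigma>. integral {0..1} (\<lambda>t. h t * (\<sigma> / (\<sigma>\<^sup>2 + (T * t)\<^sup>2)))) \<longlongrightarrow> h 0 * (pi / (2 * T))) (at_right 0)"
proof -
  obtain r where r: "continuous_on UNIV r" "\<And>t. h t = h 0 + t * r t" using difference_quotient[OF h] by blast
  obtain B where B: "B \<ge> 0" "\<And>t. t \<in> {0..1} \<Longrightarrow> \<bar>r t\<bar> \<le> B" using bounded_continuous_Icc[OF r(1)] by blast
  have ev: "\<forall>\<^sub>F \<sigma> in at_right (0::real). \<sigma> > 0" by (simp add: eventually_at_filter)
  have c: "continuous_on {0..1} (\<lambda>t. r t * (\<sigma> * t / (\<sigma>\<^sup>2 + (T * t)\<^sup>2)))" if "\<sigma> > 0" for \<sigma>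
    using poisson_denominator[OF T that]
    by (intro continuous_intros continuous_on_subset[OF r(1)]) (auto simp: less_imp_neq[THEN not_sym])
  have "((\<lambda>\<sigma>. integral {0..1} (\<lambda>t. r t * (\<sigma> * t / (\<sigma>\<^sup>2 + (T * t)\<^sup>2)))) \<longlongrightarrow> 0) (at_right 0)"
  proof (rule Lim_null_comparison)
    show "\<forall>\<^sub>F \<sigma> in at_right 0. norm (integral {0..1} (\<lambda>t. r t * (\<sigma> * t / (\<sigma>\<^sup>2 + (T * t)\<^sup>2)))) \<le>
        B * (\<sigma> / (2 * T\<^sup>2) * (ln (\<sigma>\<^sup>2 + T\<^sup>2) - ln (\<sigma>\<^sup>2)))"
      using ev
    proof eventually_elim
      case (elim \<sigma>)
      show ?case unfolding real_norm_def
        by (rule weighted_integral_bound[OF c[OF elim] B(2) _ poisson_moment[OF T elim]]) (use elim in auto)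
    qed
    show "((\<lambda>\<sigma>. B * (\<sigma> / (2 * T\<^sup>2) * (ln (\<sigma>\<^sup>2 + T\<^sup>2) - ln (\<sigma>\<^sup>2)))) \<longlongrightarrow> 0) (at_right 0)"
      using tendsto_mult_left[OF poisson_limits(2)[OF T], of B] by simp
  qed
  hence "((\<lambda>\<sigma>. h 0 * (arctan (T / \<sigma>) / T) + integral {0..1} (\<lambda>t. r t * (\<sigma> * t / (\<sigma>\<^sup>2 + (T * t)\<^sup>2)))) \<longlongrightarrow> h 0 * (pi / (2 * T)) + 0) (at_right 0)"
    by (intro tendsto_add tendsto_mult_left poisson_limits(1)[OF T])
  moreover have "\<forall>\<^sub>F \<sigma> in at_right 0. h 0 * (arctan (T / \<sigma>) / T) + integral {0..1} (\<lambda>t. r t * (\<sigma> * t / (\<sigma>\<^sup>2 + (T * t)\<^sup>2)))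
      = integral {0..1} (\<lambda>t. h t * (\<sigma> / (\<sigma>\<^sup>2 + (T * t)\<^sup>2)))"
    using ev
  proof eventually_elim
    case (elim \<sigma>)
    have "((\<lambda>t. h 0 * (\<sigma> / (\<sigma>\<^sup>2 + (T * t)\<^sup>2)) + r t * (\<sigma> * t / (\<sigma>\<^sup>2 + (T * t)\<^sup>2))) has_integral
       (h 0 * (arctan (T / \<sigma>) / T) + integral {0..1} (\<lambda>t. r t * (\<sigma> * t / (\<sigma>\<^sup>2 + (T * t)\<^sup>2))))) {0..1}"
      by (intro has_integral_add has_integral_mult_right poisson_integral T elim integrable_integral integrable_continuous_real c)
    moreover have "h 0 * (\<sigma> / (\<sigma>\<^sup>2 + (T * t)\<^sup>2)) + r t * (\<sigma> * t / (\<sigma>\<^sup>2 + (T * t)\<^sup>2)) = h t * (\<sigma> / (\<sigma>\<^sup>2 + (T * t)\<^sup>2))" for t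
    proof -
      have "r t * (\<sigma> * t / (\<sigma>\<^sup>2 + (T * t)\<^sup>2)) = (t * r t) * (\<sigma> / (\<sigma>\<^sup>2 + (T * t)\<^sup>2))" by simp
      thus ?thesis unfolding r(2)[of t] by (simp only: distrib_right)
    qed
    ultimately show ?case by (simp add: integral_unique)
  qed
  ultimately show ?thesis by (simp add: Lim_transform_eventually)
qed

lemma sinc_integral_scaled:
  assumes T: "T > 0"
  shows "((\<lambda>t. v * sinc (T * t * v)) has_integral Si (T * v) / T) {0..1}"
proof -
  have "((\<lambda>t. v * sinc (T * t * v)) has_integral (Si (T * 1 * v) / T - Si (T * 0 * v) / T)) {0..1}"
  proof (intro fundamental_theorem_of_calculus)
    fix t assume "t \<in> {0..1::real}"
    have "((\<lambda>t. Si (T * t * v)) has_real_derivative sinc (T * t * v) * (T * v)) (at t within {0..1})"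
      by (rule DERIV_chain2[OF DERIV_Si]) (auto intro!: derivative_eq_intros)
    hence "((\<lambda>t. Si (T * t * v) / T) has_real_derivative sinc (T * t * v) * (T * v) / T) (at t within {0..1})"
      by (rule DERIV_cdivide)
    thus "((\<lambda>t. Si (T * t * v) / T) has_vector_derivative v * sinc (T * t * v)) (at t within {0..1})"
      using T by (simp add: has_real_derivative_iff_has_vector_derivative mult_ac)
  qed simp
  moreover have "Si 0 = 0" by (simp add: Si_def zero_ereal_def)
  ultimately show ?thesis by simp
qed

text \<open>The constant part of \<open>q\<close> gives \<open>Si (T * v) / T\<close>. In the rest
  the factor \<open>t\<close> cancels the denominator of \<open>sinc\<close>, leaving
  \<open>r t / T * sin (T * t * v)\<close>, to which the Riemann-Lebesgue lemma applies.\<close>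

lemma dirichlet_kernel_limit:
  assumes T: "T > 0" and q: "continuous_on UNIV q" "(q has_real_derivative d) (at 0)"
  shows "((\<lambda>v. integral {0..1} (\<lambda>t. q t * (v * sinc (T * t * v)))) \<longlongrightarrow> q 0 * (pi / (2 * T))) at_top"
proof -
  obtain r where r: "continuous_on UNIV r" "\<And>t. q t = q 0 + t * r t" using difference_quotient[OF q] by blast
  have rc: "continuous_on {0..1} (\<lambda>t. complex_of_real (r t / T))"
    using T by (intro continuous_intros continuous_on_subset[OF r(1)]) auto
  have sin_int: "((\<lambda>t. r t / T * sin (T * t * v)) has_integral Im (integral {0..1} (\<lambda>t. complex_of_real (r t / T) * cis (T * t * v)))) {0..1}" for v
  proof -
    have "((\<lambda>t. complex_of_real (r t / T) * cis (T * t * v)) has_integral integral {0..1} (\<lambda>t. complex_of_real (r t / T) * cis (T * t * v))) {0..1}"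
      by (intro integrable_integral integrable_continuous_real continuous_intros rc)
    from has_integral_linear[OF this bounded_linear_Im] show ?thesis by (simp add: o_def)
  qed
  have RL: "((\<lambda>v. Im (integral {0..1} (\<lambda>t. complex_of_real (r t / T) * cis (T * t * v)))) \<longlongrightarrow> 0) at_top"
    using tendsto_Im[OF riemann_lebesgue_scaled[OF rc, of T]] T by simp
  have Si: "((\<lambda>v. Si (T * v) / T) \<longlongrightarrow> (pi / 2) / T) at_top"
  proof -
    have "filterlim (\<lambda>v. T * v) at_top at_top" using T by (intro filterlim_tendsto_pos_mult_at_top[OF tendsto_const] filterlim_ident)
    from filterlim_compose[OF Si_at_top this] show ?thesis using T by (intro tendsto_divide) auto
  qed
  have "((\<lambda>v. q 0 * (Si (T * v) / T) + Im (integral {0..1} (\<lambda>t. complex_of_real (r t / T) * cis (T * t * v)))) \<longlongrightarrow> q 0 * ((pi / 2) / T) + 0) at_top"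
    by (intro tendsto_add tendsto_mult_left Si RL)
  moreover have "integral {0..1} (\<lambda>t. q t * (v * sinc (T * t * v))) =
      q 0 * (Si (T * v) / T) + Im (integral {0..1} (\<lambda>t. complex_of_real (r t / T) * cis (T * t * v)))" for v
  proof -
    have "((\<lambda>t. q 0 * (v * sinc (T * t * v)) + r t / T * sin (T * t * v)) has_integral
       (q 0 * (Si (T * v) / T) + Im (integral {0..1} (\<lambda>t. complex_of_real (r t / T) * cis (T * t * v))))) {0..1}"
      by (intro has_integral_add has_integral_mult_right sinc_integral_scaled T sin_int)
    moreover have "q 0 * (v * sinc (T * t * v)) + r t / T * sin (T * t * v) = q t * (v * sinc (T * t * v))" for t
    proof -
      have "r t / T * sin (T * t * v) = t * r t * (v * sinc (T * t * v))"
        using T by auto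
      thus ?thesis unfolding r(2)[of t] by (simp only: distrib_right)
    qed
    ultimately show ?thesis by (simp only: integral_unique)
  qed
  ultimately show ?thesis by simp
qed

text \<open>Half the Fourier transform of the even extension of \<open>q\<close>, cut off to
  \<open>[-1, 1]\<close>. As a function of \<open>y\<close>, \<open>cosint q (T * y)\<close> thus
  has frequencies in \<open>[-T, T]\<close> only.\<close>

definition cosint :: "(real \<Rightarrow> real) \<Rightarrow> real \<Rightarrow> real" where
  "cosint q x = integral {0..1} (\<lambda>t. q t * cos (x * t))"

text \<open>\<open>cosint qK x = 2 \<pi>^2 (1 + cos x) / (\<pi>^2 - x^2)^2\<close> is nonnegative, and \<open>qF\<close> is chosen so that its cosine integral
  is \<open>(3 \<pi>^2 - x^2)/(2 \<pi>^2)\<close> times this kernel, negative for large \<open>x\<close>, while \<open>qF 0 > 0\<close>.\<close>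

definition qK :: "real \<Rightarrow> real" where "qK t = (1 - t) * cos (pi * t) + sin (pi * t) / pi"
definition qB :: "real \<Rightarrow> real" where "qB t = sin (pi * t)"
definition qF :: "real \<Rightarrow> real" where "qF t = qK t + qB t / pi"

lemma q_continuous: "continuous_on A qK" "continuous_on A qB" "continuous_on A qF"
  unfolding qK_def[abs_def] qB_def[abs_def] qF_def[abs_def] by (intro continuous_intros; simp)+

lemma q_deriv: "(qK has_real_derivative - pi * (1 - t) * sin (pi * t)) (at t within A)"
  "(qB has_real_derivative pi * cos (pi * t)) (at t within A)"
  "(qF has_real_derivative - pi * (1 - t) * sin (pi * t) + cos (pi * t)) (at t within A)"
  unfolding qK_def[abs_def] qB_def[abs_def] qF_def[abs_def]
  by (auto intro!: derivative_eq_intros simp: field_simps)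

lemma q_values [simp]: "qK 0 = 1" "qF 0 = 1" "qK 1 = 0" by (simp_all add: qK_def qF_def qB_def)

lemma cosint_integral: "continuous_on {0..1} q \<Longrightarrow> ((\<lambda>t. q t * cos (x * t)) has_integral cosint q x) {0..1}"
  unfolding cosint_def by (intro integrable_integral integrable_continuous_real continuous_intros)

lemma cosint_B: "(pi\<^sup>2 - x\<^sup>2) * cosint qB x = pi * (1 + cos x)"
proof -
  \<comment> \<open>Minus the Wronskian of \<open>sin (pi * t)\<close> and
    \<open>cos (x * t)\<close>, both eigenfunctions of the second derivative.\<close>
  define H where "H t = - pi * cos (pi * t) * cos (x * t) - x * sin (pi * t) * sin (x * t)" for t
  have "((\<lambda>t. (pi\<^sup>2 - x\<^sup>2) * (qB t * cos (x * t))) has_integral (H 1 - H 0)) {0..1}"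
  proof (intro fundamental_theorem_of_calculus)
    fix t
    have "(H has_real_derivative (pi\<^sup>2 - x\<^sup>2) * (qB t * cos (x * t))) (at t within {0..1})"
      unfolding H_def[abs_def] qB_def
      by (auto intro!: derivative_eq_intros simp: algebra_simps power2_eq_square)
    thus "(H has_vector_derivative (pi\<^sup>2 - x\<^sup>2) * (qB t * cos (x * t))) (at t within {0..1})"
      by (simp add: has_real_derivative_iff_has_vector_derivative)
  qed simp
  moreover have "((\<lambda>t. (pi\<^sup>2 - x\<^sup>2) * (qB t * cos (x * t))) has_integral (pi\<^sup>2 - x\<^sup>2) * cosint qB x) {0..1}"
    by (intro has_integral_mult_right cosint_integral q_continuous)
  ultimately have "(pi\<^sup>2 - x\<^sup>2) * cosint qB x = H 1 - H 0" by (rule has_integral_unique[rotated])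
  thus ?thesis by (simp add: H_def algebra_simps)
qed

lemma cosint_K: "(pi\<^sup>2 - x\<^sup>2) * cosint qK x = 2 * pi * cosint qB x"
proof -
  \<comment> \<open>Again minus a Wronskian, now of \<open>qK\<close> and
    \<open>cos (x * t)\<close>. It vanishes at both ends: the derivative of \<open>qK\<close> is 0
    at 0 and 1, \<open>qK\<close> is 0 at 1, and \<open>sin (x * t)\<close> is 0 at 0.\<close>
  define H where "H t = pi * (1 - t) * sin (pi * t) * cos (x * t) - x * qK t * sin (x * t)" for t
  have "((\<lambda>t. (pi\<^sup>2 - x\<^sup>2) * (qK t * cos (x * t)) - 2 * pi * (qB t * cos (x * t))) has_integral (H 1 - H 0)) {0..1}"
  proof (intro fundamental_theorem_of_calculus)
    fix t
    have "(H has_real_derivative (pi\<^sup>2 - x\<^sup>2) * (qK t * cos (x * t)) - 2 * pi * (qB t * cos (x * t))) (at t within {0..1})"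
      unfolding H_def[abs_def]
      by (rule derivative_eq_intros q_deriv refl)+ (simp add: qK_def qB_def field_simps power2_eq_square)
    thus "(H has_vector_derivative (pi\<^sup>2 - x\<^sup>2) * (qK t * cos (x * t)) - 2 * pi * (qB t * cos (x * t))) (at t within {0..1})"
      by (simp add: has_real_derivative_iff_has_vector_derivative)
  qed simp
  moreover have "((\<lambda>t. (pi\<^sup>2 - x\<^sup>2) * (qK t * cos (x * t)) - 2 * pi * (qB t * cos (x * t))) has_integral
      (pi\<^sup>2 - x\<^sup>2) * cosint qK x - 2 * pi * cosint qB x) {0..1}"
    by (intro has_integral_diff has_integral_mult_right cosint_integral q_continuous)
  ultimately have "(pi\<^sup>2 - x\<^sup>2) * cosint qK x - 2 * pi * cosint qB x = H 1 - H 0" by (rule has_integral_unique[rotated])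
  thus ?thesis by (simp add: H_def)
qed

text \<open>\<open>qF\<close> equals \<open>(3 pi^2 qK + qK'') / (2 pi^2)\<close>, and the second
  derivative becomes multiplication by \<open>- x^2\<close>. Since \<open>qK''(0) = - pi^2\<close>,
  any constant above \<open>pi^2\<close> in place of \<open>3 pi^2\<close> would keep the value at 0
  positive.\<close>

lemma cosint_F: "2 * pi\<^sup>2 * cosint qF x = (3 * pi\<^sup>2 - x\<^sup>2) * cosint qK x"
proof -
  have "((\<lambda>t. qK t * cos (x * t) + qB t * cos (x * t) / pi) has_integral cosint qK x + cosint qB x / pi) {0..1}"
    by (intro has_integral_add has_integral_divide cosint_integral q_continuous)
  moreover have "qK t * cos (x * t) + qB t * cos (x * t) / pi = qF t * cos (x * t)" for t
    by (simp add: qF_def distrib_right)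
  ultimately have "cosint qF x = cosint qK x + cosint qB x / pi"
    unfolding cosint_def[of qF] by (simp add: integral_unique)
  hence "2 * pi\<^sup>2 * cosint qF x = 2 * pi\<^sup>2 * cosint qK x + 2 * pi * cosint qB x"
    by (simp add: power2_eq_square distrib_left)
  thus ?thesis unfolding cosint_K[symmetric] by (simp add: algebra_simps)
qed

text \<open>At this point the closed form of the kernel is 0/0, so the value comes from an explicit
  antiderivative.\<close>

lemma cosint_K_at_pi: "cosint qK pi = 1/4"
proof -
  define a where "a = 1 / (4 * pi)"
  define b where "b = 3 / (8 * pi\<^sup>2)"
  have ab: "a * (2 * pi) = 1/2" "b * (2 * pi) = 3 * a" "2 * a = 1 / (2 * pi)"
    by (simp_all add: a_def b_def power2_eq_square)
  define H where "H t = t / 2 - t\<^sup>2 / 4 + (1 - t) * sin (2 * pi * t) * a - cos (2 * pi * t) * b" for t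
  have "((\<lambda>t. qK t * cos (pi * t)) has_integral (H 1 - H 0)) {0..1}"
  proof (intro fundamental_theorem_of_calculus)
    fix t :: real
    have c2: "cos (2 * pi * t) = 2 * (cos (pi * t))\<^sup>2 - 1" "sin (2 * pi * t) = 2 * sin (pi * t) * cos (pi * t)"
      using cos_double_cos[of "pi * t"] sin_double[of "pi * t"] by (simp_all add: mult.assoc)
    have "(H has_real_derivative 1/2 - t / 2 + (- sin (2 * pi * t) * a + (1 - t) * cos (2 * pi * t) * (a * (2 * pi)))
        + sin (2 * pi * t) * (b * (2 * pi))) (at t within {0..1})"
      unfolding H_def[abs_def] by (auto intro!: derivative_eq_intros simp: algebra_simps)
    also have "1/2 - t / 2 + (- sin (2 * pi * t) * a + (1 - t) * cos (2 * pi * t) * (a * (2 * pi)))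
        + sin (2 * pi * t) * (b * (2 * pi)) = 1/2 - t / 2 + (1 - t) * cos (2 * pi * t) / 2 + sin (2 * pi * t) * (2 * a)"
      unfolding ab(1,2) by (simp add: field_simps)
    also have "\<dots> = qK t * cos (pi * t)"
      unfolding ab(3) c2 by (simp add: qK_def field_simps power2_eq_square)
    finally show "(H has_vector_derivative qK t * cos (pi * t)) (at t within {0..1})"
      by (simp add: has_real_derivative_iff_has_vector_derivative)
  qed simp
  hence "cosint qK pi = H 1 - H 0" unfolding cosint_def by (rule integral_unique)
  thus ?thesis by (simp add: H_def)
qed

text \<open>\<open>qK\<close> is twice the autocorrelation of \<open>cos (pi * y)\<close> on
  \<open>[-1/2, 1/2]\<close>, so its transform is a square. The proof reads the sign off the closed
  form, which leaves \<open>pi\<close> and \<open>- pi\<close> to be treated apart.\<close>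

lemma cosint_K_nonneg: "cosint qK x \<ge> 0"
proof (cases "x\<^sup>2 = pi\<^sup>2")
  case True
  hence "x = pi \<or> x = - pi" by (simp add: power2_eq_iff)
  moreover have "cosint qK (- pi) = cosint qK pi" by (simp add: cosint_def)
  ultimately show ?thesis using cosint_K_at_pi by auto
next
  case False
  have "(pi\<^sup>2 - x\<^sup>2) * ((pi\<^sup>2 - x\<^sup>2) * cosint qK x) = 2 * pi * (pi * (1 + cos x))"
    unfolding cosint_K cosint_B[symmetric] by (simp add: mult_ac)
  hence "(pi\<^sup>2 - x\<^sup>2)\<^sup>2 * cosint qK x = 2 * pi * (pi * (1 + cos x))" by (simp add: power2_eq_square mult_ac)
  moreover have "1 + cos x \<ge> 0" using cos_ge_minus_one[of x] by linarith
  hence "2 * pi * (pi * (1 + cos x)) \<ge> 0" by (intro mult_nonneg_nonneg) auto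
  moreover have "(pi\<^sup>2 - x\<^sup>2)\<^sup>2 > 0" using False by simp
  ultimately show ?thesis by (metis zero_le_mult_iff not_less order_less_imp_le)
qed

lemma abs_cosint_le:
  assumes q: "continuous_on UNIV q"
  obtains B where "\<And>x. \<bar>cosint q x\<bar> \<le> B"
proof -
  obtain B where B: "B \<ge> 0" "\<And>t. t \<in> {0..1} \<Longrightarrow> \<bar>q t\<bar> \<le> B" using bounded_continuous_Icc[OF q] by blast
  have "\<bar>cosint q x\<bar> \<le> B" for x
  proof -
    have "norm (integral {0..1} (\<lambda>t. q t * cos (x * t))) \<le> B * (1 - 0)"
    proof (rule integral_bound)
      show "continuous_on {0..1} (\<lambda>t. q t * cos (x * t))" by (intro continuous_intros continuous_on_subset[OF q]) auto
      show "norm (q t * cos (x * t)) \<le> B" if "t \<in> {0..1}" for t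
        using mult_mono[OF B(2)[OF that] abs_cos_le_one[of "x * t"]] B(1) by (simp add: abs_mult)
    qed simp
    thus ?thesis by (simp add: cosint_def)
  qed
  thus ?thesis using that by blast
qed

section \<open>Primes near a prescribed norm and direction\<close>

text \<open>What the distribution argument takes from the arithmetic: for each angular exponent the
  prime sum is continuous up to \<open>Re s = 1\<close>, apart from a simple pole at 1 when
  \<open>k = 0\<close>.\<close>

locale prime_density =
  fixes P :: "gauss_int set" and c :: real and G :: "int \<Rightarrow> complex \<Rightarrow> complex"
  assumes P: "P \<subseteq> gauss_primes" and c: "c > 0" and G: "continuous_on {s. Re s \<ge> 1} (G k)"
    and S: "Re s > 1 \<Longrightarrow> infsum (prime_term (\<lambda>a. sgn (cg a) powi k) s) P = G k s + (if k = 0 then of_real c / (s - 1) else 0)"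
begin

definition weight :: "real \<Rightarrow> gauss_int \<Rightarrow> real" where
  "weight \<sigma> p = ln_norm p * real (gnorm p) powr (- (1 + \<sigma>))"

definition weighted_sum :: "(gauss_int \<Rightarrow> real \<Rightarrow> complex) \<Rightarrow> real \<Rightarrow> real \<Rightarrow> complex" where
  "weighted_sum f \<sigma> v = (\<Sum>\<^sub>\<infinity>p\<in>P. of_real (weight \<sigma> p) * f p v)"

text \<open>Two successive limits as in the Wiener-Ikehara method, \<open>\<sigma>\<close> to 0 at
  fixed \<open>v\<close> and then \<open>v\<close> to infinity; they are never interchanged. The
  bound on \<open>f\<close> makes the weighted sums converge, so the notion is linear in
  \<open>f\<close> and \<open>L\<close>.\<close>

definition mean_tends :: "(gauss_int \<Rightarrow> real \<Rightarrow> complex) \<Rightarrow> complex \<Rightarrow> bool" where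
  "mean_tends f L \<longleftrightarrow> (\<exists>B. \<forall>p v. norm (f p v) \<le> B) \<and>
     (\<exists>\<Lambda>. (\<forall>v. ((\<lambda>\<sigma>. weighted_sum f \<sigma> v) \<longlongrightarrow> \<Lambda> v) (at_right 0)) \<and> (\<Lambda> \<longlongrightarrow> L) at_top)"

lemma mean_tendsI:
  assumes "\<And>p v. norm (f p v) \<le> B" "\<And>v. ((\<lambda>\<sigma>. weighted_sum f \<sigma> v) \<longlongrightarrow> \<Lambda> v) (at_right 0)" "(\<Lambda> \<longlongrightarrow> L) at_top"
  shows "mean_tends f L"
  unfolding mean_tends_def using assms by (intro conjI exI[of _ B] exI[of _ \<Lambda>]) auto

lemma weight_nonneg: "weight \<sigma> p \<ge> 0" by (simp add: weight_def ln_norm_nonneg)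

lemma weight_summable: "\<sigma> > 0 \<Longrightarrow> weight \<sigma> summable_on P"
  unfolding weight_def by (rule summable_on_subset_banach[OF summable_prime_weight P]) simp

lemma weighted_sum_summable:
  fixes f :: "gauss_int \<Rightarrow> real \<Rightarrow> complex"
  assumes "\<sigma> > 0" "\<And>p v. norm (f p v) \<le> B"
  shows "(\<lambda>p. of_real (weight \<sigma> p) * f p v) summable_on P"
proof (rule abs_summable_summable)
  show "(\<lambda>p. norm (of_real (weight \<sigma> p) * f p v)) summable_on P"
    by (rule Infinite_Sum.abs_summable_on_comparison_test'[OF summable_on_cmult_left[OF weight_summable[OF assms(1)], of B]])
       (use weight_nonneg assms(2) in \<open>auto simp: norm_mult intro!: mult_left_mono\<close>)
qed

lemma eventually_pos: "\<forall>\<^sub>F \<sigma> in at_right (0::real). \<sigma> > 0"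
  by (rule eventually_at_right_gt)

lemma mean_tends_add:
  assumes "mean_tends f L" "mean_tends f' L'"
  shows "mean_tends (\<lambda>p v. f p v + f' p v) (L + L')"
proof -
  obtain B \<Lambda> where 1: "\<And>p v. norm (f p v) \<le> B" "\<And>v. ((\<lambda>\<sigma>. weighted_sum f \<sigma> v) \<longlongrightarrow> \<Lambda> v) (at_right 0)" "(\<Lambda> \<longlongrightarrow> L) at_top"
    using assms(1) unfolding mean_tends_def by blast
  obtain B' \<Lambda>' where 2: "\<And>p v. norm (f' p v) \<le> B'" "\<And>v. ((\<lambda>\<sigma>. weighted_sum f' \<sigma> v) \<longlongrightarrow> \<Lambda>' v) (at_right 0)" "(\<Lambda>' \<longlongrightarrow> L') at_top"
    using assms(2) unfolding mean_tends_def by blast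
  have t1: "norm (f p v + f' p v) \<le> B + B'" for p v
    by (rule order_trans[OF norm_triangle_ineq add_mono[OF 1(1) 2(1)]])
  have t2: "((\<lambda>\<sigma>. weighted_sum (\<lambda>p v. f p v + f' p v) \<sigma> v) \<longlongrightarrow> \<Lambda> v + \<Lambda>' v) (at_right 0)" for v
  proof (rule Lim_transform_eventually[OF tendsto_add[OF 1(2) 2(2)]])
    show "\<forall>\<^sub>F \<sigma> in at_right 0. weighted_sum f \<sigma> v + weighted_sum f' \<sigma> v = weighted_sum (\<lambda>p v. f p v + f' p v) \<sigma> v"
      using eventually_pos
    proof eventually_elim
      case (elim \<sigma>)
      show ?case unfolding weighted_sum_def distrib_left
        by (rule infsum_add[symmetric]) (rule weighted_sum_summable[OF elim], rule 1 2)+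
    qed
  qed
  have t3: "((\<lambda>v. \<Lambda> v + \<Lambda>' v) \<longlongrightarrow> L + L') at_top" by (intro tendsto_add 1 2)
  show ?thesis by (rule mean_tendsI[OF t1 t2 t3])
qed

lemma mean_tends_cmult:
  assumes "mean_tends f L"
  shows "mean_tends (\<lambda>p v. a * f p v) (a * L)"
proof -
  obtain B \<Lambda> where 1: "\<And>p v. norm (f p v) \<le> B" "\<And>v. ((\<lambda>\<sigma>. weighted_sum f \<sigma> v) \<longlongrightarrow> \<Lambda> v) (at_right 0)" "(\<Lambda> \<longlongrightarrow> L) at_top"
    using assms(1) unfolding mean_tends_def by blast
  have t1: "norm (a * f p v) \<le> norm a * B" for p v unfolding norm_mult by (intro mult_left_mono 1) simp
  have t2: "((\<lambda>\<sigma>. weighted_sum (\<lambda>p v. a * f p v) \<sigma> v) \<longlongrightarrow> a * \<Lambda> v) (at_right 0)" for v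
  proof -
    have "weighted_sum (\<lambda>p v. a * f p v) \<sigma> v = a * weighted_sum f \<sigma> v" for \<sigma>
      unfolding weighted_sum_def by (subst infsum_cmult_right'[symmetric]) (simp add: mult_ac)
    thus ?thesis using tendsto_mult_left[OF 1(2)] by simp
  qed
  have t3: "((\<lambda>v. a * \<Lambda> v) \<longlongrightarrow> a * L) at_top" by (intro tendsto_mult_left 1)
  show ?thesis by (rule mean_tendsI[OF t1 t2 t3])
qed

lemma mean_tends_zero: "mean_tends (\<lambda>p v. 0) 0"
  unfolding mean_tends_def weighted_sum_def by (auto intro!: exI[of _ 0] exI[of _ "\<lambda>_. 0"])

lemma mean_tends_sum:
  assumes "finite J" "\<And>j. j \<in> J \<Longrightarrow> mean_tends (f j) (L j)"
  shows "mean_tends (\<lambda>p v. \<Sum>j\<in>J. f j p v) (\<Sum>j\<in>J. L j)"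
  using assms
proof (induction J rule: finite_induct)
  case empty
  show ?case using mean_tends_zero by simp
next
  case (insert j J)
  have "mean_tends (\<lambda>p v. f j p v + (\<Sum>j\<in>J. f j p v)) (L j + (\<Sum>j\<in>J. L j))"
    by (rule mean_tends_add) (use insert in auto)
  thus ?case using insert(1,2) by simp
qed

lemma npow_line:
  assumes "p \<in> P"
  shows "npow p (of_real x + \<i> * of_real y) = of_real (real (gnorm p) powr (- x)) * cis (- y * ln_norm p)"
proof -
  have p0: "p \<noteq> 0" using assms P by (auto simp: gauss_primes_def)
  hence ln: "Ln (of_nat (gnorm p)) = of_real (ln_norm p)" using Ln_of_real[of "real (gnorm p)"] by (simp add: ln_norm_def)
  have "npow p (of_real x + \<i> * of_real y) = exp (- (of_real x + \<i> * of_real y) * of_real (ln_norm p))"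
    using p0 by (simp add: npow_def powr_def ln)
  also have "\<dots> = exp (of_real (- x * ln_norm p)) * exp (\<i> * of_real (- y * ln_norm p))"
    by (simp add: exp_add[symmetric] algebra_simps)
  also have "exp (of_real (- x * ln_norm p)) = complex_of_real (real (gnorm p) powr (- x))"
    unfolding exp_of_real powr_def ln_norm_def using p0 by simp
  finally show ?thesis by (simp add: cis_conv_exp)
qed

abbreviation angle_power :: "int \<Rightarrow> gauss_int \<Rightarrow> complex" where "angle_power k a \<equiv> sgn (cg a) powi k"

definition prime_series :: "int \<Rightarrow> complex \<Rightarrow> complex" where "prime_series k s = infsum (prime_term (angle_power k) s) P"

text \<open>The cosine splits into \<open>N(p)^(iTt)\<close> and \<open>N(p)^(-iTt)\<close> with
  phases in \<open>v\<close>, so exchanging sum and integral leaves the prime series on a segment of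
  \<open>Re s = 1 + \<sigma>\<close>. A majorant independent of \<open>t\<close> justifies the
  exchange.\<close>

lemma weighted_sum_cosint:
  assumes q: "continuous_on UNIV q" and \<sigma>: "\<sigma> > 0"
  shows "((\<lambda>t. of_real (q t) * ((cis (- (T * t * v)) * prime_series k (of_real (1 + \<sigma>) + \<i> * of_real (- (T * t)))
      + cis (T * t * v) * prime_series k (of_real (1 + \<sigma>) + \<i> * of_real (T * t))) / 2))
    has_integral weighted_sum (\<lambda>p v. of_real (cosint q (T * (ln_norm p - v))) * angle_power k p) \<sigma> v) {0..1}"
proof -
  obtain Bq where Bq: "Bq \<ge> 0" "\<And>t. t \<in> {0..1} \<Longrightarrow> \<bar>q t\<bar> \<le> Bq" using bounded_continuous_Icc[OF q] by blast
  define m where "m p = of_real (weight \<sigma> p) * angle_power k p" for p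
  have nm: "norm (m p) \<le> weight \<sigma> p" for p
    using mult_left_mono[OF norm_sgn_powi_le[of "cg p" k] weight_nonneg[of \<sigma> p]] weight_nonneg[of \<sigma> p]
    by (simp add: m_def norm_mult)
  define f where "f p t = m p * of_real (q t * cos (T * (ln_norm p - v) * t))" for p t
  have ul: "uniform_limit {0..1} (\<lambda>Y t. \<Sum>p\<in>Y. f p t) (\<lambda>t. infsum (\<lambda>p. f p t) P) (finite_subsets_at_top P)"
  proof (rule Weierstrass_m_test_general)
    show "norm (f p t) \<le> weight \<sigma> p * Bq" if "t \<in> {0..1}" for p t
    proof -
      have "\<bar>q t\<bar> * \<bar>cos (T * (ln_norm p - v) * t)\<bar> \<le> Bq * 1"
        by (intro mult_mono Bq that abs_cos_le_one) auto
      thus ?thesis unfolding f_def norm_mult norm_of_real abs_mult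
        by (intro mult_mono nm) (auto simp: weight_nonneg)
    qed
    show "(\<lambda>p. weight \<sigma> p * Bq) summable_on P" by (rule summable_on_cmult_left[OF weight_summable[OF \<sigma>]])
  qed
  have q01: "continuous_on {0..1} q" using q continuous_on_subset by blast
  have cont: "continuous_on {0..1} (\<lambda>t. \<Sum>p\<in>Y. f p t)" for Y
    unfolding f_def by (intro continuous_intros q01)
  obtain I J where IJ: "\<And>Y. ((\<lambda>t. \<Sum>p\<in>Y. f p t) has_integral I Y) {0..1}"
    "((\<lambda>t. infsum (\<lambda>p. f p t) P) has_integral J) {0..1}" "(I \<longlongrightarrow> J) (finite_subsets_at_top P)"
    using uniform_limit_integral[OF ul cont finite_subsets_at_top_neq_bot] by blast
  have "\<forall>\<^sub>F Y in finite_subsets_at_top P. finite Y \<and> Y \<subseteq> P"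
    by (rule eventually_finite_subsets_at_top_weakI) simp
  hence "\<forall>\<^sub>F Y in finite_subsets_at_top P. I Y = (\<Sum>p\<in>Y. of_real (weight \<sigma> p) * (of_real (cosint q (T * (ln_norm p - v))) * angle_power k p))"
  proof eventually_elim
    case (elim Y)
    have "((\<lambda>t. \<Sum>p\<in>Y. f p t) has_integral (\<Sum>p\<in>Y. m p * of_real (cosint q (T * (ln_norm p - v))))) {0..1}"
    proof (intro has_integral_sum)
      fix p
      have "((\<lambda>t. complex_of_real (q t * cos (T * (ln_norm p - v) * t))) has_integral of_real (cosint q (T * (ln_norm p - v)))) {0..1}"
        using has_integral_linear[OF cosint_integral[OF q01] bounded_linear_of_real] by (simp add: o_def)
      thus "(f p has_integral m p * of_real (cosint q (T * (ln_norm p - v)))) {0..1}"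
        unfolding f_def by (rule has_integral_mult_right)
    qed (use elim in simp)
    hence "I Y = (\<Sum>p\<in>Y. m p * of_real (cosint q (T * (ln_norm p - v))))" using IJ(1) has_integral_unique by blast
    thus ?case by (simp add: m_def mult_ac)
  qed
  hence "((\<lambda>Y. \<Sum>p\<in>Y. of_real (weight \<sigma> p) * (of_real (cosint q (T * (ln_norm p - v))) * angle_power k p)) \<longlongrightarrow> J) (finite_subsets_at_top P)"
    by (rule Lim_transform_eventually[OF IJ(3)])
  hence WJ: "weighted_sum (\<lambda>p v. of_real (cosint q (T * (ln_norm p - v))) * angle_power k p) \<sigma> v = J"
    unfolding weighted_sum_def by (intro infsumI) (simp add: has_sum_def)
  have eqs: "infsum (\<lambda>p. f p t) P = of_real (q t) * ((cis (- (T * t * v)) * prime_series k (of_real (1 + \<sigma>) + \<i> * of_real (- (T * t)))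
      + cis (T * t * v) * prime_series k (of_real (1 + \<sigma>) + \<i> * of_real (T * t))) / 2)" for t
  proof (rule infsumI)
    have hs: "(prime_term (angle_power k) (of_real (1 + \<sigma>) + \<i> * of_real y) has_sum prime_series k (of_real (1 + \<sigma>) + \<i> * of_real y)) P" for y
      unfolding prime_series_def by (intro has_sum_infsum prime_term_summable P norm_sgn_powi_le) (use \<sigma> in simp)
    have "((\<lambda>p. of_real (q t) / 2 * (cis (- (T * t * v)) * prime_term (angle_power k) (of_real (1 + \<sigma>) + \<i> * of_real (- (T * t))) p
      + cis (T * t * v) * prime_term (angle_power k) (of_real (1 + \<sigma>) + \<i> * of_real (T * t)) p)) has_sum
       (of_real (q t) / 2 * (cis (- (T * t * v)) * prime_series k (of_real (1 + \<sigma>) + \<i> * of_real (- (T * t)))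
      + cis (T * t * v) * prime_series k (of_real (1 + \<sigma>) + \<i> * of_real (T * t))))) P"
      by (intro has_sum_cmult_right has_sum_add hs)
    moreover have "f p t = of_real (q t) / 2 * (cis (- (T * t * v)) * prime_term (angle_power k) (of_real (1 + \<sigma>) + \<i> * of_real (- (T * t))) p
      + cis (T * t * v) * prime_term (angle_power k) (of_real (1 + \<sigma>) + \<i> * of_real (T * t)) p)" if p: "p \<in> P" for p
    proof -
      define x where "x = T * (ln_norm p - v) * t"
      have pt: "prime_term (angle_power k) (of_real (1 + \<sigma>) + \<i> * of_real y) p = m p * cis (- y * ln_norm p)" for y
        unfolding prime_term_def npow_line[OF p] by (simp add: m_def weight_def mult_ac)
      have "cis (- (T * t * v)) * prime_term (angle_power k) (of_real (1 + \<sigma>) + \<i> * of_real (- (T * t))) p = m p * cis x"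
      proof -
        have "cis (- (T * t * v)) * cis (- (- (T * t)) * ln_norm p) = cis x"
          unfolding cis_mult by (simp add: x_def algebra_simps)
        thus ?thesis unfolding pt by (metis mult.left_commute)
      qed
      moreover have "cis (T * t * v) * prime_term (angle_power k) (of_real (1 + \<sigma>) + \<i> * of_real (T * t)) p = m p * cis (- x)"
      proof -
        have "cis (T * t * v) * cis (- (T * t) * ln_norm p) = cis (- x)"
          unfolding cis_mult by (simp add: x_def algebra_simps)
        thus ?thesis unfolding pt by (metis mult.left_commute)
      qed
      moreover have "cis x + cis (- x) = 2 * of_real (cos x)" by (simp add: complex_eq_iff)
      hence "m p * cis x + m p * cis (- x) = 2 * (m p * of_real (cos x))"
        unfolding distrib_left[symmetric] by simp
      ultimately show ?thesis by (simp add: f_def x_def)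
    qed
    ultimately show "((\<lambda>p. f p t) has_sum of_real (q t) * ((cis (- (T * t * v)) * prime_series k (of_real (1 + \<sigma>) + \<i> * of_real (- (T * t)))
      + cis (T * t * v) * prime_series k (of_real (1 + \<sigma>) + \<i> * of_real (T * t))) / 2)) P"
      by (subst has_sum_cong[of P "\<lambda>p. f p t"]) auto
  qed
  show ?thesis using IJ(2) unfolding WJ eqs .
qed

text \<open>The pole at \<open>s = 1\<close> contributes a Poisson kernel, which carries the mass, and a conjugate kernel.\<close>

lemma pole_pair:
  assumes \<sigma>: "\<sigma> > 0"
  shows "(cis (- a) * (of_real c / (of_real (1 + \<sigma>) + \<i> * of_real (- y) - 1)) + cis a * (of_real c / (of_real (1 + \<sigma>) + \<i> * of_real y - 1))) / 2
     = of_real (c * ((\<sigma> * cos a + y * sin a) / (\<sigma>\<^sup>2 + y\<^sup>2)))"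
proof -
  define z where "z = Complex \<sigma> y"
  have z: "of_real (1 + \<sigma>) + \<i> * of_real y - 1 = z" "of_real (1 + \<sigma>) + \<i> * of_real (- y) - 1 = cnj z"
    by (simp_all add: z_def complex_eq_iff)
  have z0: "z \<noteq> 0" using \<sigma> by (simp add: z_def complex_eq_iff)
  have zz: "z * cnj z = of_real (\<sigma>\<^sup>2 + y\<^sup>2)" by (simp add: z_def complex_eq_iff power2_eq_square)
  have "cis (- a) / cnj z + cis a / z = (cis (- a) * z + cis a * cnj z) / (z * cnj z)"
    using z0 by (simp add: field_simps)
  also have "cis (- a) * z + cis a * cnj z = of_real (2 * (\<sigma> * cos a + y * sin a))"
    by (simp add: z_def complex_eq_iff)
  finally have "cis (- a) / cnj z + cis a / z = of_real (2 * (\<sigma> * cos a + y * sin a) / (\<sigma>\<^sup>2 + y\<^sup>2))"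
    unfolding zz by simp
  note eq = this
  have "(A * (C / Z) + B * (C / Y)) / 2 = C * (A / Z + B / Y) / 2" for A B C Y Z :: complex
    by (simp add: distrib_left mult_ac)
  moreover have "C * complex_of_real (2 * X / D) / 2 = C * of_real (X / D)" for C X D by simp
  ultimately show ?thesis unfolding z by (simp only: eq of_real_mult)
qed

definition regular_part :: "(real \<Rightarrow> real) \<Rightarrow> real \<Rightarrow> int \<Rightarrow> real \<Rightarrow> real \<Rightarrow> real \<Rightarrow> complex" where
  "regular_part q T k v \<sigma> t = of_real (q t) * ((cis (- (T * t * v)) * G k (of_real (1 + \<sigma>) + \<i> * of_real (- (T * t)))
      + cis (T * t * v) * G k (of_real (1 + \<sigma>) + \<i> * of_real (T * t))) / 2)"

lemma regular_part_continuous: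
  assumes q: "continuous_on UNIV q"
  shows "continuous_on ({0..1} \<times> {0..1}) (\<lambda>(\<sigma>, t). regular_part q T k v \<sigma> t)"
  unfolding regular_part_def case_prod_unfold
  by (intro continuous_intros continuous_on_compose2[OF G[of k]] continuous_on_compose2[OF q]) auto

lemma regular_part_tendsto:
  assumes q: "continuous_on UNIV q"
  shows "((\<lambda>\<sigma>. integral {0..1} (regular_part q T k v \<sigma>)) \<longlongrightarrow> integral {0..1} (regular_part q T k v 0)) (at_right 0)"
proof -
  have "continuous_on {0..1} (\<lambda>\<sigma>. integral (cbox 0 1) (regular_part q T k v \<sigma>))"
    by (rule integral_continuous_on_param) (use regular_part_continuous[OF q] in simp)
  hence "((\<lambda>\<sigma>. integral {0..1} (regular_part q T k v \<sigma>)) \<longlongrightarrow> integral {0..1} (regular_part q T k v 0)) (at 0 within {0..1})"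
    by (auto simp: continuous_on_def)
  thus ?thesis by (simp add: at_within_Icc_at_right)
qed

text \<open>At \<open>\<sigma> = 0\<close> the parameter \<open>v\<close> occurs only in the
  oscillating factors, so the Riemann-Lebesgue lemma removes this part.\<close>

lemma regular_part_decay:
  assumes q: "continuous_on UNIV q" and T: "T > 0"
  shows "((\<lambda>v. integral {0..1} (regular_part q T k v 0)) \<longlongrightarrow> 0) at_top"
proof -
  define h where "h e t = of_real (q t) * G k (1 + \<i> * of_real (e * (T * t))) / 2" for e t :: real
  have h: "continuous_on {0..1} (h e)" for e
    unfolding h_def by (intro continuous_intros continuous_on_compose2[OF G[of k]] continuous_on_compose2[OF q]) auto
  have "((\<lambda>v. integral {0..1} (\<lambda>t. h (- 1) t * cis (- T * t * v)) + integral {0..1} (\<lambda>t. h 1 t * cis (T * t * v))) \<longlongrightarrow> 0 + 0) at_top"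
    by (intro tendsto_add riemann_lebesgue_scaled h) (use T in auto)
  moreover have "integral {0..1} (\<lambda>t. h (- 1) t * cis (- T * t * v)) + integral {0..1} (\<lambda>t. h 1 t * cis (T * t * v))
     = integral {0..1} (regular_part q T k v 0)" for v
  proof -
    have "integral {0..1} (\<lambda>t. h (- 1) t * cis (- T * t * v)) + integral {0..1} (\<lambda>t. h 1 t * cis (T * t * v))
      = integral {0..1} (\<lambda>t. h (- 1) t * cis (- T * t * v) + h 1 t * cis (T * t * v))"
      by (rule integral_add[symmetric]; intro integrable_continuous_real continuous_intros h)
    also have "\<dots> = integral {0..1} (regular_part q T k v 0)"
      by (rule arg_cong[of _ _ "integral {0..1}"]) (simp add: fun_eq_iff regular_part_def h_def algebra_simps add_divide_distrib)
    finally show ?thesis .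
  qed
  ultimately show ?thesis by simp
qed

definition polar_part :: "(real \<Rightarrow> real) \<Rightarrow> real \<Rightarrow> real \<Rightarrow> real \<Rightarrow> real \<Rightarrow> real" where
  "polar_part q T v \<sigma> t = q t * ((\<sigma> * cos (T * t * v) + (T * t) * sin (T * t * v)) / (\<sigma>\<^sup>2 + (T * t)\<^sup>2))"

lemma polar_part_continuous:
  assumes q: "continuous_on UNIV q" and T: "T > 0" and \<sigma>: "\<sigma> > 0"
  shows "continuous_on {0..1} (polar_part q T v \<sigma>)"
  unfolding polar_part_def using poisson_denominator[OF T \<sigma>]
  by (intro continuous_intros continuous_on_subset[OF q]) (auto simp: less_imp_neq[THEN not_sym])

text \<open>With \<open>y = T * t\<close> and \<open>a = y * v\<close>, the conjugate kernel
  \<open>y sin a / (\<sigma>^2 + y^2)\<close> falls short of its limit \<open>v * sinc a\<close> by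
  the fraction \<open>\<sigma>^2 / (\<sigma>^2 + y^2)\<close>. This error is \<open>\<sigma>\<close>
  times a bounded Poisson integral and disappears.\<close>

lemma polar_part_tendsto:
  assumes q: "continuous_on UNIV q" "(q has_real_derivative d) (at 0)" and T: "T > 0"
  shows "((\<lambda>\<sigma>. integral {0..1} (polar_part q T v \<sigma>)) \<longlongrightarrow> q 0 * (pi / (2 * T)) + integral {0..1} (\<lambda>t. q t * (v * sinc (T * t * v)))) (at_right 0)"
proof -
  define w where "w \<sigma> t = \<sigma> / (\<sigma>\<^sup>2 + (T * t)\<^sup>2)" for \<sigma> t :: real
  define h where "h t = q t * cos (T * t * v)" for t
  define e where "e t = q t * (v * sinc (T * t * v))" for t
  have hc: "continuous_on UNIV h" unfolding h_def by (intro continuous_intros q)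
  have ec: "continuous_on UNIV e" unfolding e_def by (intro continuous_intros q continuous_on_compose2[OF continuous_on_sinc]) auto
  have hd: "(h has_real_derivative d) (at 0)"
    unfolding h_def by (rule derivative_eq_intros q(2) refl | simp)+
  obtain B where B: "B \<ge> 0" "\<And>t. t \<in> {0..1} \<Longrightarrow> \<bar>e t\<bar> \<le> B" using bounded_continuous_Icc[OF ec] by blast
  have wc: "continuous_on {0..1} (\<lambda>t. k t * w \<sigma> t)" if "\<sigma> > 0" "continuous_on UNIV k" for k :: "real \<Rightarrow> real" and \<sigma>
    unfolding w_def using poisson_denominator[OF T that(1)]
    by (intro continuous_intros continuous_on_subset[OF that(2)]) (auto simp: less_imp_neq[THEN not_sym])
  have l1: "((\<lambda>\<sigma>. integral {0..1} (\<lambda>t. h t * w \<sigma> t)) \<longlongrightarrow> q 0 * (pi / (2 * T))) (at_right 0)"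
    using poisson_kernel_limit[OF T hc hd] by (simp add: w_def h_def)
  have l2: "((\<lambda>\<sigma>. \<sigma> * integral {0..1} (\<lambda>t. e t * w \<sigma> t)) \<longlongrightarrow> 0) (at_right 0)"
  proof (rule Lim_null_comparison)
    show "\<forall>\<^sub>F \<sigma> in at_right 0. norm (\<sigma> * integral {0..1} (\<lambda>t. e t * w \<sigma> t)) \<le> \<sigma> * (B * (arctan (T / \<sigma>) / T))"
      using eventually_pos
    proof eventually_elim
      case (elim \<sigma>)
      have "\<bar>integral {0..1} (\<lambda>t. e t * w \<sigma> t)\<bar> \<le> B * (arctan (T / \<sigma>) / T)"
        by (rule weighted_integral_bound[OF wc[OF elim ec] B(2)])
           (use poisson_integral[OF T elim] elim in \<open>auto simp: w_def\<close>)
      from mult_left_mono[OF this, of \<sigma>] elim show ?case unfolding real_norm_def abs_mult by simp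
    qed
    have "((\<lambda>\<sigma>. \<sigma> * (B * (arctan (T / \<sigma>) / T))) \<longlongrightarrow> 0 * (B * (pi / (2 * T)))) (at_right 0)"
      by (intro tendsto_mult tendsto_mult_left poisson_limits(1)[OF T] tendsto_ident_at tendsto_const)
    thus "((\<lambda>\<sigma>. \<sigma> * (B * (arctan (T / \<sigma>) / T))) \<longlongrightarrow> 0) (at_right 0)" by simp
  qed
  have "((\<lambda>\<sigma>. integral {0..1} (\<lambda>t. h t * w \<sigma> t) + integral {0..1} e - \<sigma> * integral {0..1} (\<lambda>t. e t * w \<sigma> t)) \<longlongrightarrow>
      q 0 * (pi / (2 * T)) + integral {0..1} e - 0) (at_right 0)"
    by (intro tendsto_diff tendsto_add l1 l2 tendsto_const)
  moreover have "\<forall>\<^sub>F \<sigma> in at_right 0. integral {0..1} (\<lambda>t. h t * w \<sigma> t) + integral {0..1} e - \<sigma> * integral {0..1} (\<lambda>t. e t * w \<sigma> t)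
      = integral {0..1} (polar_part q T v \<sigma>)"
    using eventually_pos
  proof eventually_elim
    case (elim \<sigma>)
    have "((\<lambda>t. h t * w \<sigma> t + e t - \<sigma> * (e t * w \<sigma> t)) has_integral
      (integral {0..1} (\<lambda>t. h t * w \<sigma> t) + integral {0..1} e - \<sigma> * integral {0..1} (\<lambda>t. e t * w \<sigma> t))) {0..1}"
      by (intro has_integral_diff has_integral_add has_integral_mult_right integrable_integral integrable_continuous_real
          wc elim hc ec continuous_on_subset[OF ec]) auto
    moreover have "h t * w \<sigma> t + e t - \<sigma> * (e t * w \<sigma> t) = polar_part q T v \<sigma> t" for t
    proof -
      define D where "D = \<sigma>\<^sup>2 + (T * t)\<^sup>2"
      have D: "D > 0" unfolding D_def by (rule poisson_denominator[OF T elim])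
      have s: "T * t * sin (T * t * v) = (T * t)\<^sup>2 * (v * sinc (T * t * v))" by (auto simp: power2_eq_square)
      have w: "w \<sigma> t = \<sigma> / D" by (simp add: w_def D_def)
      have "e t - \<sigma> * (e t * w \<sigma> t) = e t * ((D - \<sigma>\<^sup>2) / D)"
        unfolding w using D by (simp add: power2_eq_square field_simps)
      also have "\<dots> = q t * (T * t * sin (T * t * v) / D)" unfolding s by (simp add: D_def e_def)
      finally have E: "e t - \<sigma> * (e t * w \<sigma> t) = q t * (T * t * sin (T * t * v) / D)" .
      show ?thesis
        unfolding add_diff_eq[symmetric] E unfolding w polar_part_def D_def[symmetric]
        by (simp add: h_def add_divide_distrib distrib_left mult_ac)
    qed
    ultimately show ?case by (simp only: integral_unique)
  qed
  ultimately show ?thesis unfolding e_def by (simp add: Lim_transform_eventually)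
qed

text \<open>For \<open>k = 0\<close> the pole contributes \<open>c * q 0 * pi / (2 * T)\<close>
  twice: from the Poisson kernel as \<open>\<sigma>\<close> tends to 0, and from the Dirichlet
  kernel as \<open>v\<close> tends to infinity. For other \<open>k\<close> there is no pole, and
  only the decaying regular part is present.\<close>

lemma mean_tends_cosint:
  assumes q: "continuous_on UNIV q" "(q has_real_derivative d) (at 0)" and T: "T > 0"
  shows "mean_tends (\<lambda>p v. of_real (cosint q (T * (ln_norm p - v))) * angle_power k p) (if k = 0 then of_real (c * q 0 * pi / T) else 0)"
proof -
  define \<Lambda> where "\<Lambda> v = integral {0..1} (regular_part q T k v 0) + (if k = 0 then
     of_real (c * (q 0 * (pi / (2 * T)) + integral {0..1} (\<lambda>t. q t * (v * sinc (T * t * v))))) else 0)" for v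
  obtain B where B: "\<And>x. \<bar>cosint q x\<bar> \<le> B" using abs_cosint_le[OF q(1)] by blast
  have t1: "norm (of_real (cosint q (T * (ln_norm p - v))) * angle_power k p) \<le> B * 1" for p v
    unfolding norm_mult norm_of_real by (intro mult_mono B norm_sgn_powi_le) (use B[of 0] in auto)
  have t2: "((\<lambda>\<sigma>. weighted_sum (\<lambda>p v. of_real (cosint q (T * (ln_norm p - v))) * angle_power k p) \<sigma> v) \<longlongrightarrow> \<Lambda> v) (at_right 0)" for v
  proof (rule Lim_transform_eventually)
    show "((\<lambda>\<sigma>. integral {0..1} (regular_part q T k v \<sigma>) + (if k = 0 then of_real (c * integral {0..1} (polar_part q T v \<sigma>)) else 0)) \<longlongrightarrow> \<Lambda> v) (at_right 0)"
    proof (cases "k = 0")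
      case True
      have "((\<lambda>\<sigma>. integral {0..1} (regular_part q T k v \<sigma>) + of_real (c * integral {0..1} (polar_part q T v \<sigma>))) \<longlongrightarrow>
          integral {0..1} (regular_part q T k v 0) + of_real (c * (q 0 * (pi / (2 * T)) + integral {0..1} (\<lambda>t. q t * (v * sinc (T * t * v)))))) (at_right 0)"
        by (intro tendsto_add regular_part_tendsto q tendsto_of_real tendsto_mult_left polar_part_tendsto[OF q T])
      thus ?thesis using True by (simp add: \<Lambda>_def)
    next
      case False
      thus ?thesis using regular_part_tendsto[OF q(1)] by (simp add: \<Lambda>_def)
    qed
    show "\<forall>\<^sub>F \<sigma> in at_right 0. integral {0..1} (regular_part q T k v \<sigma>) + (if k = 0 then of_real (c * integral {0..1} (polar_part q T v \<sigma>)) else 0)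
        = weighted_sum (\<lambda>p v. of_real (cosint q (T * (ln_norm p - v))) * angle_power k p) \<sigma> v"
      using eventually_pos eventually_at_right_less[of 0]
    proof eventually_elim
      case (elim \<sigma>)
      have rc: "continuous_on {0..1} (regular_part q T k v \<sigma>)"
        unfolding regular_part_def using elim(1)
        by (intro continuous_intros continuous_on_compose2[OF G[of k]] continuous_on_compose2[OF q(1)]) auto
      have "((\<lambda>t. regular_part q T k v \<sigma> t + (if k = 0 then of_real (c * polar_part q T v \<sigma> t) else 0)) has_integral
         (integral {0..1} (regular_part q T k v \<sigma>) + (if k = 0 then of_real (c * integral {0..1} (polar_part q T v \<sigma>)) else 0))) {0..1}"
      proof (intro has_integral_add integrable_integral integrable_continuous_real rc)
        have "((\<lambda>t. complex_of_real (c * polar_part q T v \<sigma> t)) has_integral of_real (c * integral {0..1} (polar_part q T v \<sigma>))) {0..1}"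
          using has_integral_linear[OF has_integral_mult_right[OF integrable_integral[OF integrable_continuous_real[OF polar_part_continuous[OF q(1) T elim(1)]]], of c] bounded_linear_of_real[where 'a = complex]]
          by (simp add: o_def)
        thus "((\<lambda>t. if k = 0 then of_real (c * polar_part q T v \<sigma> t) else 0) has_integral (if k = 0 then complex_of_real (c * integral {0..1} (polar_part q T v \<sigma>)) else 0)) {0..1}"
          by simp
      qed
      moreover have "regular_part q T k v \<sigma> t + (if k = 0 then of_real (c * polar_part q T v \<sigma> t) else 0)
         = of_real (q t) * ((cis (- (T * t * v)) * prime_series k (of_real (1 + \<sigma>) + \<i> * of_real (- (T * t)))
            + cis (T * t * v) * prime_series k (of_real (1 + \<sigma>) + \<i> * of_real (T * t))) / 2)" for t
      proof -
        have prime_series: "prime_series k (of_real (1 + \<sigma>) + \<i> * of_real y) = G k (of_real (1 + \<sigma>) + \<i> * of_real y)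
           + (if k = 0 then of_real c / (of_real (1 + \<sigma>) + \<i> * of_real y - 1) else 0)" for y
          unfolding prime_series_def by (rule S) (use elim in simp)
        show ?thesis
        proof (cases "k = 0")
          case True
          have "of_real (c * polar_part q T v \<sigma> t) = of_real (q t) * complex_of_real (c * ((\<sigma> * cos (T * t * v) + (T * t) * sin (T * t * v)) / (\<sigma>\<^sup>2 + (T * t)\<^sup>2)))"
            by (simp add: polar_part_def mult_ac)
          also have "\<dots> = of_real (q t) * ((cis (- (T * t * v)) * (of_real c / (of_real (1 + \<sigma>) + \<i> * of_real (- (T * t)) - 1))
             + cis (T * t * v) * (of_real c / (of_real (1 + \<sigma>) + \<i> * of_real (T * t) - 1))) / 2)"
            by (simp only: pole_pair[OF elim(1), symmetric])
          finally have e: "of_real (c * polar_part q T v \<sigma> t) = of_real (q t) * ((cis (- (T * t * v)) * (of_real c / (of_real (1 + \<sigma>) + \<i> * of_real (- (T * t)) - 1))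
             + cis (T * t * v) * (of_real c / (of_real (1 + \<sigma>) + \<i> * of_real (T * t) - 1))) / 2)" .
          have alg: "Q * ((A * X + B' * Y) / 2) + Q * ((A * X' + B' * Y') / 2) = Q * ((A * (X + X') + B' * (Y + Y')) / 2)"
            for Q A B' X X' Y Y' :: complex by (simp add: field_simps)
          show ?thesis unfolding prime_series regular_part_def if_P[OF True] e by (rule alg)
        next
          case False
          show ?thesis unfolding prime_series regular_part_def if_not_P[OF False] add_0_right ..
        qed
      qed
      ultimately show ?case
        using has_integral_unique[OF weighted_sum_cosint[OF q(1) elim(1)]] by simp
    qed
  qed
  have t3: "(\<Lambda> \<longlongrightarrow> (if k = 0 then of_real (c * q 0 * pi / T) else 0)) at_top"
  proof (cases "k = 0")
    case True
    have "((\<lambda>v. integral {0..1} (regular_part q T k v 0) + of_real (c * (q 0 * (pi / (2 * T)) + integral {0..1} (\<lambda>t. q t * (v * sinc (T * t * v)))))) \<longlongrightarrow>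
       0 + complex_of_real (c * (q 0 * (pi / (2 * T)) + q 0 * (pi / (2 * T))))) at_top"
      by (intro tendsto_add regular_part_decay q T tendsto_of_real tendsto_mult_left dirichlet_kernel_limit[OF T q] tendsto_const)
    moreover have "c * (q 0 * (pi / (2 * T)) + q 0 * (pi / (2 * T))) = c * q 0 * pi / T" using T by (simp add: field_simps)
    ultimately show ?thesis unfolding \<Lambda>_def[abs_def] if_P[OF True] by (simp only: add_0)
  next
    case False
    thus ?thesis using regular_part_decay[OF q(1) T] by (simp add: \<Lambda>_def[abs_def])
  qed
  show ?thesis by (rule mean_tendsI[OF t1 t2 t3])
qed

end

text \<open>This is \<open>(1 + u)^(2M) / u^M\<close>, on the unit circle the nonnegative
  trigonometric polynomial \<open>|1 + u|^(2M)\<close>, concentrated near \<open>u = 1\<close>. Its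
  constant term is the central binomial coefficient.\<close>

definition fejer :: "nat \<Rightarrow> complex \<Rightarrow> complex" where
  "fejer M u = (\<Sum>j\<le>2 * M. of_nat (2 * M choose j) * u powi (int j - int M))"

lemma fejer_eq:
  assumes u: "norm u = 1"
  shows "fejer M u = of_real (norm (1 + u) ^ (2 * M))"
proof -
  have u0: "u \<noteq> 0" using u by auto
  have "u powi (int j - int M) * u ^ M = u ^ j" for j
    using u0 by (simp add: power_int_diff)
  hence "fejer M u * u ^ M = (\<Sum>j\<le>2 * M. of_nat (2 * M choose j) * u ^ j)"
    unfolding fejer_def sum_distrib_right by (simp add: mult.assoc)
  also have "\<dots> = (1 + u) ^ (2 * M)"
    using binomial_ring[of u 1 "2 * M"] by (simp add: add.commute)
  also have "\<dots> = (of_real ((norm (1 + u))\<^sup>2) * u) ^ M"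
  proof -
    have uc: "u * cnj u = 1" using complex_norm_square[of u] u by simp
    have "of_real ((norm (1 + u))\<^sup>2) * u = (1 + u) * (u + u * cnj u)"
      unfolding complex_norm_square by (simp add: algebra_simps)
    hence "(1 + u)\<^sup>2 = of_real ((norm (1 + u))\<^sup>2) * u"
      unfolding uc by (simp add: power2_eq_square add.commute)
    thus ?thesis by (simp add: power_mult)
  qed
  also have "\<dots> = of_real (norm (1 + u) ^ (2 * M)) * u ^ M"
    by (simp add: power_mult_distrib power_mult)
  finally show ?thesis using u0 by simp
qed

text \<open>The constant terms of \<open>fejer (Suc M)\<close> and \<open>fejer M\<close> have ratio
  \<open>4 - 2 / (M + 1)\<close>. Hence the mean of \<open>|1 - u|^2\<close> against
  \<open>|1 + u|^(2M)\<close> is \<open>2 / (M + 1)\<close>, which becomes small.\<close>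

lemma central_binomial_Suc:
  "Suc M * (2 * Suc M choose Suc M) = 2 * (2 * M + 1) * (2 * M choose M)"
proof -
  have "Suc M * (2 * Suc M choose Suc M) = Suc (Suc (2 * M)) * (Suc (2 * M) choose M)"
    using Suc_times_binomial_eq[of "Suc (2 * M)" M] by simp
  also have "(Suc (2 * M) choose M) = (Suc (2 * M) choose Suc M)"
    using binomial_symmetric[of M "Suc (2 * M)"] by (simp add: Suc_diff_le)
  also have "Suc (Suc (2 * M)) * (Suc (2 * M) choose Suc M) = 2 * ((Suc (2 * M) choose Suc M) * Suc M)"
    by (simp only: mult_ac) simp
  also have "(Suc (2 * M) choose Suc M) * Suc M = Suc (2 * M) * (2 * M choose M)"
    by (rule Suc_times_binomial_eq[symmetric])
  finally show ?thesis by (simp only: Suc_eq_plus1 mult.assoc)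
qed

context prime_density begin

text \<open>Only the term \<open>j = M\<close>, of angular exponent 0, has a nonzero mean, and the
  rotation by \<open>\<omega>\<close> does not affect that term.\<close>

lemma mean_tends_fejer:
  assumes q: "continuous_on UNIV q" "(q has_real_derivative d) (at 0)" and T: "T > 0" and \<omega>: "\<omega> \<noteq> 0"
  shows "mean_tends (\<lambda>p v. of_real (cosint q (T * (ln_norm p - v))) * fejer M (\<omega> * sgn (cg p)))
    (of_nat (2 * M choose M) * of_real (c * q 0 * pi / T))"
proof -
  define z where "z j = of_nat (2 * M choose j) * \<omega> powi (int j - int M)" for j
  define L where "L = complex_of_real (c * q 0 * pi / T)"
  have "mean_tends (\<lambda>p v. \<Sum>j\<le>2 * M. z j * (of_real (cosint q (T * (ln_norm p - v))) * angle_power (int j - int M) p))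
     (\<Sum>j\<le>2 * M. z j * (if int j - int M = 0 then L else 0))"
    unfolding L_def by (intro mean_tends_sum mean_tends_cmult mean_tends_cosint[OF q T]) simp
  moreover have "(\<Sum>j\<le>2 * M. z j * (of_real (cosint q (T * (ln_norm p - v))) * angle_power (int j - int M) p))
      = of_real (cosint q (T * (ln_norm p - v))) * fejer M (\<omega> * sgn (cg p))" for p v
    unfolding fejer_def z_def power_int_mult_distrib sum_distrib_left by (intro sum.cong) (auto simp: mult_ac)
  moreover have "(\<Sum>j\<le>2 * M. z j * (if int j - int M = 0 then L else 0)) = of_nat (2 * M choose M) * L"
  proof -
    have "(\<Sum>j\<le>2 * M. z j * (if int j - int M = 0 then L else 0)) = (\<Sum>j\<le>2 * M. if j = M then z j * L else 0)"
      by (intro sum.cong) auto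
    thus ?thesis by (simp add: z_def)
  qed
  ultimately show ?thesis by (simp add: L_def)
qed

lemma Re_weighted_sum_nonpos:
  assumes "\<sigma> > 0" "\<And>p v. norm (f p v) \<le> B" "\<And>p. p \<in> P \<Longrightarrow> Re (f p v) \<le> 0"
  shows "Re (weighted_sum f \<sigma> v) \<le> 0"
proof -
  have "Re (weighted_sum f \<sigma> v) = (\<Sum>\<^sub>\<infinity>p\<in>P. Re (of_real (weight \<sigma> p) * f p v))"
    unfolding weighted_sum_def by (rule infsum_Re[symmetric]) (rule weighted_sum_summable[OF assms(1,2)])
  moreover have "0 \<le> (\<Sum>\<^sub>\<infinity>p\<in>P. - Re (of_real (weight \<sigma> p) * f p v))"
    using assms(3) weight_nonneg by (intro infsum_nonneg) (auto simp: mult_nonneg_nonpos)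
  ultimately show ?thesis by (simp add: infsum_uminus)
qed

text \<open>If all primes gave nonpositive values at \<open>v\<close>, the weighted sums would be
  nonpositive for every \<open>\<sigma> > 0\<close>, although they tend to
  \<open>\<Lambda> v\<close>, which has positive real part for large \<open>v\<close>.\<close>

lemma mean_tends_positive:
  assumes "mean_tends f L" "Re L > 0"
  shows "\<forall>\<^sub>F v in at_top. \<exists>p\<in>P. Re (f p v) > 0"
proof -
  obtain B \<Lambda> where 1: "\<And>p v. norm (f p v) \<le> B" "\<And>v. ((\<lambda>\<sigma>. weighted_sum f \<sigma> v) \<longlongrightarrow> \<Lambda> v) (at_right 0)" "(\<Lambda> \<longlongrightarrow> L) at_top"
    using assms(1) unfolding mean_tends_def by blast
  have "\<forall>\<^sub>F v in at_top. Re (\<Lambda> v) > 0"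
    by (rule order_tendstoD(1)[OF tendsto_Re[OF 1(3)] assms(2)])
  thus ?thesis
  proof eventually_elim
    case (elim v)
    have "\<forall>\<^sub>F \<sigma> in at_right 0. Re (weighted_sum f \<sigma> v) > 0"
      by (rule order_tendstoD(1)[OF tendsto_Re[OF 1(2)] elim])
    then obtain \<sigma> where \<sigma>: "\<sigma> > 0" "Re (weighted_sum f \<sigma> v) > 0"
      using eventually_happens[OF eventually_conj[OF eventually_pos]] trivial_limit_at_right_real by blast
    show ?case
    proof (rule ccontr)
      assume "\<not> ?case"
      hence "Re (f p v) \<le> 0" if "p \<in> P" for p using that by (meson not_le)
      have "Re (weighted_sum f \<sigma> v) \<le> 0" by (rule Re_weighted_sum_nonpos[OF \<sigma>(1), of f B v]) (rule 1(1), rule \<open>\<And>p. p \<in> P \<Longrightarrow> _\<close>)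
      with \<sigma>(2) show False by simp
    qed
  qed
qed

text \<open>The test function is \<open>K(x) |1 + u|^(2M) (3 \<pi>^2 - x^2 - C/2 |1 - u|^2)\<close> with \<open>x = T (ln N(p) - v)\<close> and
  \<open>u = \<omega> p/|p|\<close>. Its mean is a positive multiple of \<open>2 \<pi>^2 - C/(M + 1)\<close>, hence positive for large \<open>M\<close>.\<close>

lemma prime_in_window:
  assumes \<epsilon>: "\<epsilon> > 0" and \<omega>: "norm \<omega> = 1"
  shows "\<forall>\<^sub>F v in at_top. \<exists>p\<in>P. \<bar>ln_norm p - v\<bar> < \<epsilon> \<and> norm (1 - \<omega> * sgn (cg p)) < \<epsilon>"
proof -
  \<comment> \<open>Positivity of the test function will give \<open>X^2 < 3 pi^2 < 49\<close>, so
    dividing by this \<open>T\<close> leaves less than \<open>\<epsilon>\<close>.\<close>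
  define T where "T = 7 / \<epsilon>"
  \<comment> \<open>Chosen so that \<open>C / 2 * \<epsilon>^2 = 3 pi^2\<close>: a positive bracket
    then forces \<open>|1 - u| < \<epsilon>\<close>.\<close>
  define C where "C = 6 * pi\<^sup>2 / \<epsilon>\<^sup>2"
  have T: "T > 0" and C: "C > 0" using \<epsilon> by (simp_all add: T_def C_def)
  have \<omega>0: "\<omega> \<noteq> 0" using \<omega> by auto
  obtain M :: nat where M: "C / (2 * pi\<^sup>2) < real M" using reals_Archimedean2 by blast
  define x where "x p v = T * (ln_norm p - v)" for p v
  define u where "u p = \<omega> * sgn (cg p)" for p
  define b where "b = real (2 * M choose M)"
  \<comment> \<open>On the circle \<open>|1 - u|^2 = 4 - |1 + u|^2\<close>, so the penalty
    \<open>- C / 2 * |1 - u|^2\<close> splits into \<open>- 2 * C\<close> and \<open>C / 2\<close>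
    times the next even power of \<open>|1 + u|\<close>. The factor \<open>2 * pi^2\<close> clears
    the denominator in the transform of \<open>qF\<close>.\<close>
  define f where "f p v = of_real (2 * pi\<^sup>2) * (of_real (cosint qF (x p v)) * fejer M (u p))
     + (of_real (- 2 * C) * (of_real (cosint qK (x p v)) * fejer M (u p))
     + of_real (C / 2) * (of_real (cosint qK (x p v)) * fejer (Suc M) (u p)))" for p v
  define L where "L = 2 * pi\<^sup>2 * (b * (c * pi / T)) + (- 2 * C * (b * (c * pi / T)) + C / 2 * (real (2 * Suc M choose Suc M) * (c * pi / T)))"
  have mean_tends: "mean_tends f (of_real L)"
  proof -
    have "mean_tends f (of_real (2 * pi\<^sup>2) * (of_nat (2 * M choose M) * of_real (c * qF 0 * pi / T))
      + (of_real (- 2 * C) * (of_nat (2 * M choose M) * of_real (c * qK 0 * pi / T))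
      + of_real (C / 2) * (of_nat (2 * Suc M choose Suc M) * of_real (c * qK 0 * pi / T))))"
      unfolding f_def x_def u_def
      by (intro mean_tends_add mean_tends_cmult mean_tends_fejer[OF q_continuous(1) q_deriv(1) T \<omega>0] mean_tends_fejer[OF q_continuous(3) q_deriv(3) T \<omega>0])
    thus ?thesis by (simp add: L_def b_def)
  qed
  have "L > 0"
  proof -
    have b: "b > 0" by (simp add: b_def)
    have "(real M + 1) * real (2 * Suc M choose Suc M) = 2 * (2 * real M + 1) * b"
      using arg_cong[OF central_binomial_Suc[of M], of real]
      unfolding b_def of_nat_mult of_nat_Suc of_nat_add of_nat_numeral of_nat_1 by (simp only: add.commute)
    moreover have "real M + 1 > 0" by simp
    ultimately have bb: "real (2 * Suc M choose Suc M) = 2 * (2 * real M + 1) * b / (real M + 1)"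
      by (metis less_irrefl nonzero_mult_div_cancel_left)
    have "L = b * (c * pi / T) * (2 * pi\<^sup>2 - 2 * C + C * ((2 * real M + 1) / (real M + 1)))"
      unfolding L_def bb by (simp add: algebra_simps)
    also have "2 * pi\<^sup>2 - 2 * C + C * ((2 * real M + 1) / (real M + 1)) = 2 * pi\<^sup>2 - C / (real M + 1)"
      by (simp add: field_simps)
    finally have L: "L = b * (c * pi / T) * (2 * pi\<^sup>2 - C / (real M + 1))" .
    have "C < real M * (2 * pi\<^sup>2)" using M by (simp add: field_simps)
    also have "\<dots> \<le> (real M + 1) * (2 * pi\<^sup>2)" by (intro mult_right_mono) auto
    finally have "C / (real M + 1) < 2 * pi\<^sup>2" by (simp add: field_simps)
    thus ?thesis unfolding L using b c T by (intro mult_pos_pos) auto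
  qed
  hence "\<forall>\<^sub>F v in at_top. \<exists>p\<in>P. Re (f p v) > 0" by (intro mean_tends_positive[OF mean_tends]) simp
  thus ?thesis
  proof eventually_elim
    case (elim v)
    then obtain p where p: "p \<in> P" "Re (f p v) > 0" by blast
    have "cg p \<noteq> 0" using p P by (auto simp: gauss_primes_def complex_of_gauss_int_eq_0_iff)
    hence u1: "norm (u p) = 1" by (simp add: u_def norm_mult \<omega> norm_sgn)
    define X K A where "X = x p v" and "K = cosint qK X" and "A = norm (1 + u p) ^ (2 * M)"
    have pr: "(norm (1 + u p))\<^sup>2 = 4 - (norm (1 - u p))\<^sup>2"
    proof -
      have "(norm (1 + u p))\<^sup>2 + (norm (1 - u p))\<^sup>2 = 2 + 2 * (norm (u p))\<^sup>2"
        unfolding cmod_power2 by (simp add: power2_eq_square algebra_simps)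
      thus ?thesis by (simp add: u1)
    qed
    have A2: "norm (1 + u p) ^ (2 * Suc M) = (norm (1 + u p))\<^sup>2 * A"
      by (simp add: A_def power2_eq_square)
    have "f p v = of_real (2 * pi\<^sup>2 * (cosint qF X * A) + (- 2 * C * (K * A) + C / 2 * (K * ((norm (1 + u p))\<^sup>2 * A))))"
      unfolding f_def fejer_eq[OF u1] A2 X_def[symmetric] K_def[symmetric] A_def[symmetric] by (simp only: of_real_mult of_real_add)
    hence "Re (f p v) = 2 * pi\<^sup>2 * cosint qF X * A + (- 2 * C * (K * A) + C / 2 * (K * ((norm (1 + u p))\<^sup>2 * A)))" by simp
    also have "\<dots> = K * A * (3 * pi\<^sup>2 - X\<^sup>2 - C / 2 * (norm (1 - u p))\<^sup>2)"
      unfolding cosint_F pr K_def[symmetric] by (simp add: algebra_simps)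
    finally have "K * A * (3 * pi\<^sup>2 - X\<^sup>2 - C / 2 * (norm (1 - u p))\<^sup>2) > 0" using p by simp
    moreover have "K * A \<ge> 0" by (simp add: K_def A_def cosint_K_nonneg)
    ultimately have pos: "3 * pi\<^sup>2 - X\<^sup>2 - C / 2 * (norm (1 - u p))\<^sup>2 > 0" by (simp add: zero_less_mult_iff)
    have "C / 2 * (norm (1 - u p))\<^sup>2 < 3 * pi\<^sup>2" using pos zero_le_power2[of X] by linarith
    also have "3 * pi\<^sup>2 = C / 2 * \<epsilon>\<^sup>2" using \<epsilon> by (simp add: C_def)
    finally have "(norm (1 - u p))\<^sup>2 < \<epsilon>\<^sup>2" using C by simp
    hence 1: "norm (1 - u p) < \<epsilon>" using \<epsilon> by (simp add: power2_less_imp_less)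
    have "X\<^sup>2 < 3 * pi\<^sup>2" 
    proof -
      have "0 \<le> C / 2 * (norm (1 - u p))\<^sup>2" using C by simp
      thus ?thesis using pos by linarith
    qed
    also have "pi\<^sup>2 < 4\<^sup>2" by (rule power_strict_mono) (use pi_less_4 pi_gt_zero in auto)
    hence "3 * pi\<^sup>2 < 7\<^sup>2" by simp
    finally have "\<bar>X\<bar> < 7" by (metis abs_le_square_iff abs_numeral not_le)
    hence "\<bar>ln_norm p - v\<bar> < \<epsilon>" using \<epsilon> by (simp add: X_def x_def T_def abs_mult field_simps)
    thus ?case using 1 p(1) unfolding u_def by blast
  qed
qed

end

section \<open>Quotients of primes\<close>

context gauss_mod begin

lemma progression_prime_in_window:
  assumes b: "coprime b g" and "\<epsilon> > 0" "norm \<omega> = 1"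
  shows "\<forall>\<^sub>F v in at_top. \<exists>p. prime_elem p \<and> g dvd b - p \<and> \<bar>ln_norm p - v\<bar> < \<epsilon> \<and> norm (1 - \<omega> * sgn (cg p)) < \<epsilon>"
proof -
  define c where "c = 4 / real (card {\<phi>. gchar \<phi>})"
  have "\<forall>k. \<exists>G. continuous_on {s. Re s \<ge> 1} G \<and>
    (\<forall>s. Re s > 1 \<longrightarrow> infsum (prime_term (\<lambda>a. sgn (cg a) powi k) s) {p \<in> gauss_primes. p \<simeq> b} = G s + (if k = 0 then of_real c / (s - 1) else 0))"
    unfolding c_def using progression_prime_sum[OF b] by blast
  from choice[OF this] obtain G where G: "\<And>k. continuous_on {s. Re s \<ge> 1} (G k)"
    "\<And>k s. Re s > 1 \<Longrightarrow> infsum (prime_term (\<lambda>a. sgn (cg a) powi k) s) {p \<in> gauss_primes. p \<simeq> b} = G k s + (if k = 0 then of_real c / (s - 1) else 0)"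
    by blast
  interpret prime_density "{p \<in> gauss_primes. p \<simeq> b}" c G
    by unfold_locales (use G card_gchars_pos in \<open>auto simp: c_def\<close>)
  show ?thesis using prime_in_window[OF assms(2,3)]
  proof eventually_elim
    case (elim v)
    then obtain p where "p \<in> gauss_primes" "g dvd p - b" "\<bar>ln_norm p - v\<bar> < \<epsilon>" "norm (1 - \<omega> * sgn (cg p)) < \<epsilon>" by blast
    thus ?case unfolding gauss_primes_def using dvd_minus_iff[of g "p - b"] by auto
  qed
qed

end

text \<open>The windows control modulus and direction separately, so the distance is split into a
  radial and an angular error.\<close>

lemma cmod_diff_polar_le:
  "cmod (w - z) \<le> \<bar>cmod w - cmod z\<bar> + cmod z * cmod (sgn w - sgn z)"
proof -
  have "cmod x *\<^sub>R sgn x = x" for x by (cases "x = 0") (auto simp: sgn_div_norm)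
  hence "w - z = (cmod w - cmod z) *\<^sub>R sgn w + cmod z *\<^sub>R (sgn w - sgn z)"
    by (simp add: scaleR_diff_left scaleR_diff_right)
  hence "cmod (w - z) \<le> cmod ((cmod w - cmod z) *\<^sub>R sgn w) + cmod (cmod z *\<^sub>R (sgn w - sgn z))"
    by (metis norm_triangle_ineq)
  also have "\<dots> \<le> \<bar>cmod w - cmod z\<bar> * 1 + cmod z * cmod (sgn w - sgn z)"
    by (auto simp: norm_sgn)
  finally show ?thesis by simp
qed

lemma abs_exp_minus_1_le: "\<bar>x\<bar> \<le> d \<Longrightarrow> \<bar>exp x - 1\<bar> \<le> exp d - (1 :: real)"
proof (cases "x \<ge> 0")
  case False
  assume "\<bar>x\<bar> \<le> d"
  hence "- x \<le> d" by simp
  moreover have "exp x < 1" using False by simp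
  ultimately show ?thesis using exp_ge_add_one_self[of x] exp_ge_add_one_self[of d] by linarith
qed auto

lemma prime_quotient_near:
  assumes g: "\<gamma>1 \<noteq> 0" "\<gamma>2 \<noteq> 0" "coprime \<beta>1 \<gamma>1" "coprime \<beta>2 \<gamma>2" and z: "z \<noteq> 0" and e: "e > 0"
  shows "\<exists>\<pi>1 \<pi>2. prime_elem \<pi>1 \<and> prime_elem \<pi>2 \<and> \<gamma>1 dvd (\<beta>1 - \<pi>1) \<and> \<gamma>2 dvd (\<beta>2 - \<pi>2) \<and> dist (cg \<pi>1 / cg \<pi>2) z < e"
proof -
  have "((\<lambda>d. cmod z * (exp d - 1) + cmod z * (2 * d)) \<longlongrightarrow> cmod z * (exp 0 - 1) + cmod z * (2 * 0)) (at_right (0::real))"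
    by (intro tendsto_intros)
  hence "\<forall>\<^sub>F d in at_right (0::real). cmod z * (exp d - 1) + cmod z * (2 * d) < e"
    by (rule order_tendstoD(2)) (use e in simp)
  from eventually_happens[OF eventually_conj[OF eventually_at_right_less[of 0] this]]
  obtain d where d: "d > 0" "cmod z * (exp d - 1) + cmod z * (2 * d) < e" by auto
  \<comment> \<open>With this choice \<open>\<omega> * sgn (cg p)\<close> is as close to 1 as the
    direction of \<open>p\<close> is to that of \<open>z\<close>.\<close>
  define \<omega> where "\<omega> = cnj (sgn z)"
  have sz: "norm (sgn z) = 1" using z by (simp add: norm_sgn)
  have "\<forall>\<^sub>F v in at_top. \<exists>p. prime_elem p \<and> \<gamma>1 dvd \<beta>1 - p \<and> \<bar>ln_norm p - v\<bar> < d \<and> norm (1 - \<omega> * sgn (cg p)) < d"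
    by (rule gauss_mod.progression_prime_in_window) (use g d sz in \<open>auto simp: gauss_mod_def \<omega>_def\<close>)
  \<comment> \<open>\<open>ln_norm\<close> is twice the logarithm of the modulus, so shifting the
    window by \<open>2 * ln (cmod z)\<close> scales the modulus by \<open>cmod z\<close>.\<close>
  moreover have "filterlim (\<lambda>v::real. 2 * ln (cmod z) + v) at_top at_top"
    by (rule filterlim_tendsto_add_at_top[OF tendsto_const filterlim_ident])
  ultimately have w1: "\<forall>\<^sub>F v in at_top. \<exists>p. prime_elem p \<and> \<gamma>1 dvd \<beta>1 - p \<and>
      \<bar>ln_norm p - (2 * ln (cmod z) + v)\<bar> < d \<and> norm (1 - \<omega> * sgn (cg p)) < d"
    by (rule eventually_compose_filterlim)
  have w2: "\<forall>\<^sub>F v in at_top. \<exists>p. prime_elem p \<and> \<gamma>2 dvd \<beta>2 - p \<and> \<bar>ln_norm p - v\<bar> < d \<and> norm (1 - 1 * sgn (cg p)) < d"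
    by (rule gauss_mod.progression_prime_in_window) (use g d in \<open>auto simp: gauss_mod_def\<close>)
  \<comment> \<open>Both windows contain primes for all large \<open>v\<close>, so a single
    \<open>v\<close> serves both; mere existence for some \<open>v\<close> would not match the two
    moduli.\<close>
  obtain v p1 p2 where
    p1: "prime_elem p1" "\<gamma>1 dvd \<beta>1 - p1" "\<bar>ln_norm p1 - (2 * ln (cmod z) + v)\<bar> < d" "norm (1 - \<omega> * sgn (cg p1)) < d" and
    p2: "prime_elem p2" "\<gamma>2 dvd \<beta>2 - p2" "\<bar>ln_norm p2 - v\<bar> < d" "norm (1 - 1 * sgn (cg p2)) < d"
    using eventually_happens[OF eventually_conj[OF w1 w2]] by auto
  have nz: "cg p1 \<noteq> 0" "cg p2 \<noteq> 0" using p1(1) p2(1) by (auto simp: complex_of_gauss_int_eq_0_iff)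
  define w where "w = cg p1 / cg p2"
  have ln: "ln_norm p = 2 * ln (cmod (cg p))" if "cg p \<noteq> 0" for p
    using that by (simp add: ln_norm_def gnorm_cmod ln_realpow)
  define \<eta> where "\<eta> = ln (cmod (cg p1)) - ln (cmod (cg p2)) - ln (cmod z)"
  have \<eta>: "\<bar>\<eta>\<bar> \<le> d" using p1(3) p2(3) unfolding ln[OF nz(1)] ln[OF nz(2)] \<eta>_def by linarith
  have "cmod w = cmod z * exp \<eta>" using nz z by (simp add: w_def \<eta>_def exp_diff norm_divide)
  hence "cmod w - cmod z = cmod z * (exp \<eta> - 1)" by (simp add: right_diff_distrib)
  hence "\<bar>cmod w - cmod z\<bar> = cmod z * \<bar>exp \<eta> - 1\<bar>" by (simp add: abs_mult)
  also have "\<dots> \<le> cmod z * (exp d - 1)" by (intro mult_left_mono abs_exp_minus_1_le \<eta>) simp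
  finally have 1: "\<bar>cmod w - cmod z\<bar> \<le> cmod z * (exp d - 1)" .
  have s2: "norm (sgn (cg p2)) = 1" using nz by (simp add: norm_sgn)
  have "sgn w = sgn (cg p1) / sgn (cg p2)"
    by (simp add: w_def sgn_eq norm_divide)
  moreover have "sgn (cg p2) \<noteq> 0" using s2 by auto
  ultimately have "(sgn w - sgn z) * sgn (cg p2) = sgn z * (1 - sgn (cg p2)) - (sgn z - sgn (cg p1))"
    by (simp add: algebra_simps)
  hence "norm (sgn w - sgn z) = norm (sgn z * (1 - sgn (cg p2)) - (sgn z - sgn (cg p1)))"
    by (metis mult.right_neutral norm_mult s2)
  also have "\<dots> \<le> norm (1 - sgn (cg p2)) + norm (sgn z - sgn (cg p1))"
    by (rule order_trans[OF norm_triangle_ineq4]) (simp add: norm_mult sz)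
  also have "sgn z - sgn (cg p1) = sgn z * (1 - \<omega> * sgn (cg p1))"
  proof -
    have "sgn z * \<omega> = 1" unfolding \<omega>_def using complex_norm_square[of "sgn z"] sz by simp
    thus ?thesis by (simp add: right_diff_distrib mult.assoc[symmetric])
  qed
  also have "norm \<dots> = norm (1 - \<omega> * sgn (cg p1))" by (simp add: norm_mult sz)
  finally have 2: "norm (sgn w - sgn z) \<le> 2 * d" using p1(4) p2(4) by simp
  have "dist w z \<le> cmod z * (exp d - 1) + cmod z * (2 * d)"
    unfolding dist_norm using 1 2 by (intro order_trans[OF cmod_diff_polar_le add_mono] mult_left_mono) auto
  hence "dist (cg p1 / cg p2) z < e" using d(2) unfolding w_def by linarith
  thus ?thesis using p1(1,2) p2(1,2) by blast
qed

theorem theorem2p4: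
  fixes \<beta>1 \<beta>2 \<gamma>1 \<gamma>2 :: gauss_int
  assumes "\<gamma>1 \<noteq> 0" and "\<gamma>2 \<noteq> 0"
    and "coprime \<beta>1 \<gamma>1" and "coprime \<beta>2 \<gamma>2"
  shows "closure {complex_of_gauss_int \<pi>1 / complex_of_gauss_int \<pi>2 | \<pi>1 \<pi>2.
           prime_elem \<pi>1 \<and> prime_elem \<pi>2 \<and>
           \<gamma>1 dvd (\<beta>1 - \<pi>1) \<and> \<gamma>2 dvd (\<beta>2 - \<pi>2)} = UNIV"
    (is "closure ?S = UNIV")
proof -
  have "z \<in> closure ?S" for z
    unfolding closure_approachable
  proof (intro allI impI)
    fix e :: real assume e: "e > 0"
    \<comment> \<open>The point 0 has no direction, so a nearby positive real takes its
      place.\<close>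
    define z' where "z' = (if z = 0 then of_real (e / 4) else z)"
    have z': "z' \<noteq> 0" "dist z' z < e / 2" using e by (auto simp: z'_def)
    obtain \<pi>1 \<pi>2 where \<pi>: "prime_elem \<pi>1" "prime_elem \<pi>2" "\<gamma>1 dvd (\<beta>1 - \<pi>1)" "\<gamma>2 dvd (\<beta>2 - \<pi>2)"
        "dist (cg \<pi>1 / cg \<pi>2) z' < e / 2"
      using prime_quotient_near[OF assms z'(1), of "e / 2"] e by auto
    have "dist (cg \<pi>1 / cg \<pi>2) z < e" using dist_triangle_half_l \<pi>(5) z'(2) by (metis dist_commute)
    moreover have "cg \<pi>1 / cg \<pi>2 \<in> ?S" using \<pi> by blast
    ultimately show "\<exists>y\<in>?S. dist y z < e" by blast
  qed
  thus ?thesis by blast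
qed

end
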